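(* Let $P$ be a set of $n$ points in $\mathbb{R}^3$ and $\Delta$ a fixed triangle. Then the number of triangles with vertices in $P$ that are similar to $\Delta$ is $O(n^{15/7})$. *)

theory Defs
  imports "HOL-Analysis.Analysis"
begin

text \<open>Triangle (a,b,c) is similar to triangle (p,q,r) with the correspondence
  a\<mapsto>p, b\<mapsto>q, c\<mapsto>r: corresponding side lengths are proportional
  with a positive ratio (equivalently, some similarity of R^3 maps one onto the other).\<close>
definition similar_tri ::
  "real^3 \<Rightarrow> real^3 \<Rightarrow> real^3 \<Rightarrow> real^3 \<Rightarrow> real^3 \<Rightarrow> real^3 \<Rightarrow> bool" where
  "similar_tri a b c p q r \<longleftrightarrow>
     (\<exists>k>0. dist a b = k * dist p q \<and> dist b c = k * dist q r \<and> dist c a = k * dist r p)"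

definition similar_triangles ::
  "(real^3) set \<Rightarrow> real^3 \<Rightarrow> real^3 \<Rightarrow> real^3 \<Rightarrow> (real^3) set set" where
  "similar_triangles P A B C =
     {T. T \<subseteq> P \<and> card T = 3 \<and> (\<exists>a b c. T = {a, b, c} \<and> similar_tri a b c A B C)}"

end

theory Submission
  imports Defs "HOL-Homology.Homology"
begin

text \<open>
  Let the triangle have its angle at \<open>A\<close> not right. For a pair \<open>(a, b)\<close> the third vertices \<open>c\<close>
  making \<open>abc\<close> similar to \<open>ABC\<close> form a circle, three distinct points lie on the circles of at most
  two pairs, and the task is to count incidences between the \<open>n\<close> points and these \<open>n^2\<close> circles.

  A polynomial \<open>F\<close> of degree \<open>D\<close> about \<open>n^(1/7)\<close> splits the points off its zero set into cells of at
  most \<open>n / D^3\<close> points each (up to constants), by iterated ham sandwich cuts, hence by Borsuk--Ulam. A circle on which \<open>F\<close>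
  does not vanish meets the zero set in \<open>O(D)\<close> points and visits \<open>O(D)\<close> cells, and \<open>x\<close> points of one
  cell on it cost at most \<open>2\<close> plus the number of triples among them. As the triples within cells number
  \<open>O(n^3 / D^6)\<close>, such circles carry \<open>O(D n^2 + n^3 / D^6) = O(n^(15/7))\<close> incidences.

  A circle inside the zero set is grouped with the others on the sphere around \<open>a\<close> containing it. At most \<open>D\<close> spheres
  lie in the zero set and each of them carries at most \<open>n^2\<close> incidences. Any other sphere contains only
  \<open>O(D)\<close> of the circles, two of which share at most two points; summed over all spheres
  around all \<open>a\<close> this gives \<open>O(D n^2)\<close> incidences again.
\<close>

section \<open>The Borsuk--Ulam theorem for Lipschitz maps\<close>

text \<open>The degree is chosen where the two error terms D n^2 and n^3 / D^6 meet. At this balance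
  the crude count by triples, 2 + (x choose 3) for x points in a cell, is sharp enough. A right
  angle at A is excluded because then b and its mirror image in a give the same circle, and circles
  on one sphere could share more than two points. A triangle has at most one right angle, so
  exchanging A and B removes the exception. That a sphere holds only O(D) circles of the zero set
  depends on their common angular radius: it is the angle at A for every pair and every scale, so
  one finite family of caps serves all spheres. Borsuk--Ulam is obtained from the odd degree of odd
  maps, by induction on the dimension. The induction needs the image of the equator to miss a point
  of the sphere, which can fail for continuous maps, as space-filling curves show, but not for
  Lipschitz ones. Hence the bisecting functions are built from Lipschitz substitutes of the sign,
  and exact bisection comes from a limit.\<close>

definition sph :: "nat \<Rightarrow> (nat \<Rightarrow> real) set" where
  "sph n = {x. (\<Sum>i\<le>n. (x i)\<^sup>2) = 1 \<and> (\<forall>i>n. x i = 0)}"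

text \<open>Makes the degree theory of \<open>nsphere\<close> available while all estimates are made
  on a plain set of sequences.\<close>

lemma nsphere_eq_sph: "nsphere n = top_of_set (sph n)"
  unfolding nsphere sph_def by (simp add: euclidean_product_topology)

lemma sph_abs_le_1: "x \<in> sph n \<Longrightarrow> \<bar>x i\<bar> \<le> 1"
proof (cases "i \<le> n")
  case True
  assume x: "x \<in> sph n"
  have "(x i)\<^sup>2 \<le> (\<Sum>i\<le>n. (x i)\<^sup>2)"
    using True by (intro member_le_sum) auto
  with x have "(x i)\<^sup>2 \<le> 1" by (simp add: sph_def)
  then show ?thesis by (simp add: abs_square_le_1)
qed (auto simp: sph_def)

text \<open>A closed subset of a cube that is compact by Tychonoff. Positive minima and the limit of
  the coefficient vectors in the ham sandwich argument come from it.\<close>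

lemma compact_sph: "compact (sph n)"
proof -
  have "compactin (powertop_real UNIV) (Pi\<^sub>E UNIV (\<lambda>i. {-1..1}))"
    unfolding compactin_PiE by (auto simp: compactin_euclidean_iff)
  then have c: "compact (Pi\<^sub>E UNIV (\<lambda>i::nat. {-1..1::real}))"
    by (simp add: euclidean_product_topology compactin_euclidean_iff)
  have cl: "closed (sph n)"
  proof -
    have "sph n = {x. (\<Sum>i\<le>n. (x i)\<^sup>2) = 1} \<inter> (\<Inter>i\<in>{n<..}. {x. x i = 0})"
      by (auto simp: sph_def)
    moreover have "closed {x::nat\<Rightarrow>real. (\<Sum>i\<le>n. (x i)\<^sup>2) = 1}"
      by (intro closed_Collect_eq continuous_intros) auto
    moreover have "closed {x::nat\<Rightarrow>real. x i = 0}" for i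
      by (intro closed_Collect_eq continuous_intros) auto
    ultimately show ?thesis by (metis (no_types, lifting) closed_INT closed_Int)
  qed
  have "sph n \<subseteq> Pi\<^sub>E UNIV (\<lambda>i::nat. {-1..1::real})"
    using sph_abs_le_1 by (fastforce simp: abs_le_iff)
  then show ?thesis
    using compact_Int_closed[OF c cl] by (simp add: Int_absorb1)
qed

lemma sph_uminus: "x \<in> sph n \<Longrightarrow> (\<lambda>i. - x i) \<in> sph n"
  by (simp add: sph_def)

lemma sph_nonempty: "sph n \<noteq> {}"
  using in_topspace_nsphere[of n] by (auto simp: nsphere_eq_sph)

lemma sph_Suc_0: "x \<in> sph (Suc n) \<Longrightarrow> x (Suc n) = 0 \<Longrightarrow> x \<in> sph n"
  by (auto simp: sph_def) (metis Suc_lessI)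

lemma sph_mono: "sph n \<subseteq> sph (Suc n)"
  by (auto simp: sph_def)

section \<open>Lipschitz functions on spheres\<close>

definition lip :: "nat \<Rightarrow> ((nat \<Rightarrow> real) \<Rightarrow> real) \<Rightarrow> bool" where
  "lip n f \<longleftrightarrow> (\<exists>L\<ge>0. \<forall>x\<in>sph n. \<forall>y\<in>sph n. \<bar>f x - f y\<bar> \<le> L * (\<Sum>j\<le>n. \<bar>x j - y j\<bar>))"

lemma lipE:
  assumes "lip n f"
  obtains L where "L \<ge> 0" "\<And>x y. x \<in> sph n \<Longrightarrow> y \<in> sph n \<Longrightarrow> \<bar>f x - f y\<bar> \<le> L * (\<Sum>j\<le>n. \<bar>x j - y j\<bar>)"
  using assms by (auto simp: lip_def)

lemma lip_const: "lip n (\<lambda>_. c)"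
  unfolding lip_def by (intro exI[of _ 0]) auto

lemma lip_coord: "lip n (\<lambda>x. x i)"
proof -
  have "\<bar>x i - y i\<bar> \<le> 1 * (\<Sum>j\<le>n. \<bar>x j - y j\<bar>)" if "x \<in> sph n" "y \<in> sph n" for x y
  proof (cases "i \<le> n")
    case True
    then show ?thesis using member_le_sum[of i "{..n}" "\<lambda>j. \<bar>x j - y j\<bar>"] by auto
  next
    case False
    then have "x i = 0" "y i = 0" using that by (auto simp: sph_def)
    then show ?thesis by (simp add: sum_nonneg)
  qed
  then show ?thesis unfolding lip_def by (intro exI[of _ 1]) auto
qed

lemma lip_bounded:
  assumes "lip n f" obtains B where "B \<ge> 0" "\<And>x. x \<in> sph n \<Longrightarrow> \<bar>f x\<bar> \<le> B"
proof -
  obtain L where L: "L \<ge> 0" "\<And>x y. x \<in> sph n \<Longrightarrow> y \<in> sph n \<Longrightarrow> \<bar>f x - f y\<bar> \<le> L * (\<Sum>j\<le>n. \<bar>x j - y j\<bar>)"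
    using lipE[OF assms] by blast
  obtain a where a: "a \<in> sph n" using sph_nonempty by blast
  have "\<bar>f x\<bar> \<le> \<bar>f a\<bar> + L * (\<Sum>j\<le>n. 2)" if x: "x \<in> sph n" for x
  proof -
    have "\<bar>x j - a j\<bar> \<le> 2" for j
      using sph_abs_le_1[OF x, of j] sph_abs_le_1[OF a, of j] by linarith
    then have "L * (\<Sum>j\<le>n. \<bar>x j - a j\<bar>) \<le> L * (\<Sum>j\<le>n. 2)"
      using L(1) by (intro mult_left_mono sum_mono) auto
    then show ?thesis using L(2)[OF x a] by linarith
  qed
  then show ?thesis using that[of "\<bar>f a\<bar> + L * (\<Sum>j\<le>n. 2)"] L(1) by auto
qed

lemma lip_compose:
  assumes "lip n f" and C: "\<And>x y. x \<in> sph n \<Longrightarrow> y \<in> sph n \<Longrightarrow> \<bar>g (f x) - g (f y)\<bar> \<le> C * \<bar>f x - f y\<bar>" "C \<ge> 0"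
  shows "lip n (\<lambda>x. g (f x))"
proof -
  obtain L where L: "L \<ge> 0" "\<And>x y. x \<in> sph n \<Longrightarrow> y \<in> sph n \<Longrightarrow> \<bar>f x - f y\<bar> \<le> L * (\<Sum>j\<le>n. \<bar>x j - y j\<bar>)"
    using lipE[OF assms(1)] by blast
  have "\<bar>g (f x) - g (f y)\<bar> \<le> (C * L) * (\<Sum>j\<le>n. \<bar>x j - y j\<bar>)" if "x \<in> sph n" "y \<in> sph n" for x y
    using C(1)[OF that] mult_left_mono[OF L(2)[OF that] C(2)] by (simp add: mult.assoc)
  then show ?thesis unfolding lip_def using C(2) L(1) by (intro exI[of _ "C * L"]) auto
qed

lemma lip_add:
  assumes "lip n f" "lip n g" shows "lip n (\<lambda>x. f x + g x)"
proof -
  obtain L where L: "L \<ge> 0" "\<And>x y. x \<in> sph n \<Longrightarrow> y \<in> sph n \<Longrightarrow> \<bar>f x - f y\<bar> \<le> L * (\<Sum>j\<le>n. \<bar>x j - y j\<bar>)"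
    using lipE[OF assms(1)] by blast
  obtain M where M: "M \<ge> 0" "\<And>x y. x \<in> sph n \<Longrightarrow> y \<in> sph n \<Longrightarrow> \<bar>g x - g y\<bar> \<le> M * (\<Sum>j\<le>n. \<bar>x j - y j\<bar>)"
    using lipE[OF assms(2)] by blast
  have "\<bar>(f x + g x) - (f y + g y)\<bar> \<le> (L + M) * (\<Sum>j\<le>n. \<bar>x j - y j\<bar>)" if "x \<in> sph n" "y \<in> sph n" for x y
    using L(2)[OF that] M(2)[OF that] by (simp add: distrib_right)
  then show ?thesis unfolding lip_def using M(1) L(1) by (intro exI[of _ "L + M"]) auto
qed

lemma lip_mult:
  assumes "lip n f" "lip n g" shows "lip n (\<lambda>x. f x * g x)"
proof -
  obtain L where L: "L \<ge> 0" "\<And>x y. x \<in> sph n \<Longrightarrow> y \<in> sph n \<Longrightarrow> \<bar>f x - f y\<bar> \<le> L * (\<Sum>j\<le>n. \<bar>x j - y j\<bar>)"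
    using lipE[OF assms(1)] by blast
  obtain M where M: "M \<ge> 0" "\<And>x y. x \<in> sph n \<Longrightarrow> y \<in> sph n \<Longrightarrow> \<bar>g x - g y\<bar> \<le> M * (\<Sum>j\<le>n. \<bar>x j - y j\<bar>)"
    using lipE[OF assms(2)] by blast
  obtain B where B: "B \<ge> 0" "\<And>x. x \<in> sph n \<Longrightarrow> \<bar>f x\<bar> \<le> B" using lip_bounded[OF assms(1)] by blast
  obtain C where C: "C \<ge> 0" "\<And>x. x \<in> sph n \<Longrightarrow> \<bar>g x\<bar> \<le> C" using lip_bounded[OF assms(2)] by blast
  have "\<bar>f x * g x - f y * g y\<bar> \<le> (B * M + L * C) * (\<Sum>j\<le>n. \<bar>x j - y j\<bar>)" if xy: "x \<in> sph n" "y \<in> sph n" for x y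
  proof -
    let ?d = "\<Sum>j\<le>n. \<bar>x j - y j\<bar>"
    have "f x * g x - f y * g y = f x * (g x - g y) + (f x - f y) * g y" by (simp add: algebra_simps)
    then have "\<bar>f x * g x - f y * g y\<bar> \<le> \<bar>f x\<bar> * \<bar>g x - g y\<bar> + \<bar>f x - f y\<bar> * \<bar>g y\<bar>"
      by (metis abs_mult abs_triangle_ineq)
    also have "\<dots> \<le> B * (M * ?d) + (L * ?d) * C"
      using L M B C xy by (intro add_mono mult_mono) (auto simp: sum_nonneg)
    finally show ?thesis by (simp add: algebra_simps)
  qed
  then show ?thesis unfolding lip_def using M(1) L(1) B(1) C(1) by (intro exI[of _ "B * M + L * C"]) auto
qed

lemma lip_sum: "finite I \<Longrightarrow> (\<And>i. i \<in> I \<Longrightarrow> lip n (f i)) \<Longrightarrow> lip n (\<lambda>x. \<Sum>i\<in>I. f i x)"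
  by (induction I rule: finite_induct) (auto intro: lip_const lip_add)

lemma lip_diff: "lip n f \<Longrightarrow> lip n g \<Longrightarrow> lip n (\<lambda>x. f x - g x)"
  using lip_add[of n f "\<lambda>x. (-1) * g x"] lip_mult[OF lip_const[of n "-1"], of g] by simp

lemma lip_abs: "lip n f \<Longrightarrow> lip n (\<lambda>x. \<bar>f x\<bar>)"
  by (rule lip_compose[where g = abs and C = 1]) auto

lemma lip_restrict: assumes "lip (Suc n) f" shows "lip n f"
proof -
  obtain L where L: "L \<ge> 0" "\<And>x y. x \<in> sph (Suc n) \<Longrightarrow> y \<in> sph (Suc n) \<Longrightarrow> \<bar>f x - f y\<bar> \<le> L * (\<Sum>j\<le>Suc n. \<bar>x j - y j\<bar>)"
    using lipE[OF assms(1)] by blast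
  have "\<bar>f x - f y\<bar> \<le> L * (\<Sum>j\<le>n. \<bar>x j - y j\<bar>)" if xy: "x \<in> sph n" "y \<in> sph n" for x y
  proof -
    have "x (Suc n) = 0" "y (Suc n) = 0" using xy by (auto simp: sph_def)
    then show ?thesis using L(2)[of x y] xy sph_mono by auto
  qed
  then show ?thesis unfolding lip_def using L(1) by blast
qed

lemma lip_continuous_on: assumes "lip n f" shows "continuous_on (sph n) f"
proof -
  obtain L where L: "L \<ge> 0" "\<And>x y. x \<in> sph n \<Longrightarrow> y \<in> sph n \<Longrightarrow> \<bar>f x - f y\<bar> \<le> L * (\<Sum>j\<le>n. \<bar>x j - y j\<bar>)"
    using lipE[OF assms(1)] by blast
  show ?thesis unfolding continuous_on_def
  proof
    fix x assume x: "x \<in> sph n"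
    have c: "continuous_on (sph n) (\<lambda>y. L * (\<Sum>j\<le>n. \<bar>y j - x j\<bar>))"
      by (intro continuous_intros continuous_on_subset[OF continuous_on_product_coordinates]) auto
    then have "((\<lambda>y. L * (\<Sum>j\<le>n. \<bar>y j - x j\<bar>)) \<longlongrightarrow> 0) (at x within sph n)"
      using x by (force simp: continuous_on_def)
    moreover have "\<forall>\<^sub>F y in at x within sph n. norm (f y - f x) \<le> L * (\<Sum>j\<le>n. \<bar>y j - x j\<bar>)"
      using L(2) x by (auto simp: eventually_at_topological)
    ultimately have "((\<lambda>y. f y - f x) \<longlongrightarrow> 0) (at x within sph n)"
      by (rule Lim_null_comparison[rotated])
    then show "(f \<longlongrightarrow> f x) (at x within sph n)"
      by (simp add: LIM_zero_iff)
  qed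
qed

text \<open>Radial projection to the sphere, with the coordinates beyond n cut off.\<close>

definition normalize_upto :: "nat \<Rightarrow> (nat \<Rightarrow> real) \<Rightarrow> nat \<Rightarrow> real" where
  "normalize_upto n v = (\<lambda>i. if i \<le> n then v i / sqrt (\<Sum>j\<le>n. (v j)\<^sup>2) else 0)"

lemma normalize_upto_in_sph:
  assumes "i \<le> n" "v i \<noteq> 0" shows "normalize_upto n v \<in> sph n"
proof -
  have "(\<Sum>j\<le>n. (v j)\<^sup>2) > 0"
    using assms by (intro sum_pos2[of _ i]) auto
  then show ?thesis
    by (simp add: sph_def normalize_upto_def power_divide flip: sum_divide_distrib)
qed

text \<open>By compactness s has a positive minimum d^2. With p and q the two square roots, the
  difference of the inverses is |p^2 - q^2| / (p q (p + q)), whose denominator is at least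
  d^3.\<close>

lemma lip_inverse_sqrt:
  assumes "lip n s" "\<And>x. x \<in> sph n \<Longrightarrow> s x > 0"
  shows "lip n (\<lambda>x. 1 / sqrt (s x))"
proof -
  obtain a where a: "a \<in> sph n" "\<And>x. x \<in> sph n \<Longrightarrow> s a \<le> s x"
    using continuous_attains_inf[OF compact_sph sph_nonempty lip_continuous_on[OF assms(1)]] by blast
  define d where "d = sqrt (s a)"
  have d: "d > 0" using assms(2) a by (simp add: d_def)
  have dle: "d \<le> sqrt (s x)" if "x \<in> sph n" for x using a that by (simp add: d_def)
  show ?thesis
  proof (rule lip_compose[where f = s and g = "\<lambda>t. 1 / sqrt t" and C = "1 / d ^ 3"])
    fix x y assume x: "x \<in> sph n" and y: "y \<in> sph n"
    define p q where "p = sqrt (s x)" and "q = sqrt (s y)"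
    have pq: "p \<ge> d" "q \<ge> d" "p > 0" "q > 0" using dle x y assms(2) by (auto simp: p_def q_def)
    have sq: "s x = p\<^sup>2" "s y = q\<^sup>2" using assms(2) x y by (auto simp: p_def q_def less_imp_le)
    have d3: "d ^ 3 \<le> p * q * (p + q)"
    proof -
      have "d * d * d \<le> p * q * (p + q)"
        using pq d by (intro mult_mono) auto
      then show ?thesis by (simp add: power3_eq_cube)
    qed
    have "\<bar>1/p - 1/q\<bar> = \<bar>q - p\<bar> / (p * q)"
    proof -
      have "1/p - 1/q = (q - p) / (p * q)" using pq by (simp add: diff_frac_eq)
      then show ?thesis using pq by (simp add: abs_mult)
    qed
    also have "\<dots> = \<bar>s x - s y\<bar> / (p * q * (p + q))"
    proof -
      have "\<bar>s x - s y\<bar> = \<bar>q - p\<bar> * (p + q)"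
        unfolding sq using pq by (simp add: power2_eq_square square_diff_square_factored abs_mult abs_minus_commute)
      then show ?thesis using pq by simp
    qed
    also have "\<dots> \<le> \<bar>s x - s y\<bar> / d ^ 3"
      using d3 d pq by (intro divide_left_mono) auto
    finally show "\<bar>1 / sqrt (s x) - 1 / sqrt (s y)\<bar> \<le> 1 / d ^ 3 * \<bar>s x - s y\<bar>"
      by (simp add: p_def q_def)
  qed (use assms d in auto)
qed

lemma lip_normalize_upto:
  assumes "\<And>i. i \<le> m \<Longrightarrow> lip n (\<lambda>x. v x i)" "\<And>x. x \<in> sph n \<Longrightarrow> \<exists>i\<le>m. v x i \<noteq> 0"
  shows "lip n (\<lambda>x. normalize_upto m (v x) i)"
proof (cases "i \<le> m")
  case True
  have l: "lip n (\<lambda>x. \<Sum>j\<le>m. (v x j)\<^sup>2)"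
    unfolding power2_eq_square by (intro lip_sum lip_mult assms(1)) auto
  have "(\<Sum>j\<le>m. (v x j)\<^sup>2) > 0" if "x \<in> sph n" for x
    using assms(2)[OF that] by (meson atMost_iff finite_atMost sum_pos2 zero_le_power2 zero_less_power2)
  then have "lip n (\<lambda>x. v x i * (1 / sqrt (\<Sum>j\<le>m. (v x j)\<^sup>2)))"
    by (intro lip_mult lip_inverse_sqrt l assms(1) True)
  then show ?thesis using True by (simp add: normalize_upto_def)
qed (simp add: normalize_upto_def lip_const)

text \<open>Where coordinate j stays away from 0, the sphere is a graph over the other coordinates:
  the difference of the squares of x j and y j is controlled by the others, and |x j + y j| is at
  least 2 / (n + 1) because the signs agree.\<close>

lemma lip_same_cell:
  assumes x: "x \<in> sph n" and y: "y \<in> sph n" and j: "j \<le> n"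
    and xj: "\<bar>x j\<bar> \<ge> 1 / real (Suc n)" and yj: "\<bar>y j\<bar> \<ge> 1 / real (Suc n)"
    and sgn: "x j > 0 \<longleftrightarrow> y j > 0"
    and d: "\<And>i. i \<le> n \<Longrightarrow> i \<noteq> j \<Longrightarrow> \<bar>x i - y i\<bar> \<le> e" and e: "e \<ge> 0"
  shows "(\<Sum>i\<le>n. \<bar>x i - y i\<bar>) \<le> real (Suc (Suc n)) * real (Suc n) * e"
proof -
  let ?J = "{..n} - {j}"
  let ?D = "\<Sum>i\<in>?J. \<bar>x i - y i\<bar>"
  have D: "?D \<le> real (Suc n) * e"
  proof -
    have "?D \<le> (\<Sum>i\<in>?J. e)" using d by (intro sum_mono) auto
    also have "\<dots> \<le> real (Suc n) * e" using e j by (auto intro!: mult_right_mono)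
    finally show ?thesis .
  qed
  have "(x j)\<^sup>2 + (\<Sum>i\<in>?J. (x i)\<^sup>2) = 1" "(y j)\<^sup>2 + (\<Sum>i\<in>?J. (y i)\<^sup>2) = 1"
    using x y j by (simp_all add: sph_def sum.remove)
  then have "(x j)\<^sup>2 - (y j)\<^sup>2 = (\<Sum>i\<in>?J. (y i)\<^sup>2 - (x i)\<^sup>2)"
    by (simp add: sum_subtractf)
  also have "\<bar>\<dots>\<bar> \<le> (\<Sum>i\<in>?J. \<bar>(y i)\<^sup>2 - (x i)\<^sup>2\<bar>)" by (rule sum_abs)
  also have "\<dots> \<le> (\<Sum>i\<in>?J. 2 * \<bar>x i - y i\<bar>)"
  proof (rule sum_mono)
    fix i
    have "\<bar>(y i)\<^sup>2 - (x i)\<^sup>2\<bar> = \<bar>y i + x i\<bar> * \<bar>x i - y i\<bar>"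
      by (simp add: power2_eq_square square_diff_square_factored abs_mult abs_minus_commute)
    also have "\<dots> \<le> 2 * \<bar>x i - y i\<bar>"
      using sph_abs_le_1[OF x, of i] sph_abs_le_1[OF y, of i] by (intro mult_right_mono) auto
    finally show "\<bar>(y i)\<^sup>2 - (x i)\<^sup>2\<bar> \<le> 2 * \<bar>x i - y i\<bar>" .
  qed
  also have "\<dots> = 2 * ?D" by (simp add: sum_distrib_left)
  finally have 1: "\<bar>(x j)\<^sup>2 - (y j)\<^sup>2\<bar> \<le> 2 * ?D" .
  have "\<bar>x j + y j\<bar> \<ge> 2 / real (Suc n)"
  proof -
    have "\<bar>x j + y j\<bar> = \<bar>x j\<bar> + \<bar>y j\<bar>" using sgn by linarith
    then show ?thesis using xj yj by (simp add: field_simps)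
  qed
  then have "2 / real (Suc n) * \<bar>x j - y j\<bar> \<le> \<bar>x j + y j\<bar> * \<bar>x j - y j\<bar>"
    by (intro mult_right_mono) auto
  also have "\<dots> = \<bar>(x j)\<^sup>2 - (y j)\<^sup>2\<bar>"
    by (simp add: power2_eq_square square_diff_square_factored abs_mult)
  finally have "2 / real (Suc n) * \<bar>x j - y j\<bar> \<le> 2 * ?D" using 1 by linarith
  then have "\<bar>x j - y j\<bar> \<le> real (Suc n) * ?D"
    by (simp add: field_simps)
  moreover have "(\<Sum>i\<le>n. \<bar>x i - y i\<bar>) = \<bar>x j - y j\<bar> + ?D"
    using j by (simp add: sum.remove)
  ultimately have "(\<Sum>i\<le>n. \<bar>x i - y i\<bar>) \<le> real (Suc (Suc n)) * ?D"
    by (simp add: algebra_simps)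
  also have "\<dots> \<le> real (Suc (Suc n)) * (real (Suc n) * e)"
    using D by (intro mult_left_mono) auto
  finally show ?thesis by (simp add: mult.assoc)
qed

lemma grid_coordinate_le: "a < b \<Longrightarrow> m > 0 \<Longrightarrow> real a / (real b * real m) \<le> 1 / real m"
  by (simp add: field_simps)

text \<open>A Lipschitz map cannot raise dimension: \<open>sph n\<close> is covered by \<open>O(N^n)\<close> sets of diameter \<open>O(1/N)\<close>,
  whereas \<open>sph (Suc n)\<close> contains \<open>N^(n + 1)\<close> points at mutual distance of order \<open>1/N\<close>.\<close>

lemma lip_sph_not_surj:
  fixes k :: "(nat \<Rightarrow> real) \<Rightarrow> nat \<Rightarrow> real"
  assumes lip: "\<And>i. lip n (\<lambda>x. k x i)"
  shows "\<exists>p\<in>sph (Suc n). p \<notin> k ` sph n"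
proof (rule ccontr)
  assume "\<not> ?thesis"
  then have surj: "\<And>p. p \<in> sph (Suc n) \<Longrightarrow> \<exists>x\<in>sph n. k x = p" by fastforce
  define m where "m = Suc n"
  have "\<forall>i. \<exists>L\<ge>0. \<forall>x\<in>sph n. \<forall>y\<in>sph n. \<bar>k x i - k y i\<bar> \<le> L * (\<Sum>j\<le>n. \<bar>x j - y j\<bar>)"
    using lip by (simp add: lip_def)
  then obtain Lf where Lf: "\<And>i. Lf i \<ge> 0"
    "\<And>i x y. x \<in> sph n \<Longrightarrow> y \<in> sph n \<Longrightarrow> \<bar>k x i - k y i\<bar> \<le> Lf i * (\<Sum>j\<le>n. \<bar>x j - y j\<bar>)"
    by metis
  define L where "L = (\<Sum>i\<le>n. Lf i)"
  have L0: "L \<ge> 0" using Lf(1) by (simp add: L_def sum_nonneg)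
  have L: "\<bar>k x i - k y i\<bar> \<le> L * (\<Sum>j\<le>n. \<bar>x j - y j\<bar>)" if "x \<in> sph n" "y \<in> sph n" "i \<le> n" for x y i
  proof -
    have "Lf i \<le> L" unfolding L_def using that Lf(1) by (intro member_le_sum) auto
    then have "Lf i * (\<Sum>j\<le>n. \<bar>x j - y j\<bar>) \<le> L * (\<Sum>j\<le>n. \<bar>x j - y j\<bar>)"
      by (intro mult_right_mono) (auto simp: sum_nonneg)
    then show ?thesis using Lf(2)[OF that(1,2), of i] by linarith
  qed
  \<comment> \<open>c makes the cells of width 1 / (c N) so fine that their images are narrower than
    the grid spacing 1 / (N m).\<close>
  obtain c :: nat where c: "real c > L * (real (Suc m) * real m) * real m"
    using reals_Archimedean2 by blast
  have c1: "c \<ge> 1"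
  proof -
    have "0 \<le> L * (real (Suc m) * real m) * real m" using L0 by auto
    then show ?thesis using c by linarith
  qed
  \<comment> \<open>Large enough that the N^(n + 1) grid points outnumber the at most 2 m (3 c N)^n
    cells.\<close>
  define N :: nat where "N = 2 * m * (3 * c) ^ n + 1"
  have N1: "N \<ge> 1" by (simp add: N_def)
  define K where "K = c * N"
  have K1: "K \<ge> 1" using c1 N1 by (simp add: K_def)
  define G where "G = Pi\<^sub>E {..n} (\<lambda>_. {..<N})"
  \<comment> \<open>The grid lies in a cube of side 1 / m. It fits under the hemisphere, since m
    squares of at most 1 / m add up to at most 1, and the last coordinate lifts it there.\<close>
  define q where "q z = (\<lambda>i. if i \<le> n then real (z i) / (real N * real m)
      else if i = Suc n then sqrt (1 - (\<Sum>i\<le>n. (real (z i) / (real N * real m))\<^sup>2)) else 0)" for z :: "nat \<Rightarrow> nat"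
  have q: "q z \<in> sph (Suc n)" if "z \<in> G" for z
  proof -
    have "(\<Sum>i\<le>n. (real (z i) / (real N * real m))\<^sup>2) \<le> (\<Sum>i\<le>n. 1 / real m)"
    proof (rule sum_mono)
      fix i assume "i \<in> {..n}"
      have "z i < N" using \<open>i \<in> {..n}\<close> that by (auto simp: G_def)
      then have a: "real (z i) / (real N * real m) \<le> 1 / real m"
        using N1 \<open>z i < N\<close> by (intro grid_coordinate_le) (auto simp: m_def)
      moreover have "1 / real m \<le> 1" by (simp add: m_def)
      ultimately have "(real (z i) / (real N * real m)) * (real (z i) / (real N * real m)) \<le> 1 * (1 / real m)"
        by (intro mult_mono) auto
      then show "(real (z i) / (real N * real m))\<^sup>2 \<le> 1 / real m" by (simp add: power2_eq_square)
    qed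
    also have "\<dots> = 1" by (simp add: m_def)
    finally show ?thesis by (simp add: sph_def q_def)
  qed
  have "\<forall>z\<in>G. \<exists>x\<in>sph n. k x = q z" using surj q by blast
  then obtain X where X: "\<And>z. z \<in> G \<Longrightarrow> X z \<in> sph n" "\<And>z. z \<in> G \<Longrightarrow> k (X z) = q z" by metis
  \<comment> \<open>The square of a number of modulus at most 1 does not exceed its modulus, so m
    moduli below 1 / m could not have squares with sum 1.\<close>
  have "\<exists>j\<le>n. \<bar>x j\<bar> \<ge> 1 / real m" if "x \<in> sph n" for x
  proof (rule ccontr)
    assume "\<not> ?thesis"
    then have a: "\<And>j. j \<le> n \<Longrightarrow> \<bar>x j\<bar> < 1 / real m" by (meson not_le)
    have "(\<Sum>i\<le>n. (x i)\<^sup>2) < (\<Sum>i\<le>n. 1 / real m)"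
    proof (rule sum_strict_mono)
      fix i assume "i \<in> {..n}"
      then have a: "\<bar>x i\<bar> < 1 / real m" using a by auto
      have "(x i)\<^sup>2 = \<bar>x i\<bar> * \<bar>x i\<bar>" by (simp add: power2_eq_square)
      also have "\<dots> \<le> \<bar>x i\<bar> * 1" using sph_abs_le_1[OF that] by (intro mult_left_mono) auto
      finally show "(x i)\<^sup>2 < 1 / real m" using a by simp
    qed auto
    then show False using that by (simp add: sph_def m_def)
  qed
  then obtain J where J: "\<And>x. x \<in> sph n \<Longrightarrow> J x \<le> n" "\<And>x. x \<in> sph n \<Longrightarrow> \<bar>x (J x)\<bar> \<ge> 1 / real m" by metis
  \<comment> \<open>A cell is given by the place of a large coordinate, its sign, and the n others
    rounded at scale 1 / K; omitting the large coordinate brings the exponent of K down to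
    n.\<close>
  define ix where "ix x = (J x, (x (J x) > 0, restrict (\<lambda>i. \<lfloor>real K * x i\<rfloor>) ({..n} - {J x})))" for x
  define I where "I = Sigma {..n} (\<lambda>j. (UNIV::bool set) \<times> Pi\<^sub>E ({..n} - {j}) (\<lambda>_. {- int K..int K}))"
  have ixI: "ix x \<in> I" if "x \<in> sph n" for x
  proof -
    have "- int K \<le> \<lfloor>real K * x i\<rfloor> \<and> \<lfloor>real K * x i\<rfloor> \<le> int K" for i
    proof -
      have "x i \<le> 1" "- 1 \<le> x i" using sph_abs_le_1[OF that, of i] by auto
      then have "real K * x i \<le> real K * 1" "real K * (-1) \<le> real K * x i" by (intro mult_left_mono; auto)+
      then have "real_of_int (- int K) \<le> real K * x i" "real K * x i < real_of_int (int K) + 1" by auto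
      then show ?thesis unfolding le_floor_iff floor_le_iff by simp
    qed
    then show ?thesis using J(1)[OF that] by (auto simp: ix_def I_def)
  qed
  have "inj_on (\<lambda>z. ix (X z)) G"
  proof (rule inj_onI)
    fix z w assume z: "z \<in> G" and w: "w \<in> G" and eq: "ix (X z) = ix (X w)"
    define x y j where "x = X z" and "y = X w" and "j = J x"
    have xy: "x \<in> sph n" "y \<in> sph n" using X z w by (auto simp: x_def y_def)
    have jy: "J y = j" and sg: "x j > 0 \<longleftrightarrow> y j > 0"
      and r: "restrict (\<lambda>i. \<lfloor>real K * x i\<rfloor>) ({..n} - {j}) = restrict (\<lambda>i. \<lfloor>real K * y i\<rfloor>) ({..n} - {j})"
      using eq by (auto simp: ix_def x_def y_def j_def)
    have "\<bar>x i - y i\<bar> \<le> 1 / real K" if "i \<le> n" "i \<noteq> j" for i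
    proof -
      have "\<lfloor>real K * x i\<rfloor> = \<lfloor>real K * y i\<rfloor>" using fun_cong[OF r, of i] that by simp
      then have "\<bar>real K * x i - real K * y i\<bar> \<le> 1" by linarith
      then have "real K * \<bar>x i - y i\<bar> \<le> 1" by (simp add: abs_mult flip: right_diff_distrib)
      then show ?thesis using K1 by (simp add: field_simps)
    qed
    then have "(\<Sum>i\<le>n. \<bar>x i - y i\<bar>) \<le> real (Suc (Suc n)) * real (Suc n) * (1 / real K)"
    proof (intro lip_same_cell[of x n y j])
      show "j \<le> n" "1 / real (Suc n) \<le> \<bar>x j\<bar>" using J[OF xy(1)] by (auto simp: j_def m_def)
      show "1 / real (Suc n) \<le> \<bar>y j\<bar>" using J(2)[OF xy(2)] jy by (auto simp: m_def)
    qed (use xy sg in auto)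
    then have "L * (\<Sum>i\<le>n. \<bar>x i - y i\<bar>) \<le> L * (real (Suc m) * real m * (1 / real K))"
      using L0 by (intro mult_left_mono) (auto simp: m_def)
    also have "\<dots> = (L * (real (Suc m) * real m) * real m / real c) * (1 / (real N * real m))"
      by (simp add: K_def m_def)
    also have "\<dots> < 1 * (1 / (real N * real m))"
      using c c1 N1 by (intro mult_strict_right_mono) (auto simp: m_def divide_simps simp del: of_nat_Suc)
    also have "\<dots> = 1 / (real N * real m)" by simp
    finally have small: "L * (\<Sum>i\<le>n. \<bar>x i - y i\<bar>) < 1 / (real N * real m)" .
    have "z i = w i" if i: "i \<le> n" for i
    proof (rule ccontr)
      assume ne: "z i \<noteq> w i"
      have "\<bar>real (z i) / (real N * real m) - real (w i) / (real N * real m)\<bar> = \<bar>real (z i) - real (w i)\<bar> / (real N * real m)"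
        by (simp add: diff_divide_distrib[symmetric])
      also have "\<dots> \<ge> 1 / (real N * real m)" using ne by (intro divide_right_mono) auto
      finally have "\<bar>k x i - k y i\<bar> \<ge> 1 / (real N * real m)"
        using i X z w by (simp add: x_def y_def q_def)
      then show False using L[OF xy i] small by linarith
    qed
    then show "z = w" using z w unfolding G_def by (intro PiE_ext) auto
  qed
  moreover have "finite I"
    unfolding I_def by (intro finite_SigmaI finite_cartesian_product finite_PiE) auto
  ultimately have "card G \<le> card I"
    using ixI X(1) by (intro card_inj_on_le[of "\<lambda>z. ix (X z)"]) auto
  moreover have "card G = N ^ m" by (simp add: G_def card_PiE m_def)
  moreover have "card I = m * (2 * (2 * K + 1) ^ n)"
  proof -
    have "card I = (\<Sum>j\<le>n. card ((UNIV::bool set) \<times> Pi\<^sub>E ({..n} - {j}) (\<lambda>_. {- int K..int K})))"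
      unfolding I_def by (intro card_SigmaI) (auto intro!: finite_PiE)
    also have "\<dots> = (\<Sum>j\<le>n. 2 * (2 * K + 1) ^ n)"
    proof (rule sum.cong)
      fix j assume "j \<in> {..n}"
      moreover have "nat (int K + 1 + int K) = 2 * K + 1" by simp
      ultimately show "card ((UNIV::bool set) \<times> Pi\<^sub>E ({..n} - {j}) (\<lambda>_. {- int K..int K})) = 2 * (2 * K + 1) ^ n"
        by (simp add: card_cartesian_product card_PiE)
    qed auto
    finally show ?thesis by (simp add: m_def)
  qed
  ultimately have "N ^ m \<le> m * (2 * (2 * K + 1) ^ n)" by simp
  also have "\<dots> \<le> m * (2 * (3 * c * N) ^ n)"
    using K1 by (intro mult_le_mono power_mono order_refl) (auto simp: K_def)
  finally have "N * N ^ n \<le> (2 * m * (3 * c) ^ n) * N ^ n"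
    by (simp add: m_def power_mult_distrib algebra_simps)
  then have "N \<le> 2 * m * (3 * c) ^ n" using N1 by simp
  then show False by (simp add: N_def)
qed

section \<open>Parity of the degree of odd maps\<close>

definition odd_lip :: "nat \<Rightarrow> ((nat \<Rightarrow> real) \<Rightarrow> nat \<Rightarrow> real) \<Rightarrow> bool" where
  "odd_lip n k \<longleftrightarrow> k ` sph n \<subseteq> sph n \<and> (\<forall>i. lip n (\<lambda>x. k x i)) \<and>
     (\<forall>x\<in>sph n. k (\<lambda>i. - x i) = (\<lambda>i. - k x i))"

lemma odd_lip_continuous_map: "odd_lip n k \<Longrightarrow> continuous_map (nsphere n) (nsphere n) k"
  unfolding nsphere_eq_sph odd_lip_def
  by (auto intro!: continuous_on_coordinatewise_then_product lip_continuous_on)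

lemma exists_swapping_reflection:
  \<comment> \<open>For \<open>p = q\<close> the formula for \<open>T\<close> divides by \<open>c = 0\<close> and thereby yields the identity.\<close>
  assumes p: "p \<in> sph n" and q: "q \<in> sph n"
  obtains T where "odd_lip n T" "T p = q" "\<And>x. x \<in> sph n \<Longrightarrow> T (T x) = x"
proof
  define w where "w = (\<lambda>i. p i - q i)"
  define ip where "ip x y = (\<Sum>i\<le>n. x i * y i)" for x y :: "nat \<Rightarrow> real"
  have ip: "ip x x = 1" if "x \<in> sph n" for x
    using that by (simp add: ip_def sph_def power2_eq_square)
  define c where "c = ip w w"
  have c: "c = 2 - 2 * ip p q"
  proof -
    have "c = ip p p + ip q q - 2 * ip p q"
      by (simp add: c_def ip_def w_def algebra_simps sum.distrib sum_subtractf sum_distrib_left)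
    then show ?thesis using ip p q by simp
  qed
  define T where "T x = (\<lambda>i. x i - 2 * ip x w / c * w i)" for x
  have wz: "w i = 0" if "i > n" for i using p q that by (simp add: w_def sph_def)
  have lin: "ip (\<lambda>i. x i - a * w i) y = ip x y - a * ip w y" for x y a
    by (simp add: ip_def left_diff_distrib sum_subtractf sum_distrib_left mult.assoc)
  have sym: "ip x y = ip y x" for x y by (simp add: ip_def mult.commute)
  have Tw: "ip (T x) w = - ip x w" if "c \<noteq> 0" for x
    unfolding T_def lin using that by (simp flip: c_def)
  have TT: "ip (T x) (T x) = ip x x" for x
  proof -
    define a where "a = 2 * ip x w / c"
    have T: "T x = (\<lambda>i. x i - a * w i)" by (simp add: T_def a_def)
    have "ip (T x) (T x) = ip x x - 2 * a * ip x w + a * a * c"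
      unfolding T lin by (simp add: sym[of _ "\<lambda>i. x i - a * w i"] lin sym[of w x] c_def algebra_simps)
    then show ?thesis by (cases "c = 0") (auto simp: a_def)
  qed
  have Tsph: "T x \<in> sph n" if "x \<in> sph n" for x
  proof -
    have "ip (T x) (T x) = 1" using TT ip that by simp
    then show ?thesis using that wz by (auto simp: sph_def ip_def power2_eq_square T_def)
  qed
  show "odd_lip n T"
    unfolding odd_lip_def
  proof (intro conjI allI ballI)
    show "T ` sph n \<subseteq> sph n" using Tsph by auto
    show "lip n (\<lambda>x. T x i)" for i
      unfolding T_def ip_def divide_inverse
      by (intro lip_diff lip_mult lip_const lip_coord lip_sum) auto
    show "T (\<lambda>i. - x i) = (\<lambda>i. - T x i)" for x
      by (auto simp: T_def ip_def sum_negf)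
  qed
  show "T p = q"
  proof (cases "c = 0")
    case True
    then have "(\<Sum>i\<le>n. (w i)\<^sup>2) = 0" by (simp add: c_def ip_def power2_eq_square)
    then have "w i = 0" for i
      using wz[of i] by (cases "i \<le> n") (auto simp: sum_nonneg_eq_0_iff)
    then have "p = q" by (auto simp: w_def)
    then show ?thesis using True by (simp add: T_def)
  next
    case False
    have "ip p w = ip p p - ip p q"
      by (simp add: ip_def w_def algebra_simps sum_subtractf)
    then have "2 * ip p w = c" using c ip p by simp
    then show ?thesis using False by (simp add: T_def w_def)
  qed
  show "T (T x) = x" if "x \<in> sph n" for x
  proof (cases "c = 0")
    case False
    have "T (T x) = (\<lambda>i. T x i - 2 * ip (T x) w / c * w i)" by (simp add: T_def)
    then show ?thesis using Tw[OF False, of x] by (simp add: T_def)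
  qed (simp add: T_def)
qed

text \<open>An involution is a homeomorphism, so its degree is 1 or -1.\<close>

lemma odd_Brouwer_degree2_involution:
  assumes "odd_lip n T" "\<And>x. x \<in> sph n \<Longrightarrow> T (T x) = x"
  shows "odd (Brouwer_degree2 n T)"
proof -
  have "homeomorphic_maps (nsphere n) (nsphere n) T T"
    using assms odd_lip_continuous_map by (simp add: homeomorphic_maps_def nsphere_eq_sph)
  then have "\<bar>Brouwer_degree2 n T\<bar> = 1" by (rule Brouwer_degree2_homeomorphic_maps)
  then show ?thesis by presburger
qed

text \<open>Degrees multiply. This permits a reflection to move a missed point to the pole without
  changing the parity.\<close>

lemma odd_lip_compose_degree:
  assumes k: "odd_lip n k" and T: "odd_lip n T" "\<And>x. x \<in> sph n \<Longrightarrow> T (T x) = x"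
  shows "odd (Brouwer_degree2 n (T \<circ> k)) = odd (Brouwer_degree2 n k)"
  using Brouwer_degree2_compose[OF odd_lip_continuous_map[OF k] odd_lip_continuous_map[OF T(1)]]
    odd_Brouwer_degree2_involution[OF T] by simp

lemma lip_comp_sph:
  assumes "\<And>i. lip n (\<lambda>x. k x i)" "k ` sph n \<subseteq> sph n" "lip n f"
  shows "lip n (\<lambda>x. f (k x))"
proof -
  obtain L where L: "L \<ge> 0" "\<And>x y. x \<in> sph n \<Longrightarrow> y \<in> sph n \<Longrightarrow> \<bar>f x - f y\<bar> \<le> L * (\<Sum>j\<le>n. \<bar>x j - y j\<bar>)"
    using lipE[OF assms(3)] by blast
  have "\<forall>i. \<exists>M\<ge>0. \<forall>x\<in>sph n. \<forall>y\<in>sph n. \<bar>k x i - k y i\<bar> \<le> M * (\<Sum>j\<le>n. \<bar>x j - y j\<bar>)"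
    using assms(1) by (simp add: lip_def)
  then obtain M where M: "\<And>i. M i \<ge> 0"
    "\<And>i x y. x \<in> sph n \<Longrightarrow> y \<in> sph n \<Longrightarrow> \<bar>k x i - k y i\<bar> \<le> M i * (\<Sum>j\<le>n. \<bar>x j - y j\<bar>)"
    by metis
  have "\<bar>f (k x) - f (k y)\<bar> \<le> (L * (\<Sum>i\<le>n. M i)) * (\<Sum>j\<le>n. \<bar>x j - y j\<bar>)"
    if xy: "x \<in> sph n" "y \<in> sph n" for x y
  proof -
    have "\<bar>f (k x) - f (k y)\<bar> \<le> L * (\<Sum>i\<le>n. \<bar>k x i - k y i\<bar>)" using L(2) assms(2) xy by blast
    also have "\<dots> \<le> L * (\<Sum>i\<le>n. M i * (\<Sum>j\<le>n. \<bar>x j - y j\<bar>))"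
      using M(2) xy L(1) by (intro mult_left_mono sum_mono) auto
    finally show ?thesis by (simp add: sum_distrib_right mult.assoc)
  qed
  then show ?thesis unfolding lip_def using L(1) M(1)
    by (intro exI[of _ "L * (\<Sum>i\<le>n. M i)"]) (auto intro!: mult_nonneg_nonneg sum_nonneg)
qed

lemma odd_lip_compose:
  assumes "odd_lip n k" "odd_lip n T" shows "odd_lip n (T \<circ> k)"
  unfolding odd_lip_def
proof (intro conjI allI ballI)
  show "(T \<circ> k) ` sph n \<subseteq> sph n" using assms by (auto simp: odd_lip_def)
  show "lip n (\<lambda>x. (T \<circ> k) x i)" for i
    using lip_comp_sph[of n k "\<lambda>x. T x i"] assms by (simp add: odd_lip_def)
  show "(T \<circ> k) (\<lambda>i. - x i) = (\<lambda>i. - (T \<circ> k) x i)" if "x \<in> sph n" for x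
    using assms that by (simp add: odd_lip_def image_subset_iff)
qed

lemma sph_pole:
  assumes "x \<in> sph (Suc n)" "\<And>i. i \<le> n \<Longrightarrow> x i = 0"
  shows "x = (\<lambda>i. if i = Suc n then 1 else 0) \<or> x = (\<lambda>i. - (if i = Suc n then 1 else 0))"
proof -
  have "(x (Suc n))\<^sup>2 = 1" using assms by (simp add: sph_def)
  then have "x (Suc n) = 1 \<or> x (Suc n) = - 1" by (simp add: power2_eq_1_iff)
  moreover have "x i = 0" if "i \<noteq> Suc n" for i
    using that assms by (cases "i \<le> n") (auto simp: sph_def)
  ultimately show ?thesis by (auto simp: fun_eq_iff)
qed

text \<open>The theorem \<open>Borsuk_odd_mapping_degree_step\<close> needs a map that preserves the equator. Once the image of the equator
  avoids the poles, scaling down the last coordinate, completely so only over the equator, and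
  normalizing is an odd homotopy to such a map.\<close>

lemma odd_lip_homotopic_equator:
  assumes k: "odd_lip (Suc n) k" and miss: "(\<lambda>i. if i = Suc n then 1 else 0) \<notin> k ` sph n"
  obtains h where "odd_lip (Suc n) h" "h ` sph n \<subseteq> sph n"
    "homotopic_with (\<lambda>_. True) (nsphere (Suc n)) (nsphere (Suc n)) k h"
proof
  let ?m = "Suc n"
  let ?e = "\<lambda>i. if i = ?m then 1 else (0::real)"
  \<comment> \<open>The absolute value keeps \<open>v t\<close> odd. At t = 1 the factor is
    \<open>\<bar>x ?m\<bar>\<close>, at t = 0 it is 1.\<close>
  define v where "v t x = (\<lambda>i. if i = ?m then (1 - t * (1 - \<bar>x ?m\<bar>)) * k x i else k x i)" for t :: real and x
  define h where "h x = normalize_upto ?m (v 1 x)" for x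
  have ksph: "k x \<in> sph ?m" if "x \<in> sph ?m" for x using k that by (auto simp: odd_lip_def)
  \<comment> \<open>By oddness, missing one pole on the equator means missing both.\<close>
  have miss': "k x \<noteq> ?e" "k x \<noteq> (\<lambda>i. - ?e i)" if x: "x \<in> sph n" for x
  proof -
    show "k x \<noteq> ?e" using miss x by (metis image_eqI)
    have "k (\<lambda>i. - x i) \<noteq> ?e" using miss sph_uminus[OF x] by (metis image_eqI)
    moreover have "k (\<lambda>i. - x i) = (\<lambda>i. - k x i)" using k subsetD[OF sph_mono x] by (auto simp: odd_lip_def)
    ultimately show "k x \<noteq> (\<lambda>i. - ?e i)" by auto
  qed
  have nz: "\<exists>i\<le>?m. v t x i \<noteq> 0" if x: "x \<in> sph ?m" and t: "0 \<le> t" "t \<le> 1" for t x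
  proof (rule ccontr)
    assume "\<not> ?thesis"
    then have z: "\<And>i. i \<le> ?m \<Longrightarrow> v t x i = 0" by blast
    \<comment> \<open>Only the last coordinate is scaled, so \<open>k x\<close> would be a pole and
      the factor would vanish; this forces x onto the equator, where \<open>k\<close> takes no pole
      as value.\<close>
    have "k x i = 0" if "i \<le> n" for i using z[of i] that by (simp add: v_def)
    then have e: "k x = ?e \<or> k x = (\<lambda>i. - ?e i)" by (rule sph_pole[OF ksph[OF x]])
    then have "k x ?m \<noteq> 0" by auto
    with z[of ?m] have 1: "t * (1 - \<bar>x ?m\<bar>) = 1" by (simp add: v_def)
    have "\<bar>x ?m\<bar> \<le> 1" using sph_abs_le_1[OF x] .
    then have "t * (1 - \<bar>x ?m\<bar>) \<le> 1 * (1 - \<bar>x ?m\<bar>)" using t by (intro mult_right_mono) auto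
    then have "x ?m = 0" using 1 by auto
    then have "x \<in> sph n" using x sph_Suc_0 by blast
    then show False using e miss' by blast
  qed
  have vlip: "lip ?m (\<lambda>x. v t x i)" for t i
    using k by (cases "i = ?m") (auto simp: v_def odd_lip_def intro!: lip_mult lip_diff lip_const lip_abs lip_coord)
  have hsph: "h x \<in> sph ?m" if "x \<in> sph ?m" for x
    using nz[OF that, of 1] normalize_upto_in_sph unfolding h_def by fastforce
  show "odd_lip ?m h"
    unfolding odd_lip_def
  proof (intro conjI allI ballI)
    show "h ` sph ?m \<subseteq> sph ?m" using hsph by auto
    show "lip ?m (\<lambda>x. h x i)" for i
      unfolding h_def by (intro lip_normalize_upto vlip nz) auto
    show "h (\<lambda>i. - x i) = (\<lambda>i. - h x i)" if "x \<in> sph ?m" for x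
    proof -
      have "v 1 (\<lambda>i. - x i) = (\<lambda>i. - v 1 x i)" using k that by (auto simp: odd_lip_def v_def)
      then show ?thesis by (auto simp: h_def normalize_upto_def)
    qed
  qed
  show "h ` sph n \<subseteq> sph n"
  proof clarify
    fix x assume x: "x \<in> sph n"
    then have "h x \<in> sph ?m" using hsph sph_mono by blast
    moreover have "h x ?m = 0" using x by (simp add: h_def normalize_upto_def v_def sph_def)
    ultimately show "h x \<in> sph n" by (rule sph_Suc_0)
  qed
  show "homotopic_with (\<lambda>_. True) (nsphere ?m) (nsphere ?m) k h"
  proof -
    let ?H = "\<lambda>p. normalize_upto ?m (v (fst p) (snd p))"
    have kc: "continuous_on ({0..1::real} \<times> sph ?m) (\<lambda>p. k (snd p) i)" for i
    proof -
      have "continuous_on (sph ?m) (\<lambda>x. k x i)" using k by (auto simp: odd_lip_def intro: lip_continuous_on)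
      then show ?thesis
        by (rule continuous_on_compose2[where g = "\<lambda>x. k x i" and f = snd]) (auto intro: continuous_on_snd continuous_on_id)
    qed
    have xc: "continuous_on ({0..1::real} \<times> sph ?m) (\<lambda>p. snd p i)" for i
      by (rule continuous_on_compose2[where g = "\<lambda>x. x i" and f = snd and t = UNIV]) (auto intro: continuous_on_snd continuous_on_id)
    have vc: "continuous_on ({0..1::real} \<times> sph ?m) (\<lambda>p. v (fst p) (snd p) i)" for i
      unfolding v_def by (cases "i = ?m") (auto intro!: continuous_intros kc xc)
    have pos: "sqrt (\<Sum>j\<le>?m. (v t x j)\<^sup>2) \<noteq> 0" if "x \<in> sph ?m" "0 \<le> t" "t \<le> 1" for t x
    proof -
      have "(\<Sum>j\<le>?m. (v t x j)\<^sup>2) > 0"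
        using nz[OF that] by (meson atMost_iff finite_atMost sum_pos2 zero_le_power2 zero_less_power2)
      then show ?thesis by simp
    qed
    have Hc: "continuous_on ({0..1::real} \<times> sph ?m) ?H"
    proof (rule continuous_on_coordinatewise_then_product)
      fix i
      show "continuous_on ({0..1::real} \<times> sph ?m) (\<lambda>p. ?H p i)"
      proof (cases "i \<le> ?m")
        case True
        have "continuous_on ({0..1::real} \<times> sph ?m)
           (\<lambda>p. v (fst p) (snd p) i / sqrt (\<Sum>j\<le>?m. (v (fst p) (snd p) j)\<^sup>2))"
          using pos by (intro continuous_intros vc) auto
        then show ?thesis using True by (simp add: normalize_upto_def)
      qed (simp add: normalize_upto_def)
    qed
    have "?H p \<in> sph ?m" if "p \<in> {0..1::real} \<times> sph ?m" for p
      using nz[of "snd p" "fst p"] normalize_upto_in_sph that by fastforce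
    then have 1: "continuous_map (prod_topology (top_of_set {0..1}) (top_of_set (sph ?m))) (top_of_set (sph ?m)) ?H"
      using Hc by (auto simp: subtopology_Times[symmetric] euclidean_product_topology)
    have 2: "\<forall>x\<in>sph ?m. ?H (0, x) = k x"
    proof
      fix x assume x: "x \<in> sph ?m"
      have "v 0 x = k x" by (auto simp: v_def)
      then show "?H (0, x) = k x"
        using ksph[OF x] by (auto simp: normalize_upto_def sph_def fun_eq_iff)
    qed
    have 3: "\<forall>x\<in>sph ?m. ?H (1, x) = h x" by (simp add: h_def)
    show ?thesis
      unfolding nsphere_eq_sph using 1 2 3 by (subst homotopic_with) auto
  qed
qed

text \<open>For n = 0 an odd map is an involution. In the step, a reflection moves a point missed by
  the image of the equator to the pole, a homotopy makes the equator invariant, and the degree then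
  has the parity of the degree on the equator.\<close>

theorem odd_lip_degree: "odd_lip n k \<Longrightarrow> odd (Brouwer_degree2 n k)"
proof (induction n arbitrary: k)
  case 0
  have s0: "x \<in> sph 0 \<longleftrightarrow> x = (\<lambda>i. if i = 0 then 1 else 0) \<or> x = (\<lambda>i. - (if i = 0 then 1 else 0))" for x
    by (auto simp: sph_def power2_eq_1_iff fun_eq_iff)
  have "k (k x) = x" if x: "x \<in> sph 0" for x
  proof -
    have "k x \<in> sph 0" using x 0 by (auto simp: odd_lip_def)
    then have "k x = x \<or> k x = (\<lambda>i. - x i)" using x unfolding s0 by auto
    moreover have "k (\<lambda>i. - x i) = (\<lambda>i. - k x i)" using 0 x by (auto simp: odd_lip_def)
    ultimately show ?thesis by auto
  qed
  with 0 show ?case by (rule odd_Brouwer_degree2_involution)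
next
  case (Suc n)
  let ?e = "\<lambda>i. if i = Suc n then 1 else (0::real)"
  have e: "?e \<in> sph (Suc n)" by (simp add: sph_def if_distrib[of "\<lambda>x. x ^ 2"] cong: if_cong)
  obtain p where p: "p \<in> sph (Suc n)" "p \<notin> k ` sph n"
    using lip_sph_not_surj[of n k] Suc.prems lip_restrict by (metis odd_lip_def)
  obtain T where T: "odd_lip (Suc n) T" "T p = ?e" "\<And>x. x \<in> sph (Suc n) \<Longrightarrow> T (T x) = x"
    using exists_swapping_reflection[OF p(1) e] by blast
  have Tk: "odd_lip (Suc n) (T \<circ> k)" using odd_lip_compose Suc.prems T(1) by blast
  have "?e \<notin> (T \<circ> k) ` sph n"
  proof
    assume "?e \<in> (T \<circ> k) ` sph n"
    then obtain x where x: "x \<in> sph n" "T (k x) = T p" using T(2) by auto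
    have "k x \<in> sph (Suc n)" using x(1) sph_mono Suc.prems by (auto simp: odd_lip_def)
    then have "k x = p" using x(2) T(3) p(1) by metis
    then show False using p(2) x(1) by blast
  qed
  then obtain h where h: "odd_lip (Suc n) h" "h ` sph n \<subseteq> sph n"
    "homotopic_with (\<lambda>_. True) (nsphere (Suc n)) (nsphere (Suc n)) (T \<circ> k) h"
    using odd_lip_homotopic_equator[OF Tk] by blast
  have "odd_lip n h"
    using h(1,2) subsetD[OF sph_mono] by (auto simp: odd_lip_def intro: lip_restrict)
  then have "odd (Brouwer_degree2 n h)" by (rule Suc.IH)
  moreover have "even (Brouwer_degree2 (Suc n) h - Brouwer_degree2 (Suc n - Suc 0) h)"
  proof (rule Borsuk_odd_mapping_degree_step)
    show "continuous_map (nsphere (Suc n)) (nsphere (Suc n)) h"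
      using odd_lip_continuous_map h(1) by blast
  qed (use h in \<open>auto simp: nsphere_eq_sph odd_lip_def\<close>)
  ultimately have "odd (Brouwer_degree2 (Suc n) h)" by simp
  then have "odd (Brouwer_degree2 (Suc n) (T \<circ> k))"
    using Brouwer_degree2_homotopic[OF h(3)] by simp
  then show ?case using odd_lip_compose_degree[OF Suc.prems T(1,3)] by simp
qed

text \<open>Without a common zero, padding the n functions by a last coordinate 0 and normalizing
  gives an odd self-map of the sphere. It misses the poles, so its degree is 0, yet it must be
  odd.\<close>

theorem Borsuk_Ulam_lip:
  assumes lip: "\<And>i. i < n \<Longrightarrow> lip n (g i)"
    and odd: "\<And>i x. i < n \<Longrightarrow> x \<in> sph n \<Longrightarrow> g i (\<lambda>j. - x j) = - g i x"
  shows "\<exists>x\<in>sph n. \<forall>i<n. g i x = 0"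
proof (rule ccontr)
  assume "\<not> ?thesis"
  then have nz: "\<And>x. x \<in> sph n \<Longrightarrow> \<exists>i<n. g i x \<noteq> 0" by blast
  define v where "v x = (\<lambda>i. if i < n then g i x else 0)" for x
  define h where "h x = normalize_upto n (v x)" for x
  have vnz: "\<exists>i\<le>n. v x i \<noteq> 0" if "x \<in> sph n" for x
    using nz[OF that] by (auto simp: v_def intro: less_imp_le)
  have "odd_lip n h"
    unfolding odd_lip_def
  proof (intro conjI allI ballI)
    show "h ` sph n \<subseteq> sph n" using vnz normalize_upto_in_sph unfolding h_def by blast
    have "lip n (\<lambda>x. v x i)" for i using lip by (cases "i < n") (auto simp: v_def lip_const)
    then show "lip n (\<lambda>x. h x i)" for i
      unfolding h_def by (intro lip_normalize_upto vnz) auto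
    show "h (\<lambda>i. - x i) = (\<lambda>i. - h x i)" if "x \<in> sph n" for x
    proof -
      have "v (\<lambda>i. - x i) = (\<lambda>i. - v x i)" using odd that by (auto simp: v_def)
      then show ?thesis by (auto simp: h_def normalize_upto_def)
    qed
  qed
  then have "odd (Brouwer_degree2 n h)" "continuous_map (nsphere n) (nsphere n) h"
    using odd_lip_degree odd_lip_continuous_map by blast+
  moreover have "h ` sph n \<noteq> sph n"
  proof
    assume eq: "h ` sph n = sph n"
    have "(\<lambda>i. if i = n then 1 else (0::real)) \<in> sph n"
      by (simp add: sph_def if_distrib[of "\<lambda>x. x ^ 2"] cong: if_cong)
    then obtain x where "x \<in> sph n" "h x = (\<lambda>i. if i = n then 1 else 0)" using eq by (metis imageE)
    then have "h x n = 1" by simp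
    then show False by (simp add: h_def normalize_upto_def v_def)
  qed
  ultimately show False
    using Brouwer_degree2_nonsurjective[of n h] by (simp add: nsphere_eq_sph)
qed

section \<open>Trivariate polynomials on circles\<close>

text \<open>\<open>pol d f\<close>: the function \<open>f\<close> is a polynomial of degree at most \<open>d\<close>.\<close>

inductive pol :: "nat \<Rightarrow> (real^3 \<Rightarrow> real) \<Rightarrow> bool" where
  pol_const: "pol d (\<lambda>_. c)"
| pol_coord: "d \<ge> 1 \<Longrightarrow> pol d (\<lambda>x. x $ i)"
| pol_add: "pol d f \<Longrightarrow> pol d g \<Longrightarrow> pol d (\<lambda>x. f x + g x)"
| pol_mult: "pol d f \<Longrightarrow> pol e g \<Longrightarrow> pol (d + e) (\<lambda>x. f x * g x)"

lemma pol_mono: "pol d f \<Longrightarrow> d \<le> e \<Longrightarrow> pol e f"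
proof (induction arbitrary: e rule: pol.induct)
  case (pol_mult d f d' g)
  have "pol (d + (e - d)) (\<lambda>x. f x * g x)"
    using pol_mult by (intro pol.pol_mult) auto
  then show ?case using pol_mult.prems by simp
qed (auto intro: pol.intros)

lemma pol_cmult: "pol d f \<Longrightarrow> pol d (\<lambda>x. c * f x)"
  using pol_mult[OF pol_const[of 0 c], of d f] by simp

lemma pol_diff: "pol d f \<Longrightarrow> pol d g \<Longrightarrow> pol d (\<lambda>x. f x - g x)"
  using pol_add[OF _ pol_cmult[of d g "-1"], of f] by simp

lemma pol_sum: "finite I \<Longrightarrow> (\<And>i. i \<in> I \<Longrightarrow> pol d (f i)) \<Longrightarrow> pol d (\<lambda>x. \<Sum>i\<in>I. f i x)"
  by (induction I rule: finite_induct) (auto intro: pol_const pol_add)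

lemma pol_prod: "finite I \<Longrightarrow> (\<And>i. i \<in> I \<Longrightarrow> pol d (f i)) \<Longrightarrow> pol (d * card I) (\<lambda>x. \<Prod>i\<in>I. f i x)"
  by (induction I rule: finite_induct) (auto intro: pol_const pol_mult)

lemma pol_power: "pol d f \<Longrightarrow> pol (d * n) (\<lambda>x. f x ^ n)"
  by (induction n) (auto intro: pol_const pol_mult)

lemma pol_inner: "pol 1 (\<lambda>x. v \<bullet> (x - a))"
proof -
  have "pol 1 (\<lambda>x. v $ i * (x $ i - a $ i))" for i
    by (intro pol_cmult pol_diff pol_coord pol_const) auto
  then have "pol 1 (\<lambda>x. \<Sum>i\<in>UNIV. v $ i * (x $ i - a $ i))" by (intro pol_sum) auto
  then show ?thesis by (simp add: inner_vec_def)
qed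

lemma pol_continuous_on: "pol d f \<Longrightarrow> continuous_on S f"
  by (induction rule: pol.induct) (auto intro!: continuous_intros)

text \<open>Reduces questions of nonvanishing and of degree to univariate polynomials.\<close>

lemma pol_line:
  "pol d f \<Longrightarrow> \<exists>p. degree p \<le> d \<and> (\<forall>t. f (a + t *\<^sub>R v) = poly p t)"
proof (induction rule: pol.induct)
  case (pol_const d c)
  then show ?case by (intro exI[of _ "[:c:]"]) auto
next
  case (pol_coord d i)
  then show ?case by (intro exI[of _ "[:a $ i, v $ i:]"]) auto
next
  case (pol_add d f g)
  then obtain p q where "degree p \<le> d" "\<forall>t. f (a + t *\<^sub>R v) = poly p t"
    "degree q \<le> d" "\<forall>t. g (a + t *\<^sub>R v) = poly q t" by blast
  then show ?case by (intro exI[of _ "p + q"]) (auto intro: degree_add_le)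
next
  case (pol_mult d f e g)
  then obtain p q where "degree p \<le> d" "\<forall>t. f (a + t *\<^sub>R v) = poly p t"
    "degree q \<le> e" "\<forall>t. g (a + t *\<^sub>R v) = poly q t" by blast
  then show ?case by (intro exI[of _ "p * q"]) (auto intro: order_trans[OF degree_mult_le])
qed

section \<open>Stereographic parametrization of circles\<close>

definition rat_circ :: "real^3 \<Rightarrow> real^3 \<Rightarrow> real^3 \<Rightarrow> real \<Rightarrow> real^3" where
  "rat_circ c p q t = c + ((1 - t\<^sup>2) / (1 + t\<^sup>2)) *\<^sub>R p + (2 * t / (1 + t\<^sup>2)) *\<^sub>R q"

lemma one_plus_square_pos: "1 + (t::real)\<^sup>2 > 0"
  by (simp add: add_pos_nonneg)

lemma continuous_on_rat_circ: "continuous_on S (rat_circ c p q)"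
  unfolding rat_circ_def using one_plus_square_pos
  by (intro continuous_intros) (auto simp: less_imp_neq[symmetric])

text \<open>Each coordinate is a quotient of quadratics with denominator 1 + t^2, so clearing d
  denominators leaves degree at most 2 * d.\<close>

lemma pol_rat_circ:
  "pol d f \<Longrightarrow> \<exists>P. degree P \<le> 2 * d \<and> (\<forall>t. (1 + t\<^sup>2) ^ d * f (rat_circ c p q t) = poly P t)"
proof (induction rule: pol.induct)
  case (pol_const d b)
  have "degree ([:1, 0, 1:] ^ d :: real poly) \<le> 2 * d"
    using degree_power_le[of "[:1, 0, 1:] :: real poly" d] by simp
  then have "degree (Polynomial.smult b ([:1, 0, 1:] ^ d)) \<le> 2 * d"
    using degree_smult_le order_trans by blast
  then show ?case
    by (intro exI[of _ "Polynomial.smult b ([:1, 0, 1:] ^ d)"]) (auto simp: power2_eq_square mult.commute)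
next
  case (pol_coord d i)
  obtain e where d: "d = Suc e" using pol_coord by (cases d) auto
  let ?Q = "[:c $ i + p $ i, 2 * q $ i, c $ i - p $ i:]"
  have "degree ([:1, 0, 1:] ^ e :: real poly) \<le> 2 * e"
    using degree_power_le[of "[:1, 0, 1:] :: real poly" e] by simp
  moreover have "degree ?Q \<le> 2" by simp
  ultimately have "degree ([:1, 0, 1:] ^ e * ?Q) \<le> 2 * d"
    using degree_mult_le[of "[:1, 0, 1:] ^ e" ?Q] d by linarith
  moreover have "(1 + t\<^sup>2) ^ d * rat_circ c p q t $ i = poly ([:1, 0, 1:] ^ e * ?Q) t" for t
  proof -
    define s where "s = 1 + t\<^sup>2"
    have s: "s \<noteq> 0" using one_plus_square_pos[of t] by (simp add: s_def)
    have "s * rat_circ c p q t $ i = s * c $ i + (1 - t\<^sup>2) * p $ i + 2 * t * q $ i"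
      using s by (simp add: rat_circ_def s_def[symmetric] distrib_left)
    also have "\<dots> = poly ?Q t" by (simp add: s_def power2_eq_square algebra_simps)
    finally have "s ^ d * rat_circ c p q t $ i = s ^ e * poly ?Q t" by (simp add: d mult.assoc mult.left_commute)
    moreover have "poly ([:1, 0, 1:] ^ e) t = s ^ e" by (simp add: s_def power2_eq_square)
    ultimately show ?thesis by (simp only: poly_mult s_def)
  qed
  ultimately show ?case by blast
next
  case (pol_add d f g)
  then obtain P Q where "degree P \<le> 2 * d" "\<forall>t. (1 + t\<^sup>2) ^ d * f (rat_circ c p q t) = poly P t"
    "degree Q \<le> 2 * d" "\<forall>t. (1 + t\<^sup>2) ^ d * g (rat_circ c p q t) = poly Q t" by blast
  then show ?case by (intro exI[of _ "P + Q"]) (auto intro: degree_add_le simp: distrib_left)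
next
  case (pol_mult d f e g)
  then obtain P Q where PQ: "degree P \<le> 2 * d" "\<forall>t. (1 + t\<^sup>2) ^ d * f (rat_circ c p q t) = poly P t"
    "degree Q \<le> 2 * e" "\<forall>t. (1 + t\<^sup>2) ^ e * g (rat_circ c p q t) = poly Q t" by blast
  have "(1 + t\<^sup>2) ^ (d + e) * (f (rat_circ c p q t) * g (rat_circ c p q t)) = poly (P * Q) t" for t
    using PQ(2,4)[rule_format, of t, symmetric] by (simp add: power_add mult.assoc mult.left_commute)
  moreover have "degree (P * Q) \<le> 2 * (d + e)"
  proof -
    have "degree (P * Q) \<le> degree P + degree Q" by (rule degree_mult_le)
    also have "\<dots> \<le> 2 * d + 2 * e" using PQ(1,3) by (rule add_mono)
    finally show ?thesis by simp
  qed
  ultimately show ?case by blast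
qed

definition circ :: "real^3 \<Rightarrow> real^3 \<Rightarrow> real^3 \<Rightarrow> (real^3) set" where
  "circ c p q = {c + x *\<^sub>R p + y *\<^sub>R q | x y. x\<^sup>2 + y\<^sup>2 = 1}"

text \<open>The frame is rotated so that \<open>x0\<close> is the point t = 0. A polynomial not
  vanishing at \<open>x0\<close> then stays nonzero as a polynomial in t. The point
  \<open>c - p'\<close> is the limit for infinite t.\<close>

lemma circ_eq_rat_circ:
  assumes "x0 \<in> circ c p q"
  obtains p' q' where "x0 = rat_circ c p' q' 0" "circ c p q \<subseteq> insert (c - p') (range (rat_circ c p' q'))"
proof -
  obtain x y where xy: "x0 = c + x *\<^sub>R p + y *\<^sub>R q" "x\<^sup>2 + y\<^sup>2 = 1" using assms by (auto simp: circ_def)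
  define p' q' where "p' = x *\<^sub>R p + y *\<^sub>R q" and "q' = (-y) *\<^sub>R p + x *\<^sub>R q"
  have "z \<in> insert (c - p') (range (rat_circ c p' q'))" if z: "z \<in> circ c p q" for z
  proof -
    obtain X Y where XY: "z = c + X *\<^sub>R p + Y *\<^sub>R q" "X\<^sup>2 + Y\<^sup>2 = 1" using z by (auto simp: circ_def)
    \<comment> \<open>The coordinates of z in the rotated frame.\<close>
    define X' Y' where "X' = X * x + Y * y" and "Y' = Y * x - X * y"
    have n: "X'\<^sup>2 + Y'\<^sup>2 = 1"
    proof -
      have "X'\<^sup>2 + Y'\<^sup>2 = (X\<^sup>2 + Y\<^sup>2) * (x\<^sup>2 + y\<^sup>2)"
        by (simp add: X'_def Y'_def power2_eq_square algebra_simps)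
      then show ?thesis using xy XY by simp
    qed
    have "X' * x - Y' * y = X * (x\<^sup>2 + y\<^sup>2)" "X' * y + Y' * x = Y * (x\<^sup>2 + y\<^sup>2)"
      by (simp_all add: X'_def Y'_def power2_eq_square algebra_simps)
    moreover have "X' *\<^sub>R p' + Y' *\<^sub>R q' = (X' * x - Y' * y) *\<^sub>R p + (X' * y + Y' * x) *\<^sub>R q"
      by (simp add: p'_def q'_def algebra_simps)
    ultimately have z': "z = c + X' *\<^sub>R p' + Y' *\<^sub>R q'" using XY(1) xy(2) by (simp add: add.assoc)
    show ?thesis
    proof (cases "X' = -1")
      case True
      then have "Y' = 0" using n by simp
      then show ?thesis using True z' by simp
    next
      case False
      \<comment> \<open>The tangent of half the angle.\<close>
      define t where "t = Y' / (1 + X')"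
      have ne: "1 + X' \<noteq> 0" using False by linarith
      have Y2: "Y'\<^sup>2 = (1 - X') * (1 + X')" using n by (simp add: power2_eq_square algebra_simps)
      have t2: "t\<^sup>2 = (1 - X') / (1 + X')"
        using ne Y2 by (simp add: t_def power_divide power2_eq_square)
      have s: "1 + t\<^sup>2 = 2 / (1 + X')" using ne by (simp add: t2 field_simps)
      have "1 - t\<^sup>2 = 2 * X' / (1 + X')" using ne by (simp add: t2 field_simps)
      then have "(1 - t\<^sup>2) / (1 + t\<^sup>2) = X'" "2 * t / (1 + t\<^sup>2) = Y'"
        using ne unfolding s by (simp_all add: t_def)
      then have "rat_circ c p' q' t = z" by (simp add: rat_circ_def z')
      then show ?thesis by blast
    qed
  qed
  moreover have "x0 = rat_circ c p' q' 0" by (simp add: rat_circ_def p'_def xy add.assoc)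
  ultimately show ?thesis using that by blast
qed

lemma pol_zeros_rat_circ:
  assumes f: "pol d f" and nz: "f (rat_circ c p q t0) \<noteq> 0"
  shows "finite {t. f (rat_circ c p q t) = 0}" "card {t. f (rat_circ c p q t) = 0} \<le> 2 * d"
proof -
  obtain P where P: "degree P \<le> 2 * d" "\<And>t. (1 + t\<^sup>2) ^ d * f (rat_circ c p q t) = poly P t"
    using pol_rat_circ[OF f] by blast
  have pos: "(1 + t\<^sup>2) ^ d \<noteq> 0" for t :: real using one_plus_square_pos[of t] by simp
  have eq: "f (rat_circ c p q t) = 0 \<longleftrightarrow> poly P t = 0" for t
    using P(2)[of t] pos[of t] by (metis mult_eq_0_iff)
  have "poly P t0 \<noteq> 0" using eq[of t0] nz by blast
  then have "P \<noteq> 0" by auto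
  then have "finite {t. poly P t = 0}" "card {t. poly P t = 0} \<le> degree P"
    using poly_roots_finite card_poly_roots_bound by blast+
  then show "finite {t. f (rat_circ c p q t) = 0}" "card {t. f (rat_circ c p q t) = 0} \<le> 2 * d"
    unfolding eq using P(1) by (blast, linarith)
qed

text \<open>The extra 1 pays for the point \<open>c - p'\<close> at infinite parameter.\<close>

lemma pol_zeros_circ:
  assumes f: "pol d f" and x0: "x0 \<in> circ c p q" "f x0 \<noteq> 0"
  shows "finite {x \<in> circ c p q. f x = 0}" "card {x \<in> circ c p q. f x = 0} \<le> 2 * d + 1"
proof -
  obtain p' q' where r: "x0 = rat_circ c p' q' 0" "circ c p q \<subseteq> insert (c - p') (range (rat_circ c p' q'))"
    using circ_eq_rat_circ[OF x0(1)] by blast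
  let ?Z = "{t. f (rat_circ c p' q' t) = 0}"
  have Z: "finite ?Z" "card ?Z \<le> 2 * d" using pol_zeros_rat_circ[OF f] x0(2) r(1) by auto
  have sub: "{x \<in> circ c p q. f x = 0} \<subseteq> insert (c - p') (rat_circ c p' q' ` ?Z)" using r(2) by auto
  show "finite {x \<in> circ c p q. f x = 0}" using sub Z(1) finite_subset by blast
  have "card {x \<in> circ c p q. f x = 0} \<le> card (insert (c - p') (rat_circ c p' q' ` ?Z))"
    using sub Z(1) by (intro card_mono) auto
  also have "\<dots> \<le> Suc (card (rat_circ c p' q' ` ?Z))" using Z(1) by (simp add: card_insert_if)
  also have "\<dots> \<le> 2 * d + 1" using card_image_le[OF Z(1), of "rat_circ c p' q'"] Z(2) by linarith
  finally show "card {x \<in> circ c p q. f x = 0} \<le> 2 * d + 1" .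
qed

text \<open>Z cuts the line into \<open>card Z + 1\<close> intervals, and the number of elements of
  Z below t tells which of them contains t.\<close>

lemma card_image_locally_constant:
  fixes h :: "real \<Rightarrow> 'a"
  assumes Z: "finite Z"
    and const: "\<And>s t. s \<le> t \<Longrightarrow> {s..t} \<inter> Z = {} \<Longrightarrow> h s = h t"
  shows "finite (h ` (- Z))" "card (h ` (- Z)) \<le> Suc (card Z)"
proof -
  define r where "r t = card {z\<in>Z. z < t}" for t
  have same: "h s = h t" if "s \<notin> Z" "t \<notin> Z" "r s = r t" for s t
  proof -
    have *: "h s = h t" if st: "s \<notin> Z" "t \<notin> Z" "r s = r t" "s \<le> t" for s t
    proof (rule const[OF st(4)])
      have "{z\<in>Z. z < s} = {z\<in>Z. z < t}"
        using st Z unfolding r_def by (intro card_subset_eq) auto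
      then have "z \<in> Z \<Longrightarrow> z < t \<Longrightarrow> z < s" for z by blast
      then show "{s..t} \<inter> Z = {}"
        using st(1,2) by (metis (no_types, lifting) atLeastAtMost_iff disjoint_iff not_less order_le_less)
    qed
    show ?thesis using * that by (metis linear)
  qed
  have rb: "r t \<in> {..card Z}" for t unfolding r_def atMost_iff using Z by (intro card_mono) auto
  define g where "g n = h (SOME s. s \<notin> Z \<and> r s = n)" for n
  have g: "h t = g (r t)" if t: "t \<notin> Z" for t
  proof -
    let ?s = "SOME s. s \<notin> Z \<and> r s = r t"
    have "?s \<notin> Z \<and> r ?s = r t" by (rule someI[where x = t]) (use t in simp)
    then show ?thesis unfolding g_def using same[of t ?s] t by presburger
  qed
  have sub: "h ` (- Z) \<subseteq> g ` {..card Z}" using rb g by fastforce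
  then show "finite (h ` (- Z))" using finite_subset by blast
  have "card (h ` (- Z)) \<le> card (g ` {..card Z})" using sub by (intro card_mono) auto
  also have "\<dots> \<le> Suc (card Z)" using card_image_le[of "{..card Z}" g] by simp
  finally show "card (h ` (- Z)) \<le> Suc (card Z)" .
qed

text \<open>\<open>h\<close> will be the label of the cell. At most 2 * d zeros leave 2 * d + 1
  parameter intervals, and the point at infinite parameter may add one more label.\<close>

lemma cells_on_circ:
  assumes f: "pol d f" and x0: "x0 \<in> circ c p q" "f x0 \<noteq> 0"
    and h: "\<And>U x y. connected U \<Longrightarrow> (\<And>z. z \<in> U \<Longrightarrow> f z \<noteq> 0) \<Longrightarrow> x \<in> U \<Longrightarrow> y \<in> U \<Longrightarrow> h x = h y"
  shows "finite (h ` {x \<in> circ c p q. f x \<noteq> 0})" "card (h ` {x \<in> circ c p q. f x \<noteq> 0}) \<le> 2 * d + 2"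
proof -
  obtain p' q' where r: "x0 = rat_circ c p' q' 0" "circ c p q \<subseteq> insert (c - p') (range (rat_circ c p' q'))"
    using circ_eq_rat_circ[OF x0(1)] by blast
  let ?\<gamma> = "rat_circ c p' q'"
  let ?Z = "{t. f (?\<gamma> t) = 0}"
  have Z: "finite ?Z" "card ?Z \<le> 2 * d" using pol_zeros_rat_circ[OF f] x0(2) r(1) by auto
  have const: "h (?\<gamma> s) = h (?\<gamma> t)" if "s \<le> t" "{s..t} \<inter> ?Z = {}" for s t
  proof (rule h[of "?\<gamma> ` {s..t}"])
    show "connected (?\<gamma> ` {s..t})" by (intro connected_continuous_image continuous_on_rat_circ) auto
  qed (use that in \<open>auto simp: disjoint_iff\<close>)
  have H: "finite ((\<lambda>t. h (?\<gamma> t)) ` (- ?Z))" "card ((\<lambda>t. h (?\<gamma> t)) ` (- ?Z)) \<le> Suc (card ?Z)"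
    using card_image_locally_constant[OF Z(1), of "\<lambda>t. h (?\<gamma> t)", OF const] by blast+
  have sub: "h ` {x \<in> circ c p q. f x \<noteq> 0} \<subseteq> insert (h (c - p')) ((\<lambda>t. h (?\<gamma> t)) ` (- ?Z))"
    using r(2) by auto
  show "finite (h ` {x \<in> circ c p q. f x \<noteq> 0})" using sub H(1) finite_subset by blast
  have "card (h ` {x \<in> circ c p q. f x \<noteq> 0}) \<le> card (insert (h (c - p')) ((\<lambda>t. h (?\<gamma> t)) ` (- ?Z)))"
    using sub H(1) by (intro card_mono) auto
  also have "\<dots> \<le> Suc (card ((\<lambda>t. h (?\<gamma> t)) ` (- ?Z)))" using H(1) by (simp add: card_insert_if)
  finally show "card (h ` {x \<in> circ c p q. f x \<noteq> 0}) \<le> 2 * d + 2" using H(2) Z(2) by linarith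
qed

section \<open>Polynomial partitioning\<close>

text \<open>Kronecker indexing: the base-\<open>e\<close> digits of \<open>m < e^3\<close> are the three exponents, so that along the
  curve \<open>(t, t^e, t^(e^2))\<close> the \<open>m\<close>-th monomial becomes \<open>t^m\<close>.\<close>

definition kmon :: "nat \<Rightarrow> nat \<Rightarrow> real^3 \<Rightarrow> real" where
  "kmon e m x = (x $ 1) ^ (m mod e) * (x $ 2) ^ ((m div e) mod e) * (x $ 3) ^ (m div (e * e))"

lemma pol_kmon: assumes "m < e ^ 3" shows "pol (3 * e) (kmon e m)"
proof -
  have e: "e > 0" using assms by (cases e) auto
  have "m div (e * e) < e" using assms e by (simp add: less_mult_imp_div_less power3_eq_cube)
  then have le: "m mod e \<le> e" "(m div e) mod e \<le> e" "m div (e * e) \<le> e"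
    using e by (auto simp: less_imp_le)
  have p: "pol e (\<lambda>x. (x $ i) ^ k)" if "k \<le> e" for i k
    using pol_mono[OF pol_power[OF pol_coord[of 1 i]], of k e] that by simp
  have "pol (e + e + e) (kmon e m)"
    unfolding kmon_def[abs_def] using le by (intro pol_mult p)
  moreover have "e + e + e = 3 * e" by simp
  ultimately show ?thesis by (simp only:)
qed

lemma kmon_moment_curve: "kmon e m (vector [t, t ^ e, t ^ (e * e)]) = t ^ m"
proof -
  have "m mod e + (e * ((m div e) mod e) + e * e * (m div (e * e))) = m"
  proof -
    have "m div (e * e) = (m div e) div e" by (simp add: div_mult2_eq)
    then have "e * ((m div e) mod e) + e * e * (m div (e * e)) = e * ((m div e) mod e + e * ((m div e) div e))"
      by (simp only: distrib_left mult.assoc)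
    also have "\<dots> = e * (m div e)" by (simp only: mod_mult_div_eq)
    finally show ?thesis by simp
  qed
  then show ?thesis by (simp add: kmon_def flip: power_mult power_add add.assoc)
qed

definition kpol :: "nat \<Rightarrow> nat \<Rightarrow> (nat \<Rightarrow> real) \<Rightarrow> real^3 \<Rightarrow> real" where
  "kpol e M v x = (\<Sum>m\<le>M. v m * kmon e m x)"

lemma pol_kpol: assumes "M < e ^ 3" shows "pol (3 * e) (kpol e M v)"
  unfolding kpol_def[abs_def] using assms by (intro pol_sum pol_cmult pol_kmon) auto

text \<open>On the curve of \<open>kmon_moment_curve\<close> the coefficients become those of a
  univariate polynomial, and one of them is nonzero.\<close>

lemma kpol_nonzero:
  assumes "v \<in> sph M" shows "\<exists>x. kpol e M v x \<noteq> 0"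
proof -
  define p where "p = (\<Sum>m\<le>M. Polynomial.monom (v m) m)"
  have "\<exists>m\<le>M. v m \<noteq> 0"
  proof (rule ccontr)
    assume "\<not> ?thesis"
    then have "(\<Sum>m\<le>M. (v m)\<^sup>2) = 0" by simp
    then show False using assms by (simp add: sph_def)
  qed
  then obtain m where m: "m \<le> M" "v m \<noteq> 0" by blast
  have "Polynomial.coeff p m = v m" using m by (simp add: p_def coeff_sum)
  then have "p \<noteq> 0" using m by auto
  then obtain t where "poly p t \<noteq> 0" using poly_all_0_iff_0 by blast
  moreover have "poly p t = kpol e M v (vector [t, t ^ e, t ^ (e * e)])"
    by (simp add: p_def kpol_def kmon_moment_curve poly_sum poly_monom)
  ultimately show ?thesis by metis
qed

definition clamp1 :: "real \<Rightarrow> real" where "clamp1 t = max (-1) (min 1 t)"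

text \<open>Borsuk--Ulam balances the sums of the continuous sign substitutes \<open>clamp1 (N * f p)\<close>; a limit
  point of the solutions for growing \<open>N\<close> bisects exactly.\<close>

lemma polynomial_ham_sandwich:
  assumes M: "M < e ^ 3" and fin: "\<And>i. i < M \<Longrightarrow> finite (S i)"
  shows "\<exists>f. pol (3 * e) f \<and> (\<exists>x. f x \<noteq> 0) \<and>
     (\<forall>i<M. 2 * card {p \<in> S i. f p > 0} \<le> card (S i) \<and> 2 * card {p \<in> S i. f p < 0} \<le> card (S i))"
proof -
  let ?f = "kpol e M"
  define g where "g N i v = (\<Sum>p\<in>S i. clamp1 (real N * ?f v p))" for N :: nat and i v
  have flip: "lip M (\<lambda>v. ?f v p)" for p
    unfolding kpol_def by (intro lip_sum lip_mult lip_const lip_coord) auto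
  \<comment> \<open>M conditions against M + 1 coefficients, which are normalized to the
    sphere.\<close>
  have "\<exists>v\<in>sph M. \<forall>i<M. g N i v = 0" for N
  proof (rule Borsuk_Ulam_lip)
    fix i assume i: "i < M"
    have "lip M (\<lambda>v. clamp1 (real N * ?f v p))" for p
      by (rule lip_compose[where g = clamp1 and C = 1]) (auto intro!: lip_mult lip_const flip simp: clamp1_def)
    then show "lip M (g N i)" unfolding g_def using fin[OF i] by (intro lip_sum) auto
    fix v
    have "?f (\<lambda>j. - v j) p = - ?f v p" for p by (simp add: kpol_def sum_negf)
    moreover have "clamp1 (- t) = - clamp1 t" for t by (simp add: clamp1_def min_def max_def)
    ultimately show "g N i (\<lambda>j. - v j) = - g N i v" by (simp add: g_def sum_negf)
  qed
  then obtain v where v: "\<And>N. v N \<in> sph M" "\<And>N i. i < M \<Longrightarrow> g N i (v N) = 0" by metis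
  have "seq_compact (sph M)" using compact_sph compact_imp_seq_compact by blast
  then obtain l r where l: "l \<in> sph M" "strict_mono r" "(v \<circ> r) \<longlonglongrightarrow> l"
    using v(1) unfolding seq_compact_def by metis
  have coord: "(\<lambda>n. v (r n) m) \<longlonglongrightarrow> l m" for m
  proof -
    have "isCont (\<lambda>x::nat \<Rightarrow> real. x m) l"
    proof -
      have "continuous_on UNIV (\<lambda>x::nat \<Rightarrow> real. x m)" by (rule continuous_on_product_coordinates)
      then show ?thesis using continuous_on_eq_continuous_at[OF open_UNIV] by blast
    qed
    then show ?thesis using isCont_tendsto_compose l(3) by (fastforce simp: o_def)
  qed
  have lim: "(\<lambda>n. ?f (v (r n)) p) \<longlonglongrightarrow> ?f l p" for p
    unfolding kpol_def by (intro tendsto_intros coord)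
  have half: "2 * card {p \<in> S i. s * ?f l p > 0} \<le> card (S i)" if i: "i < M" and s: "s = 1 \<or> s = - 1" for i and s :: real
  proof -
    let ?Q = "{p \<in> S i. s * ?f l p > 0}"
    have finS: "finite (S i)" using fin i by blast
    \<comment> \<open>The values converge to something positive and the factor \<open>r n\<close>
      tends to infinity, so the clamp eventually saturates, and at a common n for the finitely many
      points of \<open>?Q\<close>.\<close>
    have "\<forall>\<^sub>F n in sequentially. 1 \<le> s * (real (r n) * ?f (v (r n)) p)" if p: "p \<in> ?Q" for p
    proof -
      have "(\<lambda>n. s * ?f (v (r n)) p) \<longlonglongrightarrow> s * ?f l p" by (intro tendsto_intros lim)
      moreover have "filterlim (\<lambda>n. real (r n)) at_top sequentially"
        using filterlim_compose[OF filterlim_real_sequentially filterlim_subseq[OF l(2)]] .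
      ultimately have "filterlim (\<lambda>n. (s * ?f (v (r n)) p) * real (r n)) at_top sequentially"
        using p by (intro filterlim_tendsto_pos_mult_at_top) auto
      then have "\<forall>\<^sub>F n in sequentially. 1 \<le> (s * ?f (v (r n)) p) * real (r n)"
        by (simp add: filterlim_at_top)
      then show ?thesis by (simp add: mult_ac)
    qed
    then have "\<forall>\<^sub>F n in sequentially. \<forall>p\<in>?Q. 1 \<le> s * (real (r n) * ?f (v (r n)) p)"
      using finS by (intro eventually_ball_finite) auto
    then obtain n where n: "\<And>p. p \<in> ?Q \<Longrightarrow> 1 \<le> s * (real (r n) * ?f (v (r n)) p)"
      by (auto simp: eventually_sequentially)
    let ?c = "\<lambda>p. s * clamp1 (real (r n) * ?f (v (r n)) p)"
    have "0 = (\<Sum>p\<in>S i. ?c p)" using v(2)[OF i, of "r n"] by (simp add: g_def flip: sum_distrib_left)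
    also have "\<dots> = (\<Sum>p\<in>?Q. ?c p) + (\<Sum>p\<in>S i - ?Q. ?c p)"
      using finS by (simp add: sum.subset_diff[of ?Q "S i"])
    \<comment> \<open>Every point of \<open>?Q\<close> contributes at least 1 and every other at
      least -1 to a sum that is 0, so \<open>?Q\<close> is at most half of
      \<open>S i\<close>.\<close>
    also have "\<dots> \<ge> (\<Sum>p\<in>?Q. 1) + (\<Sum>p\<in>S i - ?Q. - 1)"
    proof (intro add_mono sum_mono)
      fix p assume "p \<in> ?Q"
      then show "1 \<le> ?c p" using n[of p] s by (auto simp: clamp1_def)
    next
      fix p show "- 1 \<le> ?c p" using s by (auto simp: clamp1_def)
    qed
    finally have "real (card ?Q) \<le> real (card (S i - ?Q))" by simp
    moreover have "card (S i - ?Q) = card (S i) - card ?Q" "card ?Q \<le> card (S i)"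
      using finS by (auto intro: card_Diff_subset card_mono)
    ultimately show ?thesis by linarith
  qed
  have "2 * card {p \<in> S i. ?f l p > 0} \<le> card (S i) \<and> 2 * card {p \<in> S i. ?f l p < 0} \<le> card (S i)" if "i < M" for i
    using half[OF that, of 1] half[OF that, of "-1"] by simp
  then show ?thesis
    using pol_kpol[OF M, of l] kpol_nonzero[OF l(1), of e] by blast
qed

text \<open>On the line through x and y both factors restrict to nonzero univariate
  polynomials.\<close>

lemma pol_mult_nonzero:
  assumes f: "pol d f" "f x \<noteq> 0" and g: "pol e g" "g y \<noteq> 0"
  shows "\<exists>z. f z * g z \<noteq> 0"
proof -
  obtain p where p: "\<And>t. f (x + t *\<^sub>R (y - x)) = poly p t" using pol_line[OF f(1)] by blast
  obtain q where q: "\<And>t. g (x + t *\<^sub>R (y - x)) = poly q t" using pol_line[OF g(1)] by blast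
  have "p \<noteq> 0" using p[of 0] f(2) by auto
  moreover have "q \<noteq> 0" using q[of 1] g(2) by auto
  ultimately obtain t where "poly (p * q) t \<noteq> 0" using poly_all_0_iff_0 by (metis mult_eq_0_iff)
  then show ?thesis using p q by (metis poly_mult)
qed

text \<open>The degree spent in j bisections. Bisecting 2^j cells at once takes more than 2^j
  monomials, that is e^3 > 2^j, and costs degree 3 * e; e is taken to be a power of 2.\<close>

primrec pdeg :: "nat \<Rightarrow> nat" where
  "pdeg 0 = 0"
| "pdeg (Suc j) = pdeg j + 3 * 2 ^ (j div 3 + 1)"

text \<open>Three consecutive steps use the same e = 2^(L + 1) and together cost 18 * 2^L, so the
  sum is geometric.\<close>

lemma pdeg_le: "pdeg (3 * L) \<le> 18 * 2 ^ L"
proof (induction L)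
  case (Suc L)
  have "pdeg (3 * Suc L) = pdeg (3 * L) + 18 * 2 ^ L"
  proof -
    have s: "3 * Suc L = Suc (Suc (Suc (3 * L)))" by simp
    have "3 * L div 3 = L" "Suc (3 * L) div 3 = L" "Suc (Suc (3 * L)) div 3 = L" by presburger+
    then show ?thesis unfolding s by (simp only: pdeg.simps) simp
  qed
  then show ?case using Suc by simp
qed simp

text \<open>The map \<open>\<sigma>\<close> labels the cells by sign patterns; a cell need not be connected, but \<open>\<sigma>\<close> is constant on
  connected sets avoiding the zero set.\<close>

lemma polynomial_partitioning:
  assumes P: "finite P"
  shows "\<exists>F \<sigma>. pol (pdeg j) F \<and> (\<exists>x. F x \<noteq> 0) \<and>
     (\<forall>U x y. connected U \<longrightarrow> (\<forall>z\<in>U. F z \<noteq> 0) \<longrightarrow> x \<in> U \<longrightarrow> y \<in> U \<longrightarrow> \<sigma> x = \<sigma> y) \<and>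
     (\<forall>x. \<sigma> x < (2::nat) ^ j) \<and> (\<forall>k. 2 ^ j * card {p \<in> P. F p \<noteq> 0 \<and> \<sigma> p = k} \<le> card P)"
proof (induction j)
  case 0
  have "card {p \<in> P. (1::real) \<noteq> 0 \<and> 0 = k} \<le> card P" for k :: nat using P by (intro card_mono) auto
  then show ?case by (intro exI[of _ "\<lambda>_. 1"] exI[of _ "\<lambda>_. 0"]) (auto intro: pol_const)
next
  case (Suc j)
  from Suc.IH obtain F \<sigma> where IH: "pol (pdeg j) F" "\<exists>x. F x \<noteq> 0"
     "\<forall>U x y. connected U \<longrightarrow> (\<forall>z\<in>U. F z \<noteq> 0) \<longrightarrow> x \<in> U \<longrightarrow> y \<in> U \<longrightarrow> \<sigma> x = \<sigma> y"
     "\<forall>x. \<sigma> x < (2::nat) ^ j" "\<forall>k. 2 ^ j * card {p \<in> P. F p \<noteq> 0 \<and> \<sigma> p = k} \<le> card P"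
    by blast
  note F = IH(1) and nz = IH(2) and lt = IH(4)[rule_format] and cd = IH(5)[rule_format]
  have const: "\<sigma> x = \<sigma> y" if "connected U" "\<And>z. z \<in> U \<Longrightarrow> F z \<noteq> 0" "x \<in> U" "y \<in> U" for U x y
    using IH(3) that by blast
  define S where "S i = {p \<in> P. F p \<noteq> 0 \<and> \<sigma> p = i}" for i
  have "(2::nat) ^ j < (2 ^ (j div 3 + 1)) ^ 3"
  proof -
    have "j < (j div 3 + 1) * 3" by presburger
    then show ?thesis unfolding power_mult[symmetric] by (intro power_strict_increasing) simp_all
  qed
  note less = this
  have finS: "finite (S i)" for i using P by (simp add: S_def)
  obtain f where f0: "pol (3 * 2 ^ (j div 3 + 1)) f \<and> (\<exists>x. f x \<noteq> 0) \<and>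
     (\<forall>i<2 ^ j. 2 * card {p \<in> S i. f p > 0} \<le> card (S i) \<and> 2 * card {p \<in> S i. f p < 0} \<le> card (S i))"
    using polynomial_ham_sandwich[OF less finS] by (rule exE)
  have f: "pol (3 * 2 ^ (j div 3 + 1)) f" "\<exists>x. f x \<noteq> 0"
    "\<And>i. i < 2 ^ j \<Longrightarrow> 2 * card {p \<in> S i. f p > 0} \<le> card (S i) \<and> 2 * card {p \<in> S i. f p < 0} \<le> card (S i)"
    using f0 by simp_all
  \<comment> \<open>Appends a binary digit, so the old label is \<open>k div 2\<close>. Digit 0 also
    covers f x = 0, but such points lie in the new zero set and are in no cell.\<close>
  define \<sigma>' where "\<sigma>' x = 2 * \<sigma> x + (if f x > 0 then 1 else 0)" for x
  show ?case
  proof (intro exI[of _ "\<lambda>x. F x * f x"] exI[of _ \<sigma>'] conjI allI impI)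
    show "pol (pdeg (Suc j)) (\<lambda>x. F x * f x)" using pol_mult[OF F f(1)] by simp
    show "\<exists>x. F x * f x \<noteq> 0" using pol_mult_nonzero[OF F _ f(1)] nz f(2) by blast
    fix U x y assume U: "connected U" "\<forall>z\<in>U. F z * f z \<noteq> 0" and xy: "x \<in> U" "y \<in> U"
    have "\<sigma> x = \<sigma> y" using const[of U x y] U xy by auto
    moreover have "f x > 0 \<longleftrightarrow> f y > 0"
    proof -
      have no: False if "a \<in> U" "b \<in> U" "f a > 0" "\<not> f b > 0" for a b
      proof -
        have "connected (f ` U)" by (intro connected_continuous_image pol_continuous_on[OF f(1)] U)
        then have "0 \<in> f ` U"
          using connectedD_interval[of "f ` U" "f b" "f a" 0] that by auto
        then show False using U(2) by auto
      qed
      then show ?thesis using xy by blast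
    qed
    ultimately show "\<sigma>' x = \<sigma>' y" by (simp add: \<sigma>'_def)
  next
    fix x show "\<sigma>' x < 2 ^ Suc j" using lt[of x] by (auto simp: \<sigma>'_def)
  next
    fix k
    let ?T = "{p \<in> P. F p * f p \<noteq> 0 \<and> \<sigma>' p = k}"
    have "2 * card ?T \<le> card (S (k div 2))"
    proof (cases "k div 2 < 2 ^ j")
      case True
      show ?thesis
      proof (cases "odd k")
        case odd: True
        have "?T \<subseteq> {p \<in> S (k div 2). f p > 0}"
          using odd by (auto simp: S_def \<sigma>'_def split: if_splits)
        then have "card ?T \<le> card {p \<in> S (k div 2). f p > 0}" using finS by (intro card_mono) auto
        then show ?thesis using f(3)[OF True] by linarith
      next
        case even: False
        have "?T \<subseteq> {p \<in> S (k div 2). f p < 0}"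
          using even by (auto simp: S_def \<sigma>'_def split: if_splits)
        then have "card ?T \<le> card {p \<in> S (k div 2). f p < 0}" using finS by (intro card_mono) auto
        then show ?thesis using f(3)[OF True] by linarith
      qed
    next
      case False
      have "?T = {}" using lt False by (auto simp: \<sigma>'_def split: if_splits)
      then show ?thesis by (metis card.empty mult_0_right zero_le)
    qed
    then have "2 ^ j * (2 * card ?T) \<le> 2 ^ j * card (S (k div 2))" by (rule mult_le_mono2)
    also have "\<dots> \<le> card P" using cd by (simp add: S_def)
    finally show "2 ^ Suc j * card ?T \<le> card P" by (simp add: mult_ac)
  qed
qed

section \<open>Polynomials vanishing on spheres and on circles of a sphere\<close>

lemma circ_subset_sphere:
  assumes "norm p = r" "norm q = r" "p \<bullet> q = 0"
  shows "circ c p q \<subseteq> sphere c r"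
proof
  fix z assume "z \<in> circ c p q"
  then obtain x y where z: "z = c + x *\<^sub>R p + y *\<^sub>R q" "x\<^sup>2 + y\<^sup>2 = 1" by (auto simp: circ_def)
  have pp: "p \<bullet> p = r\<^sup>2" "q \<bullet> q = r\<^sup>2" using assms by (simp_all add: dot_square_norm)
  have "(norm (z - c))\<^sup>2 = (x *\<^sub>R p + y *\<^sub>R q) \<bullet> (x *\<^sub>R p + y *\<^sub>R q)"
    by (simp add: z(1) dot_square_norm add.assoc)
  also have "\<dots> = r\<^sup>2 * (x\<^sup>2 + y\<^sup>2)"
    using pp assms(3) by (simp add: inner_add_left inner_add_right inner_commute[of q p] power2_eq_square algebra_simps)
  finally have "(norm (z - c))\<^sup>2 = r\<^sup>2" using z(2) by simp
  moreover have "r \<ge> 0" using assms(1) norm_ge_zero by metis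
  ultimately have "norm (z - c) = r" by (simp add: power2_eq_iff_nonneg)
  then show "z \<in> sphere c r" by (simp add: dist_norm norm_minus_commute)
qed

text \<open>Gram--Schmidt turns y - c into a vector orthogonal to p. The purpose is to join two
  points of a sphere by a circle, as \<open>pol_line\<close> does in space.\<close>

lemma great_circle_through:
  assumes r: "r > 0" and p: "norm p = r" and y: "y \<in> sphere c r"
  obtains q where "norm q = r" "p \<bullet> q = 0" "y \<in> circ c p q"
proof -
  define v where "v = y - c"
  have v: "norm v = r" using y by (simp add: v_def dist_norm norm_minus_commute)
  have pp: "p \<bullet> p = r\<^sup>2" "v \<bullet> v = r\<^sup>2" using p v by (simp_all add: dot_square_norm)
  define x where "x = (v \<bullet> p) / r\<^sup>2"
  define w where "w = v - x *\<^sub>R p"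
  have pw: "p \<bullet> w = 0" using r by (simp add: w_def x_def inner_diff_right pp inner_commute)
  have vv: "r\<^sup>2 = x\<^sup>2 * r\<^sup>2 + (norm w)\<^sup>2"
  proof -
    have "r\<^sup>2 = (x *\<^sub>R p + w) \<bullet> (x *\<^sub>R p + w)" using pp by (simp add: w_def)
    also have "\<dots> = x * x * (p \<bullet> p) + 2 * x * (p \<bullet> w) + w \<bullet> w"
      by (simp add: inner_add_left inner_add_right inner_commute[of w p] algebra_simps)
    finally show ?thesis unfolding power2_norm_eq_inner using pw pp by (simp add: power2_eq_square)
  qed
  show ?thesis
  proof (cases "w = 0")
    \<comment> \<open>Here y is c + p or c - p, which every great circle through c + p
      contains.\<close>
    case True
    obtain u where u: "u \<noteq> 0" "orthogonal p u" using orthogonal_to_vector_exists[of p] by auto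
    have "x\<^sup>2 = 1" using vv True r by simp
    moreover have "y = c + x *\<^sub>R p + 0 *\<^sub>R ((r / norm u) *\<^sub>R u)" using True by (simp add: w_def v_def algebra_simps)
    ultimately have "y \<in> circ c p ((r / norm u) *\<^sub>R u)" unfolding circ_def by fastforce
    then show ?thesis using u r that[of "(r / norm u) *\<^sub>R u"] by (simp add: orthogonal_def)
  next
    case False
    have "x\<^sup>2 + (norm w / r)\<^sup>2 = 1" using vv r by (simp add: power_divide field_simps)
    moreover have "y = c + x *\<^sub>R p + (norm w / r) *\<^sub>R ((r / norm w) *\<^sub>R w)"
      using False r by (simp add: w_def v_def algebra_simps)
    ultimately have "y \<in> circ c p ((r / norm w) *\<^sub>R w)" unfolding circ_def by blast
    then show ?thesis using False r pw that[of "(r / norm w) *\<^sub>R w"] by simp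
  qed
qed

lemma sphere_nonempty: "r \<ge> 0 \<Longrightarrow> sphere (c :: real^3) r \<noteq> {}"
proof -
  assume "r \<ge> 0"
  then have "c + r *\<^sub>R axis 1 1 \<in> sphere c r" by (simp add: dist_norm norm_axis_1)
  then show ?thesis by blast
qed

lemma infinite_circ:
  assumes r: "r > 0" "norm p = r" "norm q = r" "p \<bullet> q = 0"
  shows "infinite (circ c p q)"
proof
  assume fin: "finite (circ c p q)"
  have pp: "p \<bullet> p = r\<^sup>2" using r by (simp add: dot_square_norm)
  have "{-1..1} \<subseteq> (\<lambda>z. (z - c) \<bullet> p / r\<^sup>2) ` circ c p q"
  proof
    fix x :: real assume x: "x \<in> {-1..1}"
    then have "x\<^sup>2 \<le> 1" by (simp add: abs_square_le_1 abs_le_iff)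
    then have "x\<^sup>2 + (sqrt (1 - x\<^sup>2))\<^sup>2 = 1" by simp
    then have "c + x *\<^sub>R p + sqrt (1 - x\<^sup>2) *\<^sub>R q \<in> circ c p q" unfolding circ_def by blast
    moreover have "x = (c + x *\<^sub>R p + sqrt (1 - x\<^sup>2) *\<^sub>R q - c) \<bullet> p / r\<^sup>2"
      using r pp by (simp add: inner_add_left inner_commute[of q p] algebra_simps)
    ultimately show "x \<in> (\<lambda>z. (z - c) \<bullet> p / r\<^sup>2) ` circ c p q" by blast
  qed
  then have "finite {-1..1::real}" using fin finite_subset by blast
  then show False using infinite_Icc[of "-1" "1::real"] by simp
qed

text \<open>Irreducibility of the sphere: on a great circle through x and y each factor has only
  finitely many zeros, and the circle is infinite.\<close>

lemma pol_mult_nonzero_on_sphere: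
  assumes f: "pol d f" "x \<in> sphere c r" "f x \<noteq> 0" and g: "pol e g" "y \<in> sphere c r" "g y \<noteq> 0" and r: "r > 0"
  shows "\<exists>z\<in>sphere c r. f z * g z \<noteq> 0"
proof -
  have nx: "norm (x - c) = r" using f(2) by (simp add: dist_norm norm_minus_commute)
  obtain q where q: "norm q = r" "(x - c) \<bullet> q = 0" "y \<in> circ c (x - c) q"
    using great_circle_through[OF r nx g(2)] by blast
  let ?C = "circ c (x - c) q"
  have "x = c + 1 *\<^sub>R (x - c) + 0 *\<^sub>R q" by simp
  moreover have "1\<^sup>2 + 0\<^sup>2 = (1::real)" by simp
  ultimately have x: "x \<in> ?C" unfolding circ_def by blast
  have "finite {z \<in> ?C. f z = 0}" "finite {z \<in> ?C. g z = 0}"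
    using pol_zeros_circ(1)[OF f(1) x f(3)] pol_zeros_circ(1)[OF g(1) q(3) g(3)] .
  then have *: "infinite (?C - ({z \<in> ?C. f z = 0} \<union> {z \<in> ?C. g z = 0}))"
    using infinite_circ[OF r nx q(1,2)] by simp
  obtain z where "z \<in> ?C" "f z \<noteq> 0" "g z \<noteq> 0"
  proof -
    have "?C - ({z \<in> ?C. f z = 0} \<union> {z \<in> ?C. g z = 0}) \<noteq> {}" using * by (metis finite.emptyI)
    then show ?thesis using that by blast
  qed
  then show ?thesis using circ_subset_sphere[OF nx q(1,2)] by auto
qed

lemma pol_prod_nonzero_on_sphere:
  assumes "finite I" "\<And>i. i \<in> I \<Longrightarrow> pol d (f i)" "\<And>i. i \<in> I \<Longrightarrow> \<exists>x\<in>sphere c r. f i x \<noteq> 0" and r: "r > 0"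
  shows "\<exists>x\<in>sphere c r. (\<Prod>i\<in>I. f i x) \<noteq> 0"
  using assms(1-3)
proof (induction I rule: finite_induct)
  case empty
  have "sphere c r \<noteq> {}" using r by (intro sphere_nonempty) simp
  then show ?case by (metis ex_in_conv prod.empty zero_neq_one)
next
  case (insert i I)
  then obtain y where "y \<in> sphere c r" "(\<Prod>i\<in>I. f i y) \<noteq> 0" by blast
  moreover obtain x where "x \<in> sphere c r" "f i x \<noteq> 0" using insert.prems(2) by blast
  ultimately have "\<exists>z\<in>sphere c r. f i z * (\<Prod>i\<in>I. f i z) \<noteq> 0"
    using insert r by (intro pol_mult_nonzero_on_sphere[where d = d and e = "d * card I"] pol_prod) auto
  then show ?case using insert by simp
qed

section \<open>Division by the equation of a sphere\<close>

definition sphere_pol :: "real^3 \<Rightarrow> real \<Rightarrow> real^3 \<Rightarrow> real" where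
  "sphere_pol a r x = (norm (x - a))\<^sup>2 - r\<^sup>2"

lemma sphere_pol_coords:
  "sphere_pol a r x = (x $ 1 - a $ 1)\<^sup>2 + (x $ 2 - a $ 2)\<^sup>2 + (x $ 3 - a $ 3)\<^sup>2 - r\<^sup>2"
  unfolding sphere_pol_def power2_norm_eq_inner
  by (simp add: inner_vec_def sum_3 power2_eq_square)

lemma pol_sphere_pol: "pol 2 (sphere_pol a r)"
proof -
  have "pol (1 * 2) (\<lambda>x. (x $ i - a $ i) ^ 2)" for i
    by (intro pol_power pol_diff pol_coord pol_const) auto
  then have "pol 2 (\<lambda>x. (x $ 1 - a $ 1)\<^sup>2 + (x $ 2 - a $ 2)\<^sup>2 + (x $ 3 - a $ 3)\<^sup>2 - r\<^sup>2)"
    by (intro pol_diff pol_add pol_const) auto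
  then show ?thesis unfolding sphere_pol_coords[abs_def] .
qed

lemma sphere_pol_eq_0_iff: "r > 0 \<Longrightarrow> sphere_pol a r x = 0 \<longleftrightarrow> x \<in> sphere a r"
  by (auto simp: sphere_pol_def dist_norm norm_minus_commute power2_eq_iff_nonneg)

text \<open>Polynomials in the first two coordinates. They are the coefficients of remainders modulo
  \<open>sphere_pol\<close>, which is monic quadratic in the third coordinate. Degrees stay
  unspecified; \<open>card_spheres_in_zero_set\<close> recovers them on a line.\<close>

definition cylindrical :: "(real^3 \<Rightarrow> real) \<Rightarrow> bool" where
  "cylindrical A \<longleftrightarrow> (\<exists>d. pol d A) \<and> (\<forall>x y. x $ 1 = y $ 1 \<longrightarrow> x $ 2 = y $ 2 \<longrightarrow> A x = A y)"

lemma cylindrical_intros: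
  "cylindrical (\<lambda>_. c)" "cylindrical (\<lambda>x. x $ 1)" "cylindrical (\<lambda>x. x $ 2)"
  "cylindrical A \<Longrightarrow> cylindrical B \<Longrightarrow> cylindrical (\<lambda>x. A x + B x)"
  "cylindrical A \<Longrightarrow> cylindrical B \<Longrightarrow> cylindrical (\<lambda>x. A x * B x)"
proof -
  show "cylindrical (\<lambda>_. c)" "cylindrical (\<lambda>x. x $ 1)" "cylindrical (\<lambda>x. x $ 2)"
    by (auto simp: cylindrical_def intro: pol_const pol_coord[of 1])
  assume A: "cylindrical A" and B: "cylindrical B"
  then obtain d e where de: "pol d A" "pol e B" by (auto simp: cylindrical_def)
  have "pol (max d e) (\<lambda>x. A x + B x)"
    using pol_mono[OF de(1)] pol_mono[OF de(2)] by (intro pol_add) auto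
  moreover have "A x + B x = A y + B y" "A x * B x = A y * B y" if "x $ 1 = y $ 1" "x $ 2 = y $ 2" for x y
    using A B that unfolding cylindrical_def by metis+
  ultimately show "cylindrical (\<lambda>x. A x + B x)" "cylindrical (\<lambda>x. A x * B x)"
    using pol_mult[OF de] unfolding cylindrical_def by blast+
qed

text \<open>Division with remainder in z = x $ 3 - a $ 3. Only products create z^2, and there it is
  replaced using the equation of the sphere.\<close>

lemma pol_reduce_mod_sphere:
  "pol d f \<Longrightarrow> \<exists>g A B. (\<exists>e. pol e g) \<and> cylindrical A \<and> cylindrical B \<and>
     (\<forall>x. f x = sphere_pol a r x * g x + A x + (x $ 3 - a $ 3) * B x)"
proof (induction rule: pol.induct)
  case (pol_const d c)
  then show ?case
    by (intro exI[of _ "\<lambda>_. 0"] exI[of _ "\<lambda>_. c"]) (auto intro: cylindrical_intros pol.pol_const)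
next
  case (pol_coord d i)
  consider "i = 1" | "i = 2" | "i = 3" using exhaust_3[of i] by blast
  then show ?case
  proof cases
    case 1
    then show ?thesis
      by (intro exI[of _ "\<lambda>_. 0"] exI[of _ "\<lambda>x. x $ 1"]) (auto intro: cylindrical_intros pol.pol_const)
  next
    case 2
    then show ?thesis
      by (intro exI[of _ "\<lambda>_. 0"] exI[of _ "\<lambda>x. x $ 2"]) (auto intro: cylindrical_intros pol.pol_const)
  next
    case 3
    then show ?thesis
      by (intro exI[of _ "\<lambda>_. 0"] exI[of _ "\<lambda>_. a $ 3"] exI[of _ "\<lambda>_. 1"]) (auto intro: cylindrical_intros pol.pol_const)
  qed
next
  case (pol_add d f g)
  then obtain h A B h' A' B' e e' where *: "pol e h" "cylindrical A" "cylindrical B"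
     "\<And>x. f x = sphere_pol a r x * h x + A x + (x $ 3 - a $ 3) * B x"
     "pol e' h'" "cylindrical A'" "cylindrical B'"
     "\<And>x. g x = sphere_pol a r x * h' x + A' x + (x $ 3 - a $ 3) * B' x" by metis
  have "pol (max e e') (\<lambda>x. h x + h' x)"
    using pol_mono[OF *(1)] pol_mono[OF *(5)] by (intro pol.pol_add) auto
  moreover have "f x + g x = sphere_pol a r x * (h x + h' x) + (A x + A' x) + (x $ 3 - a $ 3) * (B x + B' x)" for x
    unfolding *(4,8) by (simp add: algebra_simps)
  moreover have "cylindrical (\<lambda>x. A x + A' x)" "cylindrical (\<lambda>x. B x + B' x)"
    using * cylindrical_intros by blast+
  ultimately show ?case
    by (intro exI[of _ "\<lambda>x. h x + h' x"] exI[of _ "\<lambda>x. A x + A' x"] exI[of _ "\<lambda>x. B x + B' x"]) blast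
next
  case (pol_mult d f d' g)
  then obtain h A B h' A' B' e e' where *: "pol e h" "cylindrical A" "cylindrical B"
     "\<And>x. f x = sphere_pol a r x * h x + A x + (x $ 3 - a $ 3) * B x"
     "pol e' h'" "cylindrical A'" "cylindrical B'"
     "\<And>x. g x = sphere_pol a r x * h' x + A' x + (x $ 3 - a $ 3) * B' x" by metis
  obtain k1 k2 where k: "pol k1 B" "pol k2 B'" using *(3,7) by (auto simp: cylindrical_def)
  \<comment> \<open>The remainder of z^2, with minus signs written as factors -1 to match
    \<open>cylindrical_intros\<close>.\<close>
  define s where "s x = r\<^sup>2 + (-1) * ((x $ 1 + (- a $ 1)) * (x $ 1 + (- a $ 1))) + (-1) * ((x $ 2 + (- a $ 2)) * (x $ 2 + (- a $ 2)))"
    for x :: "real^3"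
  have s: "cylindrical s" unfolding s_def by (intro cylindrical_intros)
  have z2: "(x $ 3 - a $ 3) * (x $ 3 - a $ 3) = sphere_pol a r x + s x" for x
    by (simp add: sphere_pol_coords s_def power2_eq_square)
  \<comment> \<open>The quotient of the product; the bracket is the remainder A + z B of f.\<close>
  define h'' where "h'' x = h x * g x + (f x - sphere_pol a r x * h x) * h' x + B x * B' x" for x
  have "pol (Suc (e + d' + d + 2 + e + e' + k1 + k2)) h''"
    unfolding h''_def
    by (intro pol.pol_add; rule pol_mono, (rule pol.pol_mult pol_diff pol_mono[OF pol_mult.hyps(1), of "d + 2 + e"] 
       pol_mono[OF pol.pol_mult[OF pol_sphere_pol *(1)], of "d + 2 + e"] * pol_mult.hyps k | simp)+)
  moreover have "f x * g x = sphere_pol a r x * h'' x + (A x * A' x + s x * (B x * B' x)) + (x $ 3 - a $ 3) * (A x * B' x + A' x * B x)" for x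
  proof -
    define q z where "q = sphere_pol a r x" and "z = x $ 3 - a $ 3"
    have "f x * g x = q * (h x * g x) + (A x + z * B x) * g x"
      by (simp add: *(4)[of x] q_def z_def algebra_simps)
    also have "\<dots> = q * (h x * g x + (A x + z * B x) * h' x) + (A x * A' x + z * (A x * B' x + A' x * B x) + z * z * (B x * B' x))"
      by (simp add: *(8)[of x] q_def z_def algebra_simps)
    also have "z * z = q + s x" using z2 by (simp add: q_def z_def)
    finally show ?thesis by (simp add: h''_def *(4)[of x] q_def z_def algebra_simps)
  qed
  moreover have "cylindrical (\<lambda>x. A x * A' x + s x * (B x * B' x))" "cylindrical (\<lambda>x. A x * B' x + A' x * B x)"
    using * s by (auto intro!: cylindrical_intros)
  ultimately show ?case by blast
qed

text \<open>The point a lies inside the cylinder, so on the line from a to x the restricted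
  polynomial has infinitely many roots and vanishes at x as well.\<close>

lemma cylindrical_eq_0:
  fixes a :: "real^3"
  assumes A: "cylindrical A" and r: "r > 0"
    and z: "\<And>x. (x $ 1 - a $ 1)\<^sup>2 + (x $ 2 - a $ 2)\<^sup>2 < r\<^sup>2 \<Longrightarrow> A x = 0"
  shows "A x = 0"
proof -
  obtain d where d: "pol d A" using A by (auto simp: cylindrical_def)
  obtain p where p: "\<And>t. A (a + t *\<^sub>R (x - a)) = poly p t" using pol_line[OF d] by blast
  define s where "s = (x $ 1 - a $ 1)\<^sup>2 + (x $ 2 - a $ 2)\<^sup>2"
  have s0: "s \<ge> 0" by (simp add: s_def)
  \<comment> \<open>As s \<le> (1 + s)^2, the condition t (1 + s) < r gives t^2 s < r^2 without
    square roots.\<close>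
  define e where "e = r / (1 + s)"
  have e: "e > 0" using r s0 by (simp add: e_def)
  have "poly p t = 0" if t: "0 < t" "t < e" for t
  proof -
    have "t\<^sup>2 * s < r\<^sup>2"
    proof -
      have "t * (1 + s) < r" using t s0 by (simp add: e_def field_simps)
      then have "(t * (1 + s))\<^sup>2 < r\<^sup>2" using t s0 by (intro power_strict_mono) auto
      moreover have "s \<le> (1 + s)\<^sup>2" using s0 by (simp add: power2_eq_square algebra_simps)
      then have "t\<^sup>2 * s \<le> (t * (1 + s))\<^sup>2" by (simp add: power_mult_distrib mult_left_mono)
      ultimately show ?thesis by linarith
    qed
    then have "A (a + t *\<^sub>R (x - a)) = 0" by (intro z) (simp add: s_def power_mult_distrib distrib_left)
    then show ?thesis using p by simp
  qed
  then have "{0<..<e} \<subseteq> {t. poly p t = 0}" by auto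
  then have "infinite {t. poly p t = 0}" using e infinite_Ioo finite_subset by metis
  then have "p = 0" using poly_roots_finite by blast
  then show ?thesis using p[of 1] by simp
qed

text \<open>Over an inner point of the disc lie two points of the sphere, where the remainder equals
  A + w B and A - w B with w > 0. So A and B vanish over the disc, hence everywhere.\<close>

lemma sphere_pol_divides:
  assumes f: "pol d f" and r: "r > 0" and z: "\<And>x. x \<in> sphere a r \<Longrightarrow> f x = 0"
  obtains g e where "pol e g" "\<And>x. f x = sphere_pol a r x * g x"
proof -
  obtain g A B e where *: "pol e g" "cylindrical A" "cylindrical B"
     "\<And>x. f x = sphere_pol a r x * g x + A x + (x $ 3 - a $ 3) * B x"
    using pol_reduce_mod_sphere[OF f, of a r] by blast
  have AB: "A x = 0 \<and> B x = 0" if x: "(x $ 1 - a $ 1)\<^sup>2 + (x $ 2 - a $ 2)\<^sup>2 < r\<^sup>2" for x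
  proof -
    define w where "w = sqrt (r\<^sup>2 - (x $ 1 - a $ 1)\<^sup>2 - (x $ 2 - a $ 2)\<^sup>2)"
    have w: "w > 0" "w\<^sup>2 = r\<^sup>2 - (x $ 1 - a $ 1)\<^sup>2 - (x $ 2 - a $ 2)\<^sup>2" using x by (auto simp: w_def)
    have "A x + s * B x = 0" if s: "s = w \<or> s = - w" for s
    proof -
      define y :: "real^3" where "y = vector [x $ 1, x $ 2, a $ 3 + s]"
      have y: "y $ 1 = x $ 1" "y $ 2 = x $ 2" "y $ 3 = a $ 3 + s" by (simp_all add: y_def)
      have "s\<^sup>2 = w\<^sup>2" using s by auto
      then have q: "sphere_pol a r y = 0" by (simp add: sphere_pol_coords y w(2))
      then have "f y = 0" using z sphere_pol_eq_0_iff[OF r] by blast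
      moreover have "A y = A x" "B y = B x" using *(2,3) y unfolding cylindrical_def by metis+
      ultimately show ?thesis using *(4)[of y] q y by simp
    qed
    from this[of w] this[of "-w"] show ?thesis using w(1) by auto
  qed
  have "A x = 0" "B x = 0" for x
    using cylindrical_eq_0[OF *(2) r, of a x] cylindrical_eq_0[OF *(3) r, of a x] AB by blast+
  then show ?thesis using that[OF *(1)] *(4) by simp
qed

text \<open>For different centres at distance l, the ends of the diameter along a - b have the
  different distances l + r and |l - r| from b.\<close>

lemma distinct_spheres:
  fixes a b :: "real^3"
  assumes "(a, r) \<noteq> (b, s)" "r > 0" "s > 0"
  shows "\<exists>x\<in>sphere a r. x \<notin> sphere b s"
proof (cases "a = b")
  case True
  then have "r \<noteq> s" using assms by auto
  moreover have "sphere a r \<noteq> {}" using assms by (intro sphere_nonempty) simp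
  ultimately show ?thesis using True by (metis ex_in_conv mem_sphere)
next
  case False
  define l where "l = norm (a - b)"
  have l: "l > 0" using False by (simp add: l_def)
  define u where "u = (1 / l) *\<^sub>R (a - b)"
  have u: "norm u = 1" "a - b = l *\<^sub>R u" using l by (simp_all add: u_def flip: l_def)
  have "norm (a + t *\<^sub>R u - b) = \<bar>l + t\<bar>" for t
  proof -
    have "a + t *\<^sub>R u - b = (l + t) *\<^sub>R u" using u(2) by (simp add: algebra_simps)
    then show ?thesis using u(1) by simp
  qed
  then have n: "dist b (a + t *\<^sub>R u) = \<bar>l + t\<bar>" for t by (simp add: dist_norm norm_minus_commute)
  have in_s: "a + r *\<^sub>R u \<in> sphere a r" "a + (- r) *\<^sub>R u \<in> sphere a r" using u assms by (auto simp: dist_norm)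
  show ?thesis
  proof (rule ccontr)
    assume "\<not> ?thesis"
    then have "dist b (a + r *\<^sub>R u) = s" "dist b (a + (-r) *\<^sub>R u) = s" using in_s by (metis mem_sphere)+
    then have "\<bar>l + r\<bar> = \<bar>l + - r\<bar>" unfolding n by simp
    then show False using l assms by linarith
  qed
qed

text \<open>The equations of the spheres are divided out one after another. Degrees are compared
  only at the end, on a line through \<open>x0\<close>, where f does not vanish identically.\<close>

lemma card_spheres_in_zero_set:
  assumes T: "finite T" "\<And>a r. (a, r) \<in> T \<Longrightarrow> r > 0" and f: "pol d f" "f x0 \<noteq> 0"
    and z: "\<And>a r x. (a, r) \<in> T \<Longrightarrow> x \<in> sphere a r \<Longrightarrow> f x = 0"
  shows "2 * card T \<le> d"
proof -
  have "\<exists>g e. pol e g \<and> (\<forall>x. f x = (\<Prod>t\<in>T. sphere_pol (fst t) (snd t) x) * g x)"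
    using T z
  proof (induction T rule: finite_induct)
    case empty
    then show ?case using f by auto
  next
    case (insert s T)
    obtain g e where g: "pol e g" "\<And>x. f x = (\<Prod>t\<in>T. sphere_pol (fst t) (snd t) x) * g x"
    proof -
      have "\<exists>g e. pol e g \<and> (\<forall>x. f x = (\<Prod>t\<in>T. sphere_pol (fst t) (snd t) x) * g x)"
        by (rule insert.IH) (use insert.prems in \<open>blast+\<close>)
      then show ?thesis using that by blast
    qed
    obtain a r where s: "s = (a, r)" by (cases s)
    have r: "r > 0" using insert s by auto
    have "\<exists>x\<in>sphere a r. (\<Prod>t\<in>T. sphere_pol (fst t) (snd t) x) \<noteq> 0"
    proof (rule pol_prod_nonzero_on_sphere[where d = 2])
      fix t assume t: "t \<in> T"
      then have "(a, r) \<noteq> (fst t, snd t)" "snd t > 0"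
        using insert.hyps(2) s insert.prems(1)[of "fst t" "snd t"] by auto
      then show "\<exists>x\<in>sphere a r. sphere_pol (fst t) (snd t) x \<noteq> 0"
        using distinct_spheres[of a r "fst t" "snd t"] r sphere_pol_eq_0_iff by blast
    qed (use insert r pol_sphere_pol in auto)
    then obtain y where y: "y \<in> sphere a r" "(\<Prod>t\<in>T. sphere_pol (fst t) (snd t) y) \<noteq> 0" by blast
    have pp: "pol (2 * card T) (\<lambda>x. \<Prod>t\<in>T. sphere_pol (fst t) (snd t) x)"
      using insert(1) pol_sphere_pol by (intro pol_prod) auto
    \<comment> \<open>The factors already split off do not vanish identically on the new sphere, so
      by irreducibility the cofactor does.\<close>
    have gz: "g x = 0" if x: "x \<in> sphere a r" for x
    proof (rule ccontr)
      assume "g x \<noteq> 0"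
      then obtain w where "w \<in> sphere a r" "(\<Prod>t\<in>T. sphere_pol (fst t) (snd t) w) * g w \<noteq> 0"
        using pol_mult_nonzero_on_sphere[OF pp y g(1) x _ r] by blast
      then show False using g(2)[of w] insert.prems(2)[of a r w] s by simp
    qed
    obtain h k where h: "pol k h" "\<And>x. g x = sphere_pol a r x * h x"
      using sphere_pol_divides[OF g(1) r gz] by blast
    have "f x = (\<Prod>t\<in>insert s T. sphere_pol (fst t) (snd t) x) * h x" for x
      using insert(1,2) by (simp add: g(2) h(2) s)
    then show ?case using h(1) by blast
  qed
  then obtain g e where g: "pol e g" "\<And>x. f x = (\<Prod>t\<in>T. sphere_pol (fst t) (snd t) x) * g x" by blast
  define v :: "real^3" where "v = axis 1 1"
  have v: "norm v = 1" by (simp add: v_def norm_axis_1)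
  obtain F where F: "degree F \<le> d" "\<And>t. f (x0 + t *\<^sub>R v) = poly F t" using pol_line[OF f(1)] by blast
  obtain G where G: "\<And>t. g (x0 + t *\<^sub>R v) = poly G t" using pol_line[OF g(1)] by blast
  \<comment> \<open>As v is a unit vector, every restricted equation is monic of degree exactly
    2.\<close>
  define Q where "Q s = [:(norm (x0 - fst s))\<^sup>2 - (snd s)\<^sup>2, 2 * ((x0 - fst s) \<bullet> v), 1:]" for s :: "(real^3) \<times> real"
  have Q: "sphere_pol (fst s) (snd s) (x0 + t *\<^sub>R v) = poly (Q s) t" for s t
  proof -
    define b where "b = x0 - fst s"
    have "x0 + t *\<^sub>R v - fst s = b + t *\<^sub>R v" by (simp add: b_def)
    then have "(norm (x0 + t *\<^sub>R v - fst s))\<^sup>2 = (b + t *\<^sub>R v) \<bullet> (b + t *\<^sub>R v)"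
      by (simp only: power2_norm_eq_inner)
    also have "\<dots> = b \<bullet> b + 2 * t * (b \<bullet> v) + t * t * (v \<bullet> v)"
      by (simp add: inner_add_left inner_add_right inner_commute[of v b] algebra_simps)
    also have "\<dots> = (norm b)\<^sup>2 + 2 * t * (b \<bullet> v) + t * t"
    proof -
      have "v \<bullet> v = 1" using v by (simp only: norm_eq_1)
      then show ?thesis by (simp only: dot_square_norm[of b] mult_1_right)
    qed
    finally show ?thesis by (simp add: sphere_pol_def Q_def b_def algebra_simps)
  qed
  have "poly F t = poly ((\<Prod>s\<in>T. Q s) * G) t" for t
    using g(2)[of "x0 + t *\<^sub>R v"] by (simp add: F(2) G Q poly_prod)
  then have FQ: "F = (\<Prod>s\<in>T. Q s) * G" by (simp add: poly_eq_poly_eq_iff[symmetric] fun_eq_iff)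
  have "F \<noteq> 0" using F(2)[of 0] f(2) by auto
  then have G0: "G \<noteq> 0" and Q0: "(\<Prod>s\<in>T. Q s) \<noteq> 0" using FQ by auto
  have "degree (\<Prod>s\<in>T. Q s) = (\<Sum>s\<in>T. degree (Q s))" by (rule degree_prod_eq_sum_degree) (simp add: Q_def)
  also have "\<dots> = 2 * card T" by (simp add: Q_def)
  finally have "degree F = 2 * card T + degree G" using FQ degree_mult_eq[OF Q0 G0] by simp
  then show ?thesis using F(1) by simp
qed

section \<open>Circles of fixed angular radius on a sphere\<close>

definition sphere_circle :: "real^3 \<Rightarrow> real \<Rightarrow> real \<Rightarrow> real^3 \<Rightarrow> (real^3) set" where
  "sphere_circle a r \<tau> u = {x \<in> sphere a r. (x - a) \<bullet> u = \<tau> * r}"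

text \<open>The point \<open>w\<close> is inside and \<open>-w\<close> outside of every circle, so each great circle through \<open>w\<close> meets all
  of them. A great circle avoiding their pairwise intersections and not contained in the zero set
  has a separate zero of \<open>f\<close> for each circle.\<close>

lemma card_circles_through_cap:
  assumes r: "r > 0" and f: "pol d f" and nz: "y0 \<in> sphere a r" "f y0 \<noteq> 0"
    and U: "finite U" "\<And>u. u \<in> U \<Longrightarrow> w \<bullet> u > \<bar>\<tau>\<bar>" and w: "norm w = 1"
    and fz: "\<And>u x. u \<in> U \<Longrightarrow> x \<in> sphere_circle a r \<tau> u \<Longrightarrow> f x = 0"
    and fin: "\<And>u v. u \<in> U \<Longrightarrow> v \<in> U \<Longrightarrow> u \<noteq> v \<Longrightarrow> finite (sphere_circle a r \<tau> u \<inter> sphere_circle a r \<tau> v)"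
  shows "card U \<le> 2 * d + 1"
proof -
  define X where "X = (\<Union>u\<in>U. \<Union>v\<in>U - {u}. sphere_circle a r \<tau> u \<inter> sphere_circle a r \<tau> v)"
  have finX: "finite X" unfolding X_def by (intro finite_UN_I finite_Diff fin U(1)) auto
  \<comment> \<open>For x in \<open>X\<close>, \<open>l x y\<close> vanishes exactly when y lies in
    the plane of a, x and the direction w.\<close>
  define l where "l x y = cross3 w (x - a) \<bullet> (y - a)" for x y
  have lnz: "\<exists>y\<in>sphere a r. l x y \<noteq> 0" if x: "x \<in> X" for x
  proof -
    obtain u where u: "u \<in> U" "x \<in> sphere_circle a r \<tau> u" using x by (auto simp: X_def)
    have nx: "norm (x - a) = r" "(x - a) \<bullet> u = \<tau> * r"
      using u by (auto simp: sphere_circle_def dist_norm norm_minus_commute)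
    \<comment> \<open>A point of a circle in direction w or -w would give |w \<bullet> u| =
      |\<tau>|.\<close>
    have c: "cross3 w (x - a) \<noteq> 0"
    proof
      assume "cross3 w (x - a) = 0"
      then have "collinear {0, w, x - a}" by (simp add: cross_eq_0)
      then obtain k where k: "x - a = k *\<^sub>R w" using w
        by (metis collinear_lemma norm_zero scale_zero_left zero_neq_one)
      then have "\<bar>k\<bar> = r" using nx w by simp
      moreover have "k * (w \<bullet> u) = \<tau> * r" using nx k by simp
      ultimately have "r * \<bar>w \<bullet> u\<bar> = r * \<bar>\<tau>\<bar>" using r by (metis abs_mult abs_of_pos mult.commute)
      then show False using U(2)[OF u(1)] r by auto
    qed
    define n where "n = cross3 w (x - a)"
    have "a + (r / norm n) *\<^sub>R n \<in> sphere a r" using c r by (simp add: dist_norm n_def)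
    moreover have "l x (a + (r / norm n) *\<^sub>R n) \<noteq> 0" using c r by (simp add: l_def n_def)
    ultimately show ?thesis by blast
  qed
  have lp: "pol 1 (l x)" for x unfolding l_def by (rule pol_inner)
  have "\<exists>y1\<in>sphere a r. (\<Prod>x\<in>X. l x y1) \<noteq> 0"
    using finX lp lnz r by (intro pol_prod_nonzero_on_sphere[where d = 1])
  then obtain y1 where "y1 \<in> sphere a r" "(\<Prod>x\<in>X. l x y1) \<noteq> 0" by blast
  \<comment> \<open>Irreducibility of the sphere combines the nonvanishing of f with that of all the
    planes.\<close>
  then obtain y where y: "y \<in> sphere a r" "f y * (\<Prod>x\<in>X. l x y) \<noteq> 0"
    using pol_mult_nonzero_on_sphere[OF f nz pol_prod[OF finX, of 1 l, OF lp] _ _ r] by blast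
  then have fy: "f y \<noteq> 0" and ly: "\<And>x. x \<in> X \<Longrightarrow> l x y \<noteq> 0" using finX by auto
  have nw: "norm (r *\<^sub>R w) = r" using w r by simp
  obtain q where q: "norm q = r" "(r *\<^sub>R w) \<bullet> q = 0" "y \<in> circ a (r *\<^sub>R w) q"
    using great_circle_through[OF r nw y(1)] by blast
  let ?C = "circ a (r *\<^sub>R w) q"
  have "\<exists>z. z \<in> ?C \<inter> sphere_circle a r \<tau> u" if u: "u \<in> U" for u
  proof -
    define \<phi> where "\<phi> t = (cos t *\<^sub>R (r *\<^sub>R w) + sin t *\<^sub>R q) \<bullet> u" for t
    have "w \<bullet> u > \<tau>" "- (w \<bullet> u) < \<tau>" using U(2)[OF u] by auto
    moreover have "\<phi> 0 = r * (w \<bullet> u)" "\<phi> pi = r * (- (w \<bullet> u))" by (simp_all add: \<phi>_def)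
    ultimately have "\<phi> pi \<le> \<tau> * r" "\<tau> * r \<le> \<phi> 0"
      using r by (simp_all only: mult.commute[of \<tau> r] mult_le_cancel_left_pos less_imp_le)
    moreover have "continuous_on {0..pi} \<phi>" unfolding \<phi>_def by (intro continuous_intros)
    ultimately obtain t where t: "\<phi> t = \<tau> * r" using IVT2'[of \<phi> pi "\<tau> * r" 0] by auto
    let ?z = "a + cos t *\<^sub>R (r *\<^sub>R w) + sin t *\<^sub>R q"
    have "?z \<in> ?C" unfolding circ_def using sin_cos_squared_add2[of t] by blast
    moreover have "(?z - a) \<bullet> u = \<tau> * r" using t by (simp add: \<phi>_def add.assoc)
    moreover have "?z \<in> sphere a r" using circ_subset_sphere[OF nw q(1,2)] \<open>?z \<in> ?C\<close> by blast
    ultimately show ?thesis unfolding sphere_circle_def by blast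
  qed
  then obtain Z where Z: "\<And>u. u \<in> U \<Longrightarrow> Z u \<in> ?C \<inter> sphere_circle a r \<tau> u" by metis
  have "inj_on Z U"
  proof (rule inj_onI, rule ccontr)
    fix u v assume uv: "u \<in> U" "v \<in> U" "Z u = Z v" "u \<noteq> v"
    then have "Z u \<in> sphere_circle a r \<tau> u \<inter> sphere_circle a r \<tau> v" using Z[of u] Z[of v] by auto
    then have "Z u \<in> X" using uv by (auto simp: X_def)
    \<comment> \<open>\<open>Z u\<close> lies on the great circle through y in direction w, so it is
      in their plane.\<close>
    moreover have "l (Z u) y = 0"
    proof -
      obtain s t where st: "Z u = a + s *\<^sub>R (r *\<^sub>R w) + t *\<^sub>R q" using Z[OF uv(1)] by (auto simp: circ_def)
      obtain s' t' where st': "y = a + s' *\<^sub>R (r *\<^sub>R w) + t' *\<^sub>R q" using q(3) by (auto simp: circ_def)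
      show ?thesis
        by (simp add: l_def st st' cross_add_right cross_mult_right inner_add_right dot_cross_self add.assoc)
    qed
    ultimately show False using ly by blast
  qed
  moreover have "Z ` U \<subseteq> {x \<in> ?C. f x = 0}" using Z fz by fastforce
  ultimately have "card U \<le> card {x \<in> ?C. f x = 0}"
    using pol_zeros_circ(1)[OF f q(3) fy] by (metis card_inj_on_le)
  also have "\<dots> \<le> 2 * d + 1" by (rule pol_zeros_circ(2)[OF f q(3) fy])
  finally show ?thesis .
qed

text \<open>By compactness finitely many w suffice for every axis u to satisfy w \<bullet> u >
  |\<tau>| for one of them. This set depends on \<tau> alone, so K is uniform in the sphere and in
  the polynomial.\<close>

lemma card_circles_in_zero_set:
  assumes \<tau>: "\<bar>\<tau>\<bar> < 1"
  shows "\<exists>K. \<forall>d f a r y U. r > 0 \<longrightarrow> pol d f \<longrightarrow> y \<in> sphere a r \<longrightarrow> f y \<noteq> 0 \<longrightarrow> finite U \<longrightarrow>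
     (\<forall>u\<in>U. norm u = 1 \<and> (\<forall>x\<in>sphere_circle a r \<tau> u. f x = 0)) \<longrightarrow>
     (\<forall>u\<in>U. \<forall>v\<in>U. u \<noteq> v \<longrightarrow> finite (sphere_circle a r \<tau> u \<inter> sphere_circle a r \<tau> v)) \<longrightarrow>
     card U \<le> K * (2 * d + 1)"
proof -
  have "compact (sphere (0::real^3) 1)" by simp
  moreover have "sphere (0::real^3) 1 \<subseteq> (\<Union>w\<in>sphere 0 1. {u. w \<bullet> u > \<bar>\<tau>\<bar>})"
  proof
    fix u :: "real^3" assume u: "u \<in> sphere 0 1"
    then have "u \<bullet> u > \<bar>\<tau>\<bar>" using \<tau> by (simp add: dot_square_norm)
    then show "u \<in> (\<Union>w\<in>sphere 0 1. {u. w \<bullet> u > \<bar>\<tau>\<bar>})" using u by blast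
  qed
  moreover have "open {u::real^3. w \<bullet> u > \<bar>\<tau>\<bar>}" for w by (rule open_halfspace_gt)
  ultimately obtain W where W: "W \<subseteq> sphere 0 1" "finite W" "sphere (0::real^3) 1 \<subseteq> (\<Union>w\<in>W. {u. w \<bullet> u > \<bar>\<tau>\<bar>})"
    by (metis (no_types, lifting) compactE_image)
  show ?thesis
  proof (intro exI[of _ "card W"] allI impI)
    fix d f a r y U
    assume r: "(r::real) > 0" and f: "pol d f" and y: "y \<in> sphere a r" "f y \<noteq> 0" and U: "finite U"
      and uz: "\<forall>u\<in>U. norm u = 1 \<and> (\<forall>x\<in>sphere_circle a r \<tau> u. f x = 0)"
      and fin: "\<forall>u\<in>U. \<forall>v\<in>U. u \<noteq> v \<longrightarrow> finite (sphere_circle a r \<tau> u \<inter> sphere_circle a r \<tau> v)"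
    have "U \<subseteq> (\<Union>w\<in>W. {u\<in>U. w \<bullet> u > \<bar>\<tau>\<bar>})"
    proof
      fix u assume "u \<in> U"
      then have "u \<in> sphere 0 1" using uz by simp
      then show "u \<in> (\<Union>w\<in>W. {u\<in>U. w \<bullet> u > \<bar>\<tau>\<bar>})" using W(3) \<open>u \<in> U\<close> by blast
    qed
    then have "card U \<le> card (\<Union>w\<in>W. {u\<in>U. w \<bullet> u > \<bar>\<tau>\<bar>})" using U W(2) by (intro card_mono) auto
    also have "\<dots> \<le> (\<Sum>w\<in>W. card {u\<in>U. w \<bullet> u > \<bar>\<tau>\<bar>})" by (rule card_UN_le[OF W(2)])
    also have "\<dots> \<le> (\<Sum>w\<in>W. 2 * d + 1)"
    proof (rule sum_mono)
      fix w assume "w \<in> W"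
      then have "norm w = 1" using W(1) by auto
      then show "card {u\<in>U. w \<bullet> u > \<bar>\<tau>\<bar>} \<le> 2 * d + 1"
        using uz fin U by (intro card_circles_through_cap[OF r f y]) auto
    qed
    finally show "card U \<le> card W * (2 * d + 1)" by simp
  qed
qed

section \<open>The circles of third vertices\<close>

text \<open>The remainder z of the expansion is orthogonal to u, e and f =
  \<open>cross3 u e\<close>. By Lagrange its cross product with f is zero too, which leaves only z =
  0.\<close>

lemma orthonormal_expansion:
  assumes u: "norm u = 1" and e: "norm e = 1" "u \<bullet> e = 0"
  shows "y = (y \<bullet> u) *\<^sub>R u + (y \<bullet> e) *\<^sub>R e + (y \<bullet> cross3 u e) *\<^sub>R cross3 u e"
proof -
  define f where "f = cross3 u e"
  have uf: "u \<bullet> f = 0" "e \<bullet> f = 0" by (simp_all add: f_def dot_cross_self)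
  have "(norm f)\<^sup>2 + (u \<bullet> e)\<^sup>2 = (norm u * norm e)\<^sup>2" unfolding f_def by (rule norm_cross_dot)
  then have nf: "norm f = 1" using u e by (simp add: power2_eq_1_iff) (smt (verit) norm_ge_zero)
  have s: "u \<bullet> u = 1" "e \<bullet> e = 1" "f \<bullet> f = 1" using u e nf by (simp_all only: norm_eq_1)
  define z where "z = y - ((y \<bullet> u) *\<^sub>R u + (y \<bullet> e) *\<^sub>R e + (y \<bullet> f) *\<^sub>R f)"
  have z: "u \<bullet> z = 0" "e \<bullet> z = 0" "f \<bullet> z = 0"
    using s uf e(2) by (simp_all add: z_def inner_diff_right inner_add_right inner_commute[of _ y] inner_commute[of e u] inner_commute[of f u] inner_commute[of f e])
  have "cross3 z f = 0"
    using z by (simp add: f_def Lagrange inner_commute[of z])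
  then have "z = 0 \<or> f = 0" using z(3) norm_and_cross_eq_0[of z f] by (simp add: inner_commute)
  then show ?thesis using nf by (auto simp: z_def f_def)
qed

text \<open>The centre is a + \<tau> r u and the radius r sqrt(1 - \<tau>^2). It carries the zero
  counts for \<open>circ\<close> over to the circles of third vertices.\<close>

lemma sphere_circle_subset_circ:
  assumes u: "norm u = 1" and r: "r > 0" and \<tau>: "\<bar>\<tau>\<bar> < 1"
  shows "\<exists>c p q. sphere_circle a r \<tau> u \<subseteq> circ c p q"
proof -
  obtain e0 where e0: "e0 \<noteq> 0" "orthogonal u e0" using orthogonal_to_vector_exists[of u] by auto
  define e where "e = (1 / norm e0) *\<^sub>R e0"
  have e: "norm e = 1" "u \<bullet> e = 0" using e0 by (auto simp: e_def orthogonal_def)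
  define f where "f = cross3 u e"
  have uf: "u \<bullet> f = 0" "e \<bullet> f = 0" by (simp_all add: f_def dot_cross_self)
  have "(norm f)\<^sup>2 + (u \<bullet> e)\<^sup>2 = (norm u * norm e)\<^sup>2" unfolding f_def by (rule norm_cross_dot)
  then have nf: "norm f = 1" using u e by (simp add: power2_eq_1_iff) (smt (verit) norm_ge_zero)
  have s: "u \<bullet> u = 1" "e \<bullet> e = 1" "f \<bullet> f = 1" using u e nf by (simp_all only: norm_eq_1)
  define \<rho> where "\<rho> = r * sqrt (1 - \<tau>\<^sup>2)"
  have "\<tau>\<^sup>2 < 1" using \<tau> by (simp add: abs_square_less_1)
  then have \<rho>: "\<rho> > 0" "\<rho>\<^sup>2 = r\<^sup>2 - (\<tau> * r)\<^sup>2" using r by (auto simp: \<rho>_def power_mult_distrib algebra_simps)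
  have "x \<in> circ (a + (\<tau> * r) *\<^sub>R u) (\<rho> *\<^sub>R e) (\<rho> *\<^sub>R f)" if x: "x \<in> sphere_circle a r \<tau> u" for x
  proof -
    define y where "y = x - a"
    have y: "norm y = r" "y \<bullet> u = \<tau> * r"
      using x by (auto simp: y_def sphere_circle_def dist_norm norm_minus_commute)
    define \<alpha> \<beta> where "\<alpha> = y \<bullet> e" and "\<beta> = y \<bullet> f"
    have ye: "y = (\<tau> * r) *\<^sub>R u + \<alpha> *\<^sub>R e + \<beta> *\<^sub>R f"
      using orthonormal_expansion[OF u e, of y] y(2) by (simp add: \<alpha>_def \<beta>_def f_def)
    have "r\<^sup>2 = y \<bullet> y" using y(1) by (simp add: dot_square_norm)
    also have "\<dots> = (\<tau> * r) * (y \<bullet> u) + \<alpha> * (y \<bullet> e) + \<beta> * (y \<bullet> f)"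
      by (subst (2) ye) (simp add: inner_add_right)
    finally have "\<alpha>\<^sup>2 + \<beta>\<^sup>2 = \<rho>\<^sup>2" using y(2) \<rho>(2) by (simp add: \<alpha>_def \<beta>_def power2_eq_square)
    then have "(\<alpha> / \<rho>)\<^sup>2 + (\<beta> / \<rho>)\<^sup>2 = 1" using \<rho>(1) by (simp add: power_divide flip: add_divide_distrib)
    moreover have "x = a + (\<tau> * r) *\<^sub>R u + (\<alpha> / \<rho>) *\<^sub>R (\<rho> *\<^sub>R e) + (\<beta> / \<rho>) *\<^sub>R (\<rho> *\<^sub>R f)"
    proof -
      have "x = a + y" by (simp add: y_def)
      then show ?thesis using ye \<rho>(1) by (simp add: add.assoc)
    qed
    ultimately show ?thesis unfolding circ_def by blast
  qed
  then show ?thesis by blast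
qed

text \<open>A line meets a sphere at most twice: |v + t d| = |v| is quadratic in t and has the roots
  0 and 1.\<close>

lemma cross_nonzero_on_sphere:
  assumes s: "c1 \<in> sphere a r" "c2 \<in> sphere a r" "c3 \<in> sphere a r" and ne: "c1 \<noteq> c2" "c1 \<noteq> c3" "c2 \<noteq> c3"
  shows "cross3 (c2 - c1) (c3 - c1) \<noteq> 0"
proof
  assume "cross3 (c2 - c1) (c3 - c1) = 0"
  then have "collinear {0, c2 - c1, c3 - c1}" by (simp add: cross_eq_0)
  then obtain k where k: "c3 - c1 = k *\<^sub>R (c2 - c1)" using ne by (auto simp: collinear_lemma)
  define v d where "v = c1 - a" and "d = c2 - c1"
  have eqs: "norm (v + d) = norm v" "norm (v + k *\<^sub>R d) = norm v"
  proof -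
    have "v + d = c2 - a" by (simp add: v_def d_def)
    moreover have "v + k *\<^sub>R d = c3 - a" using k by (simp add: v_def d_def flip: k)
    moreover have "norm (c1 - a) = r" "norm (c2 - a) = r" "norm (c3 - a) = r"
      using s by (simp_all add: dist_norm norm_minus_commute)
    ultimately show "norm (v + d) = norm v" "norm (v + k *\<^sub>R d) = norm v"
      by (simp_all only: v_def)
  qed
  have n: "(v + t *\<^sub>R d) \<bullet> (v + t *\<^sub>R d) = v \<bullet> v + 2 * t * (v \<bullet> d) + t * t * (d \<bullet> d)" for t
    by (simp add: inner_add_left inner_add_right inner_commute[of d v] algebra_simps)
  have e1: "2 * (v \<bullet> d) + d \<bullet> d = 0" using eqs(1) n[of 1] by (simp add: norm_eq)
  have "k * (2 * (v \<bullet> d)) + k * k * (d \<bullet> d) = 0" using eqs(2) n[of k] by (simp add: norm_eq)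
  moreover have "2 * (v \<bullet> d) = - (d \<bullet> d)" using e1 by linarith
  ultimately have "k * (k - 1) * (d \<bullet> d) = 0" by (simp add: algebra_simps)
  moreover have "d \<bullet> d \<noteq> 0" using ne by (simp add: d_def)
  ultimately have "k = 0 \<or> k = 1" by simp
  then show False using k ne by auto
qed

lemma parallel_to_cross:
  assumes "w \<bullet> x = 0" "w \<bullet> y = 0" "cross3 x y \<noteq> 0"
  obtains k where "w = k *\<^sub>R cross3 x y"
proof -
  have "cross3 w (cross3 x y) = 0" using assms by (simp add: Lagrange)
  then have "collinear {0, cross3 x y, w}" by (simp add: cross_eq_0 insert_commute)
  then show ?thesis using that assms(3) by (auto simp: collinear_lemma)
qed

text \<open>The points \<open>c\<close> with \<open>|ac| = \<mu> |ab|\<close> whose angle at \<open>a\<close> has cosine \<open>\<tau>\<close>.\<close>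

definition apex_circle :: "real \<Rightarrow> real \<Rightarrow> real^3 \<Rightarrow> real^3 \<Rightarrow> (real^3) set" where
  "apex_circle \<mu> \<tau> a b = sphere_circle a (\<mu> * dist a b) \<tau> ((1 / dist a b) *\<^sub>R (b - a))"

lemma apex_circle_iff:
  assumes "a \<noteq> b"
  shows "c \<in> apex_circle \<mu> \<tau> a b \<longleftrightarrow>
    norm (c - a) = \<mu> * norm (b - a) \<and> (c - a) \<bullet> (b - a) = \<tau> * \<mu> * (norm (b - a))\<^sup>2"
proof -
  have "norm (b - a) > 0" using assms by simp
  then have "(c - a) \<bullet> (b - a) / norm (b - a) = \<tau> * (\<mu> * norm (b - a)) \<longleftrightarrow> (c - a) \<bullet> (b - a) = \<tau> * \<mu> * (norm (b - a))\<^sup>2"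
    by (simp add: field_simps power2_eq_square)
  then show ?thesis
    by (auto simp: apex_circle_def sphere_circle_def dist_norm norm_minus_commute)
qed

text \<open>Three points determine the centre and the axis of the circle, and its radius determines \<open>|ab|\<close>,
  so only the orientation of the axis is left free.\<close>

lemma apex_circle_three_points:
  assumes \<mu>: "\<mu> > 0" and \<tau>: "\<bar>\<tau>\<bar> < 1" and ab: "a \<noteq> b" "a' \<noteq> b'"
    and c: "c1 \<in> apex_circle \<mu> \<tau> a b" "c2 \<in> apex_circle \<mu> \<tau> a b" "c3 \<in> apex_circle \<mu> \<tau> a b"
    and c': "c1 \<in> apex_circle \<mu> \<tau> a' b'" "c2 \<in> apex_circle \<mu> \<tau> a' b'" "c3 \<in> apex_circle \<mu> \<tau> a' b'"
    and ne: "c1 \<noteq> c2" "c1 \<noteq> c3" "c2 \<noteq> c3"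
  shows "(a', b') = (a, b) \<or> (a', b') = (a + (2 * \<tau> * \<mu>) *\<^sub>R (b - a), a + (2 * \<tau> * \<mu> - 1) *\<^sub>R (b - a))"
proof -
  define e where "e = cross3 (c2 - c1) (c3 - c1)"
  have "c1 \<in> sphere a (\<mu> * dist a b)" "c2 \<in> sphere a (\<mu> * dist a b)" "c3 \<in> sphere a (\<mu> * dist a b)"
    using c by (auto simp: apex_circle_def sphere_circle_def)
  then have e0: "e \<noteq> 0" unfolding e_def using ne by (rule cross_nonzero_on_sphere)
  \<comment> \<open>The circle has centre a + \<tau> \<mu> (b - a) and squared radius \<mu>^2 (1 -
    \<tau>^2) |ab|^2, and e is normal to the plane of the three points.\<close>
  have centre: "\<exists>k. b - a = k *\<^sub>R e \<and>
       (\<forall>x\<in>{c1, c2, c3}. (norm (x - (a + (\<tau> * \<mu>) *\<^sub>R (b - a))))\<^sup>2 = \<mu>\<^sup>2 * (1 - \<tau>\<^sup>2) * (norm (b - a))\<^sup>2 \<and> (x - (a + (\<tau> * \<mu>) *\<^sub>R (b - a))) \<bullet> e = 0)"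
    if ab: "a \<noteq> b" and c: "\<And>x. x \<in> {c1, c2, c3} \<Longrightarrow> x \<in> apex_circle \<mu> \<tau> a b" for a b
  proof -
    define w where "w = b - a"
    have w: "w \<noteq> 0" using ab by (simp add: w_def)
    have ww: "w \<bullet> w = (norm w)\<^sup>2" by (rule dot_square_norm)
    have cx: "norm (x - a) = \<mu> * norm w" "(x - a) \<bullet> w = \<tau> * \<mu> * (norm w)\<^sup>2" if "x \<in> {c1, c2, c3}" for x
      using c[OF that] apex_circle_iff[OF ab] by (auto simp: w_def)
    have "w \<bullet> (c2 - c1) = (c2 - a) \<bullet> w - (c1 - a) \<bullet> w" "w \<bullet> (c3 - c1) = (c3 - a) \<bullet> w - (c1 - a) \<bullet> w"
      by (simp_all add: inner_diff_right inner_diff_left inner_commute[of w])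
    then have "w \<bullet> (c2 - c1) = 0" "w \<bullet> (c3 - c1) = 0" using cx by auto
    then obtain k where k: "w = k *\<^sub>R e" using e0 parallel_to_cross unfolding e_def by blast
    have k0: "k \<noteq> 0" using k w by auto
    have "(norm (x - (a + (\<tau> * \<mu>) *\<^sub>R w)))\<^sup>2 = \<mu>\<^sup>2 * (1 - \<tau>\<^sup>2) * (norm w)\<^sup>2 \<and> (x - (a + (\<tau> * \<mu>) *\<^sub>R w)) \<bullet> e = 0"
      if x: "x \<in> {c1, c2, c3}" for x
    proof -
      have xo: "x - (a + (\<tau> * \<mu>) *\<^sub>R w) = (x - a) - (\<tau> * \<mu>) *\<^sub>R w" by simp
      define y where "y = x - a"
      have y: "y \<bullet> y = (\<mu> * norm w)\<^sup>2" "y \<bullet> w = \<tau> * \<mu> * (norm w)\<^sup>2"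
        using cx[OF x] by (simp_all add: y_def dot_square_norm)
      have "(y - (\<tau> * \<mu>) *\<^sub>R w) \<bullet> w = 0" using y(2) ww by (simp add: inner_diff_left)
      then have 1: "(y - (\<tau> * \<mu>) *\<^sub>R w) \<bullet> e = 0" using k k0 by simp
      have "(y - (\<tau> * \<mu>) *\<^sub>R w) \<bullet> (y - (\<tau> * \<mu>) *\<^sub>R w) = y \<bullet> y - 2 * (\<tau> * \<mu>) * (y \<bullet> w) + (\<tau> * \<mu>) * (\<tau> * \<mu>) * (w \<bullet> w)"
        by (simp add: inner_diff_left inner_diff_right inner_commute[of w y] algebra_simps)
      also have "\<dots> = \<mu>\<^sup>2 * (1 - \<tau>\<^sup>2) * (norm w)\<^sup>2"
        unfolding y ww by (simp add: power2_eq_square algebra_simps)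
      finally show ?thesis using 1 unfolding xo y_def[symmetric] power2_norm_eq_inner[of "y - _"] by simp
    qed
    then show ?thesis using k unfolding w_def by blast
  qed
  obtain k where k: "b - a = k *\<^sub>R e"
    "\<And>x. x \<in> {c1, c2, c3} \<Longrightarrow> (norm (x - (a + (\<tau> * \<mu>) *\<^sub>R (b - a))))\<^sup>2 = \<mu>\<^sup>2 * (1 - \<tau>\<^sup>2) * (norm (b - a))\<^sup>2 \<and> (x - (a + (\<tau> * \<mu>) *\<^sub>R (b - a))) \<bullet> e = 0"
    using centre[OF ab(1)] c by blast
  obtain k' where k': "b' - a' = k' *\<^sub>R e"
    "\<And>x. x \<in> {c1, c2, c3} \<Longrightarrow> (norm (x - (a' + (\<tau> * \<mu>) *\<^sub>R (b' - a'))))\<^sup>2 = \<mu>\<^sup>2 * (1 - \<tau>\<^sup>2) * (norm (b' - a'))\<^sup>2 \<and> (x - (a' + (\<tau> * \<mu>) *\<^sub>R (b' - a'))) \<bullet> e = 0"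
    using centre[OF ab(2)] c' by blast
  define z z' where "z = a + (\<tau> * \<mu>) *\<^sub>R (b - a)" and "z' = a' + (\<tau> * \<mu>) *\<^sub>R (b' - a')"
  have n: "(norm (x - z))\<^sup>2 - (norm (x - z'))\<^sup>2 = 2 * (x \<bullet> (z' - z)) + z \<bullet> z - z' \<bullet> z'" for x
    by (simp add: power2_norm_eq_inner inner_diff_left inner_diff_right inner_commute algebra_simps)
  \<comment> \<open>Each centre is equidistant from the three points, so z' - z is normal to their
    plane. Both centres lie in that plane, hence coincide.\<close>
  have "(z' - z) \<bullet> (x - c1) = 0" if "x \<in> {c2, c3}" for x
  proof -
    have "(norm (x - z))\<^sup>2 - (norm (x - z'))\<^sup>2 = (norm (c1 - z))\<^sup>2 - (norm (c1 - z'))\<^sup>2"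
      using that k(2)[of x] k(2)[of c1] k'(2)[of x] k'(2)[of c1] by (auto simp: z_def z'_def)
    then show ?thesis unfolding n by (simp add: inner_diff_right inner_commute)
  qed
  then obtain m where m: "z' - z = m *\<^sub>R e"
    using e0 parallel_to_cross[of "z' - z" "c2 - c1" "c3 - c1"] unfolding e_def by auto
  have "(z' - z) \<bullet> e = (c1 - z) \<bullet> e - (c1 - z') \<bullet> e" by (simp add: inner_diff_left)
  also have "\<dots> = 0" using k(2)[of c1] k'(2)[of c1] by (simp add: z_def z'_def)
  finally have "m = 0" using m e0 by simp
  then have zz: "z' = z" using m by simp
  have "\<mu>\<^sup>2 * (1 - \<tau>\<^sup>2) * (norm (b - a))\<^sup>2 = \<mu>\<^sup>2 * (1 - \<tau>\<^sup>2) * (norm (b' - a'))\<^sup>2"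
    using k(2)[of c1] k'(2)[of c1] zz by (simp add: z_def z'_def)
  moreover have "\<tau>\<^sup>2 \<noteq> 1" using \<tau> by (auto simp: power2_eq_1_iff)
  ultimately have "norm (b - a) = norm (b' - a')" using \<mu> by simp
  then have "\<bar>k\<bar> = \<bar>k'\<bar>" using k(1) k'(1) e0 by simp
  then consider "k' = k" | "k' = - k" by linarith
  then show ?thesis
  proof cases
    case 1
    then have "b' - a' = b - a" using k(1) k'(1) by simp
    then show ?thesis using zz by (simp add: z_def z'_def)
  next
    case 2
    then have w: "b' - a' = - (b - a)" using k(1) k'(1) by simp
    have "a' = a + (\<tau> * \<mu>) *\<^sub>R (b - a) - (\<tau> * \<mu>) *\<^sub>R (b' - a')" using zz by (simp add: z_def z'_def algebra_simps)
    also have "\<dots> = a + (2 * \<tau> * \<mu>) *\<^sub>R (b - a)"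
    proof -
      have "(2 * \<tau> * \<mu>) *\<^sub>R (b - a) = (\<tau> * \<mu>) *\<^sub>R (b - a) + (\<tau> * \<mu>) *\<^sub>R (b - a)"
        by (simp flip: scaleR_add_left)
      then show ?thesis unfolding w scaleR_minus_right by (simp only: diff_minus_eq_add add.assoc)
    qed
    finally have a': "a' = a + (2 * \<tau> * \<mu>) *\<^sub>R (b - a)" .
    have "b' = a' - (b - a)" using w by (simp add: algebra_simps)
    then have "b' = a + (2 * \<tau> * \<mu> - 1) *\<^sub>R (b - a)" unfolding a' by (simp add: scaleR_diff_left)
    then show ?thesis using a' by simp
  qed
qed

text \<open>The other alternative moves the apex by 2 \<tau> \<mu> (b - a), which is not zero: this
  is where the angle at A must not be right.\<close>

lemma apex_circle_three_points_same_vertex: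
  assumes "\<mu> > 0" "\<bar>\<tau>\<bar> < 1" "\<tau> \<noteq> 0" "a \<noteq> b" "a \<noteq> b'"
    and "{c1, c2, c3} \<subseteq> apex_circle \<mu> \<tau> a b \<inter> apex_circle \<mu> \<tau> a b'"
    and "c1 \<noteq> c2" "c1 \<noteq> c3" "c2 \<noteq> c3"
  shows "b' = b"
  using apex_circle_three_points[of \<mu> \<tau> a b a b' c1 c2 c3] assms by auto

lemma card_le_2_if_no_three:
  assumes "\<And>x y z. x \<in> S \<Longrightarrow> y \<in> S \<Longrightarrow> z \<in> S \<Longrightarrow> x = y \<or> x = z \<or> y = z"
  shows "finite S" "card S \<le> 2"
proof -
  have "\<exists>x y. S \<subseteq> {x, y}"
  proof (cases "\<exists>x\<in>S. \<exists>y\<in>S. x \<noteq> y")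
    case True
    then show ?thesis using assms by blast
  qed blast
  then obtain x y where S: "S \<subseteq> {x, y}" by blast
  then show "finite S" using finite_subset by blast
  have "card S \<le> card {x, y}" using S by (intro card_mono) auto
  also have "\<dots> \<le> 2" by (simp add: card_insert_if)
  finally show "card S \<le> 2" .
qed

lemma apex_circle_Int:
  assumes "\<mu> > 0" "\<bar>\<tau>\<bar> < 1" "\<tau> \<noteq> 0" "a \<noteq> b" "a \<noteq> b'" "b \<noteq> b'"
  shows "finite (apex_circle \<mu> \<tau> a b \<inter> apex_circle \<mu> \<tau> a b')" "card (apex_circle \<mu> \<tau> a b \<inter> apex_circle \<mu> \<tau> a b') \<le> 2"
proof -
  have "x = y \<or> x = z \<or> y = z" if "{x, y, z} \<subseteq> apex_circle \<mu> \<tau> a b \<inter> apex_circle \<mu> \<tau> a b'" for x y z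
    using apex_circle_three_points_same_vertex[OF assms(1-5) that] assms(6) by blast
  then show "finite (apex_circle \<mu> \<tau> a b \<inter> apex_circle \<mu> \<tau> a b')" "card (apex_circle \<mu> \<tau> a b \<inter> apex_circle \<mu> \<tau> a b') \<le> 2"
    using card_le_2_if_no_three[of "apex_circle \<mu> \<tau> a b \<inter> apex_circle \<mu> \<tau> a b'"] by simp_all
qed

section \<open>Counting incidences\<close>

text \<open>From the third point on, each new point brings at least one new triple.\<close>

lemma card_le_2_plus_triples:
  assumes "finite A" shows "card A \<le> 2 + card {T. T \<subseteq> A \<and> card T = 3}"
proof -
  have "x \<le> 2 + (x choose 3)" for x :: nat
  proof (induction x)
    case (Suc m)
    show ?case
    proof (cases "m < 2")
      case False
      then have "(m choose 2) > 0" by (simp add: zero_less_binomial_iff)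
      moreover have "Suc m choose 3 = (m choose 2) + (m choose 3)" by (simp add: numeral_3_eq_3 numeral_2_eq_2)
      ultimately show ?thesis using Suc by linarith
    qed simp
  qed simp
  then show ?thesis using n_subsets[OF assms, of 3] by simp
qed

text \<open>A set added to the union overlaps each earlier one in at most two elements.\<close>

lemma sum_card_le_of_small_intersections:
  assumes "finite U" "\<And>u. u \<in> U \<Longrightarrow> finite (A u)"
    and "\<And>u v. u \<in> U \<Longrightarrow> v \<in> U \<Longrightarrow> u \<noteq> v \<Longrightarrow> card (A u \<inter> A v) \<le> 2"
  shows "(\<Sum>u\<in>U. card (A u)) \<le> card (\<Union>u\<in>U. A u) + 2 * card U * card U"
  using assms
proof (induction U rule: finite_induct)
  case (insert u U)
  let ?V = "\<Union>v\<in>U. A v"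
  have finV: "finite ?V" using insert by auto
  have fu: "finite (A u)" using insert by auto
  have "A u \<inter> ?V = (\<Union>v\<in>U. A u \<inter> A v)" by blast
  then have "card (A u \<inter> ?V) \<le> (\<Sum>v\<in>U. card (A u \<inter> A v))" by (simp only: card_UN_le[OF insert.hyps(1)])
  also have "\<dots> \<le> (\<Sum>v\<in>U. 2)" using insert.prems(2) insert.hyps(2) by (intro sum_mono) auto
  finally have 1: "card (A u \<inter> ?V) \<le> 2 * card U" by simp
  have 2: "card (A u) = card (A u - ?V) + card (A u \<inter> ?V)"
  proof -
    have "card ((A u - ?V) \<union> (A u \<inter> ?V)) = card (A u - ?V) + card (A u \<inter> ?V)"
      by (rule card_Un_disjoint) (use fu in auto)
    moreover have "(A u - ?V) \<union> (A u \<inter> ?V) = A u" by blast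
    ultimately show ?thesis by simp
  qed
  have 3: "card (\<Union>v\<in>insert u U. A v) = card (A u - ?V) + card ?V"
  proof -
    have "card ((A u - ?V) \<union> ?V) = card (A u - ?V) + card ?V"
      by (rule card_Un_disjoint) (use fu finV in auto)
    moreover have "(A u - ?V) \<union> ?V = (\<Union>v\<in>insert u U. A v)" by blast
    ultimately show ?thesis by simp
  qed
  have IH: "(\<Sum>v\<in>U. card (A v)) \<le> card ?V + 2 * card U * card U" using insert by auto
  have "(\<Sum>v\<in>insert u U. card (A v)) = card (A u) + (\<Sum>v\<in>U. card (A v))" using insert.hyps by simp
  also have "\<dots> \<le> card (\<Union>v\<in>insert u U. A v) + (2 * card U + 2 * card U * card U)"
    using 1 2 3 IH by linarith
  also have "2 * card U + 2 * card U * card U \<le> 2 * card (insert u U) * card (insert u U)"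
    using insert.hyps by simp
  finally show ?case by simp
qed simp

definition cell_triples :: "(real^3) set \<Rightarrow> (real^3 \<Rightarrow> real) \<Rightarrow> (real^3 \<Rightarrow> nat) \<Rightarrow> (real^3) set set" where
  "cell_triples P F \<sigma> = {T. T \<subseteq> P \<and> card T = 3 \<and> (\<exists>k. \<forall>p\<in>T. F p \<noteq> 0 \<and> \<sigma> p = k)}"

lemma finite_cell_triples: "finite P \<Longrightarrow> finite (cell_triples P F \<sigma>)"
  unfolding cell_triples_def by (rule finite_subset[of _ "Pow P"]) auto

text \<open>Each of 2^j cells has at most n / 2^j points, so there are at most 2^j (n / 2^j)^3 = n^3
  / 4^j triples.\<close>

lemma card_cell_triples:
  assumes P: "finite P" and lt: "\<And>x. \<sigma> x < (2::nat) ^ j"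
    and cd: "\<And>k. 2 ^ j * card {p \<in> P. F p \<noteq> 0 \<and> \<sigma> p = k} \<le> card P"
  shows "4 ^ j * card (cell_triples P F \<sigma>) \<le> card P ^ 3"
proof -
  define C where "C k = {p \<in> P. F p \<noteq> 0 \<and> \<sigma> p = k}" for k
  have finC: "finite (C k)" for k using P by (simp add: C_def)
  have sub: "cell_triples P F \<sigma> \<subseteq> (\<Union>k<2 ^ j. {T. T \<subseteq> C k \<and> card T = 3})"
  proof
    fix T assume T: "T \<in> cell_triples P F \<sigma>"
    then obtain k where k: "\<And>p. p \<in> T \<Longrightarrow> F p \<noteq> 0 \<and> \<sigma> p = k" by (auto simp: cell_triples_def)
    have "T \<noteq> {}" using T by (auto simp: cell_triples_def)
    then have "k < 2 ^ j" using k lt by blast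
    moreover have "T \<subseteq> C k" using T k by (auto simp: cell_triples_def C_def)
    ultimately show "T \<in> (\<Union>k<2 ^ j. {T. T \<subseteq> C k \<and> card T = 3})"
      using T by (auto simp: cell_triples_def)
  qed
  have fin: "finite {T. T \<subseteq> C k \<and> card T = 3}" for k
    by (rule finite_subset[of _ "Pow (C k)"]) (use finC in auto)
  have "card (cell_triples P F \<sigma>) \<le> card (\<Union>k<2 ^ j. {T. T \<subseteq> C k \<and> card T = 3})"
    using sub fin by (intro card_mono) auto
  also have "\<dots> \<le> (\<Sum>k<2 ^ j. card {T. T \<subseteq> C k \<and> card T = 3})" by (rule card_UN_le) auto
  also have "\<dots> = (\<Sum>k<2 ^ j. card (C k) choose 3)" using n_subsets[OF finC] by simp
  finally have le: "card (cell_triples P F \<sigma>) \<le> (\<Sum>k<2 ^ j. card (C k) choose 3)" .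
  have "8 ^ j * (card (C k) choose 3) \<le> card P ^ 3" for k
  proof -
    have "card (C k) choose 3 \<le> card (C k) ^ 3"
      by (cases "3 \<le> card (C k)") (auto simp: binomial_le_pow binomial_eq_0)
    then have "8 ^ j * (card (C k) choose 3) \<le> 8 ^ j * card (C k) ^ 3" by (rule mult_le_mono2)
    also have "\<dots> = (2 ^ j * card (C k)) ^ 3"
    proof -
      have "(8::nat) ^ j = (2 ^ 3) ^ j" by simp
      also have "\<dots> = (2 ^ j) ^ 3" by (simp only: power_mult[symmetric] mult.commute)
      finally show ?thesis by (simp add: power_mult_distrib)
    qed
    also have "\<dots> \<le> card P ^ 3" using cd[of k] by (intro power_mono) (auto simp: C_def)
    finally show ?thesis .
  qed
  then have "(\<Sum>k<(2::nat) ^ j. 8 ^ j * (card (C k) choose 3)) \<le> (\<Sum>k<(2::nat) ^ j. card P ^ 3)"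
    by (intro sum_mono) auto
  then have "8 ^ j * (\<Sum>k<2 ^ j. card (C k) choose 3) \<le> 2 ^ j * card P ^ 3"
    by (simp add: sum_distrib_left)
  then have "8 ^ j * card (cell_triples P F \<sigma>) \<le> 2 ^ j * card P ^ 3"
    using mult_le_mono2[OF le, of "8 ^ j"] by linarith
  moreover have "(8::nat) ^ j = 2 ^ j * 4 ^ j" by (simp flip: power_mult_distrib)
  ultimately show ?thesis by (simp add: mult.assoc)
qed

text \<open>2 * D + 1 zeros and twice 2 * D + 2 visited cells make 6 * D + 5. The triples pay for
  further points in a cell.\<close>

lemma points_on_circle_outside_zero_set:
  assumes P: "finite P" and F: "pol D F" and G: "G \<subseteq> circ c p q" "x0 \<in> G" "F x0 \<noteq> 0"
    and const: "\<And>U x y. connected U \<Longrightarrow> (\<And>z. z \<in> U \<Longrightarrow> F z \<noteq> 0) \<Longrightarrow> x \<in> U \<Longrightarrow> y \<in> U \<Longrightarrow> \<sigma> x = \<sigma> y"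
  shows "card (G \<inter> P) \<le> 6 * D + 5 + card {T \<in> cell_triples P F \<sigma>. T \<subseteq> G}"
proof -
  have x0: "x0 \<in> circ c p q" using G by blast
  define Z where "Z = {x \<in> G \<inter> P. F x = 0}"
  define N where "N = {x \<in> G \<inter> P. F x \<noteq> 0}"
  define K where "K = \<sigma> ` N"
  have finN: "finite N" using P by (simp add: N_def)
  have "Z \<subseteq> {x \<in> circ c p q. F x = 0}" using G by (auto simp: Z_def)
  then have "card Z \<le> card {x \<in> circ c p q. F x = 0}" using pol_zeros_circ(1)[OF F x0 G(3)] by (rule card_mono[rotated])
  then have cZ: "card Z \<le> 2 * D + 1" using pol_zeros_circ(2)[OF F x0 G(3)] by linarith
  have "K \<subseteq> \<sigma> ` {x \<in> circ c p q. F x \<noteq> 0}" using G by (auto simp: K_def N_def)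
  then have "card K \<le> card (\<sigma> ` {x \<in> circ c p q. F x \<noteq> 0})"
    using cells_on_circ(1)[OF F x0 G(3) const] by (rule card_mono[rotated])
  also have "\<dots> \<le> 2 * D + 2" by (rule cells_on_circ(2)[OF F x0 G(3) const])
  finally have cK: "card K \<le> 2 * D + 2" .
  have finK: "finite K" using finN by (simp add: K_def)
  define Nk where "Nk k = {x \<in> N. \<sigma> x = k}" for k
  define Tk where "Tk k = {T. T \<subseteq> Nk k \<and> card T = 3}" for k
  have finT: "finite (Tk k)" for k
    unfolding Tk_def by (rule finite_subset[of _ "Pow (Nk k)"]) (use finN in \<open>auto simp: Nk_def\<close>)
  have "card N \<le> card (\<Union>k\<in>K. Nk k)"
    using finN finK by (intro card_mono) (auto simp: Nk_def K_def)
  also have "\<dots> \<le> (\<Sum>k\<in>K. card (Nk k))" by (rule card_UN_le[OF finK])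
  also have "\<dots> \<le> (\<Sum>k\<in>K. 2 + card (Tk k))"
    unfolding Tk_def by (intro sum_mono card_le_2_plus_triples) (use finN in \<open>auto simp: Nk_def\<close>)
  also have "\<dots> = 2 * card K + (\<Sum>k\<in>K. card (Tk k))" by (subst sum.distrib) simp
  also have "(\<Sum>k\<in>K. card (Tk k)) = card (\<Union>k\<in>K. Tk k)"
  proof (rule card_UN_disjoint[symmetric])
    show "\<forall>i\<in>K. \<forall>j\<in>K. i \<noteq> j \<longrightarrow> Tk i \<inter> Tk j = {}"
    proof (intro ballI impI)
      fix i j :: nat assume "i \<noteq> j"
      have False if "T \<in> Tk i" "T \<in> Tk j" for T
      proof -
        have "T \<noteq> {}" using that by (auto simp: Tk_def)
        then show False using that \<open>i \<noteq> j\<close> by (auto simp: Tk_def Nk_def)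
      qed
      then show "Tk i \<inter> Tk j = {}" by blast
    qed
  qed (use finK finT in auto)
  also have "\<dots> \<le> card {T \<in> cell_triples P F \<sigma>. T \<subseteq> G}"
  proof (rule card_mono)
    show "finite {T \<in> cell_triples P F \<sigma>. T \<subseteq> G}" using finite_cell_triples[OF P] by simp
    show "(\<Union>k\<in>K. Tk k) \<subseteq> {T \<in> cell_triples P F \<sigma>. T \<subseteq> G}"
      by (auto simp: Tk_def Nk_def N_def cell_triples_def subset_iff)
  qed
  finally have cN: "card N \<le> 2 * card K + card {T \<in> cell_triples P F \<sigma>. T \<subseteq> G}" by simp
  have "G \<inter> P = Z \<union> N" by (auto simp: Z_def N_def)
  then have "card (G \<inter> P) \<le> card Z + card N" by (simp add: card_Un_le)
  then show ?thesis using cZ cK cN by linarith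
qed

lemma card_pairs_through_three_points:
  assumes \<mu>: "\<mu> > 0" "\<bar>\<tau>\<bar> < 1" and T: "card T = 3"
    and Q: "\<And>x. x \<in> Q \<Longrightarrow> fst x \<noteq> snd x \<and> T \<subseteq> apex_circle \<mu> \<tau> (fst x) (snd x)"
  shows "card Q \<le> 2"
proof (cases "Q = {}")
  case False
  then obtain a b where ab: "(a, b) \<in> Q" by auto
  obtain c1 c2 c3 where c: "T = {c1, c2, c3}" "c1 \<noteq> c2" "c1 \<noteq> c3" "c2 \<noteq> c3" using T by (metis card_3_iff)
  have "Q \<subseteq> {(a, b), (a + (2 * \<tau> * \<mu>) *\<^sub>R (b - a), a + (2 * \<tau> * \<mu> - 1) *\<^sub>R (b - a))}"
  proof
    fix x assume x: "x \<in> Q"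
    obtain a' b' where x': "x = (a', b')" by (cases x)
    have "(a', b') = (a, b) \<or> (a', b') = (a + (2 * \<tau> * \<mu>) *\<^sub>R (b - a), a + (2 * \<tau> * \<mu> - 1) *\<^sub>R (b - a))"
      using Q[OF ab] Q[OF x] x' c by (intro apex_circle_three_points[OF \<mu>, of a b a' b' c1 c2 c3]) auto
    then show "x \<in> {(a, b), (a + (2 * \<tau> * \<mu>) *\<^sub>R (b - a), a + (2 * \<tau> * \<mu> - 1) *\<^sub>R (b - a))}" using x' by simp
  qed
  then have "card Q \<le> card {(a, b), (a + (2 * \<tau> * \<mu>) *\<^sub>R (b - a), a + (2 * \<tau> * \<mu> - 1) *\<^sub>R (b - a))}"
    by (intro card_mono) auto
  also have "\<dots> \<le> 2" by (simp add: card_insert_if)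
  finally show ?thesis .
qed simp

text \<open>Double counting: a triple lies on the circles of at most two pairs, so it is charged at
  most twice in the whole sum.\<close>

lemma incidences_circles_not_in_zero_set:
  assumes \<mu>: "\<mu> > 0" "\<bar>\<tau>\<bar> < 1" and P: "finite P" and F: "pol D F"
    and const: "\<And>U x y. connected U \<Longrightarrow> (\<And>z. z \<in> U \<Longrightarrow> F z \<noteq> 0) \<Longrightarrow> x \<in> U \<Longrightarrow> y \<in> U \<Longrightarrow> \<sigma> x = \<sigma> y"
    and Q: "Q \<subseteq> P \<times> P" "\<And>a b. (a, b) \<in> Q \<Longrightarrow> a \<noteq> b \<and> (\<exists>x\<in>apex_circle \<mu> \<tau> a b. F x \<noteq> 0)"
  shows "(\<Sum>x\<in>Q. card (apex_circle \<mu> \<tau> (fst x) (snd x) \<inter> P)) \<le>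
     (6 * D + 5) * card P * card P + 2 * card (cell_triples P F \<sigma>)"
proof -
  let ?G = "\<lambda>x. apex_circle \<mu> \<tau> (fst x) (snd x)"
  let ?T = "cell_triples P F \<sigma>"
  have finQ: "finite Q" using Q(1) P finite_subset by blast
  have cQ: "card Q \<le> card P * card P" using Q(1) P by (metis card_cartesian_product card_mono finite_SigmaI)
  have one: "card (?G x \<inter> P) \<le> 6 * D + 5 + card {T \<in> ?T. T \<subseteq> ?G x}" if x: "x \<in> Q" for x
  proof -
    obtain a b where ab: "x = (a, b)" by (cases x)
    have ne: "a \<noteq> b" and "\<exists>y\<in>apex_circle \<mu> \<tau> a b. F y \<noteq> 0" using Q(2) x ab by auto
    then obtain y where y: "y \<in> apex_circle \<mu> \<tau> a b" "F y \<noteq> 0" by blast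
    have "\<exists>c p q. apex_circle \<mu> \<tau> a b \<subseteq> circ c p q"
      unfolding apex_circle_def using ne \<mu> by (intro sphere_circle_subset_circ) (auto simp: dist_norm norm_minus_commute)
    then obtain c p q where "apex_circle \<mu> \<tau> a b \<subseteq> circ c p q" by blast
    from points_on_circle_outside_zero_set[OF P F this y const] show ?thesis by (simp add: ab)
  qed
  have "(\<Sum>x\<in>Q. card {T \<in> ?T. T \<subseteq> ?G x}) = (\<Sum>x\<in>Q. \<Sum>T\<in>?T. if T \<subseteq> ?G x then 1 else 0)"
    using finite_cell_triples[OF P] by (simp add: sum.If_cases Int_def)
  also have "\<dots> = (\<Sum>T\<in>?T. \<Sum>x\<in>Q. if T \<subseteq> ?G x then 1 else 0)" by (rule sum.swap)
  also have "\<dots> = (\<Sum>T\<in>?T. card {x \<in> Q. T \<subseteq> ?G x})" using finQ by (simp add: sum.If_cases Int_def)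
  also have "\<dots> \<le> (\<Sum>T\<in>?T. 2)"
  proof (rule sum_mono)
    fix T assume "T \<in> ?T"
    then have "card T = 3" by (simp add: cell_triples_def)
    then show "card {x \<in> Q. T \<subseteq> ?G x} \<le> 2"
      by (rule card_pairs_through_three_points[OF \<mu>]) (use Q(2) in force)
  qed
  finally have 2: "(\<Sum>x\<in>Q. card {T \<in> ?T. T \<subseteq> ?G x}) \<le> 2 * card ?T" by simp
  have "(\<Sum>x\<in>Q. card (?G x \<inter> P)) \<le> (\<Sum>x\<in>Q. 6 * D + 5 + card {T \<in> ?T. T \<subseteq> ?G x})"
    using one by (intro sum_mono) auto
  also have "\<dots> = (6 * D + 5) * card Q + (\<Sum>x\<in>Q. card {T \<in> ?T. T \<subseteq> ?G x})"
    by (simp add: sum.distrib)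
  also have "\<dots> \<le> (6 * D + 5) * (card P * card P) + 2 * card ?T"
    using 2 cQ by (intro add_mono mult_le_mono2)
  finally show ?thesis by (simp only: mult.assoc)
qed

text \<open>In the factor, 1 counts the points on the spheres, the term with K pays for points
  shared by circles of one sphere, and D pays for the spheres inside the zero set.\<close>

lemma incidences_circles_in_zero_set:
  assumes \<mu>: "\<mu> > 0" "\<bar>\<tau>\<bar> < 1" "\<tau> \<noteq> 0" and P: "finite P" and F: "pol D F" "F x0 \<noteq> 0"
    and K: "\<And>d f a r y U. r > 0 \<Longrightarrow> pol d f \<Longrightarrow> y \<in> sphere a r \<Longrightarrow> f y \<noteq> 0 \<Longrightarrow> finite U \<Longrightarrow>
       (\<And>u. u \<in> U \<Longrightarrow> norm u = 1 \<and> (\<forall>x\<in>sphere_circle a r \<tau> u. f x = 0)) \<Longrightarrow>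
       (\<And>u v. u \<in> U \<Longrightarrow> v \<in> U \<Longrightarrow> u \<noteq> v \<Longrightarrow> finite (sphere_circle a r \<tau> u \<inter> sphere_circle a r \<tau> v)) \<Longrightarrow>
       card U \<le> K * (2 * d + 1)"
    and Q: "Q \<subseteq> P \<times> P" "\<And>a b. (a, b) \<in> Q \<Longrightarrow> a \<noteq> b \<and> (\<forall>x\<in>apex_circle \<mu> \<tau> a b. F x = 0)"
  shows "(\<Sum>x\<in>Q. card (apex_circle \<mu> \<tau> (fst x) (snd x) \<inter> P)) \<le>
     (1 + 2 * (K * (2 * D + 1)) + D) * card P * card P"
proof -
  let ?G = "\<lambda>x. apex_circle \<mu> \<tau> (fst x) (snd x)"
  let ?n = "card P"
  let ?k = "K * (2 * D + 1)"
  have finQ: "finite Q" using Q(1) P finite_subset by blast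
  have cQ: "card Q \<le> ?n * ?n" using Q(1) P by (metis card_cartesian_product card_mono finite_SigmaI)
  \<comment> \<open>The sphere of a pair, recorded by its centre and |ab| rather than the radius
    \<mu> |ab|.\<close>
  define g where "g x = (fst x, dist (fst x) (snd x))" for x :: "(real^3) \<times> (real^3)"
  define E where "E = g ` Q"
  define X where "X e = {x \<in> Q. g x = e}" for e
  define S where "S e = sphere (fst e) (\<mu> * snd e)" for e :: "(real^3) \<times> real"
  define V where "V = {e \<in> E. \<forall>x\<in>S e. F x = 0}"
  have finE: "finite E" using finQ by (simp add: E_def)
  have E: "fst e \<in> P \<and> snd e > 0" if "e \<in> E" for e using that Q by (auto simp: E_def g_def)
  have finX: "finite (X e)" for e using finQ by (simp add: X_def)
  have GS: "?G x \<subseteq> S (g x)" for x by (auto simp: apex_circle_def sphere_circle_def S_def g_def)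
  have step: "(\<Sum>x\<in>X e. card (?G x \<inter> P)) \<le> card (P \<inter> S e) + 2 * ?k * card (X e) + (if e \<in> V then ?n * ?n else 0)"
    if e: "e \<in> E" for e
  proof (cases "e \<in> V")
    case True
    have "card (X e) \<le> ?n"
    proof (rule card_inj_on_le[of snd])
      show "inj_on snd (X e)" by (auto simp: inj_on_def X_def g_def)
      show "snd ` X e \<subseteq> P" using Q(1) by (auto simp: X_def)
    qed (rule P)
    then have "card (X e) * ?n \<le> ?n * ?n" by (rule mult_le_mono1)
    moreover have "(\<Sum>x\<in>X e. card (?G x \<inter> P)) \<le> (\<Sum>x\<in>X e. ?n)"
      using P by (intro sum_mono card_mono) auto
    moreover have "(\<Sum>x\<in>X e. ?n) = card (X e) * ?n" by simp
    ultimately have "(\<Sum>x\<in>X e. card (?G x \<inter> P)) \<le> ?n * ?n" by linarith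
    then show ?thesis using True by simp
  next
    case False
    obtain a d where ad: "e = (a, d)" by (cases e)
    have d: "d > 0" using E[OF e] ad by simp
    obtain y where y: "y \<in> sphere a (\<mu> * d)" "F y \<noteq> 0" using False e by (auto simp: V_def S_def ad)
    have Xe: "fst x = a" "a \<noteq> snd x" "dist a (snd x) = d" "\<And>z. z \<in> ?G x \<Longrightarrow> F z = 0" if "x \<in> X e" for x
    proof -
      have xQ: "(fst x, snd x) \<in> Q" using that by (simp add: X_def)
      show "fst x = a" "a \<noteq> snd x" "dist a (snd x) = d" "\<And>z. z \<in> ?G x \<Longrightarrow> F z = 0"
        using that Q(2)[OF xQ] by (auto simp: X_def g_def ad)
    qed
    define u where "u x = (1 / d) *\<^sub>R (snd x - a)" for x :: "(real^3) \<times> (real^3)"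
    have Gu: "?G x = sphere_circle a (\<mu> * d) \<tau> (u x)" if "x \<in> X e" for x
      using Xe[OF that] by (simp add: apex_circle_def u_def)
    have inj: "inj_on u (X e)"
    proof (rule inj_onI)
      fix x y assume xy: "x \<in> X e" "y \<in> X e" "u x = u y"
      then have "snd x = snd y" using d by (simp add: u_def)
      then show "x = y" using Xe(1) xy by (simp add: prod_eq_iff)
    qed
    have two: "finite (?G x \<inter> ?G y) \<and> card (?G x \<inter> ?G y) \<le> 2" if xy: "x \<in> X e" "y \<in> X e" "x \<noteq> y" for x y
    proof -
      have "snd x \<noteq> snd y" using xy Xe(1) by (simp add: prod_eq_iff)
      then show ?thesis
        using apex_circle_Int[OF \<mu>, of a "snd x" "snd y"] Xe[OF xy(1)] Xe[OF xy(2)] by simp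
    qed
    have "card (u ` X e) \<le> ?k"
    proof (rule K[OF _ F(1) y])
      show "\<mu> * d > 0" using \<mu> d by simp
      show "norm v = 1 \<and> (\<forall>x\<in>sphere_circle a (\<mu> * d) \<tau> v. F x = 0)" if v: "v \<in> u ` X e" for v
      proof -
        obtain x where x: "x \<in> X e" "v = u x" using v by blast
        have "norm v = 1" using Xe[OF x(1)] d x(2) by (simp add: u_def dist_norm norm_minus_commute)
        then show ?thesis using Xe(4)[OF x(1)] Gu[OF x(1)] x(2) by simp
      qed
      show "finite (sphere_circle a (\<mu> * d) \<tau> v \<inter> sphere_circle a (\<mu> * d) \<tau> w)"
        if vw: "v \<in> u ` X e" "w \<in> u ` X e" "v \<noteq> w" for v w
      proof -
        obtain x y where xy: "x \<in> X e" "v = u x" "y \<in> X e" "w = u y" using vw by blast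
        then have "x \<noteq> y" using vw by blast
        then show ?thesis using two[OF xy(1,3)] Gu xy by simp
      qed
    qed (use finX in simp)
    then have cX: "card (X e) \<le> ?k" using card_image[OF inj] by simp
    have "(\<Sum>x\<in>X e. card (?G x \<inter> P)) \<le> card (\<Union>x\<in>X e. ?G x \<inter> P) + 2 * card (X e) * card (X e)"
    proof (rule sum_card_le_of_small_intersections)
      fix x y assume xy: "x \<in> X e" "y \<in> X e" "x \<noteq> y"
      have "card ((?G x \<inter> P) \<inter> (?G y \<inter> P)) \<le> card (?G x \<inter> ?G y)"
        using two[OF xy] by (intro card_mono) auto
      then show "card ((?G x \<inter> P) \<inter> (?G y \<inter> P)) \<le> 2" using two[OF xy] by linarith
    qed (use finX P in auto)
    moreover have "card (\<Union>x\<in>X e. ?G x \<inter> P) \<le> card (P \<inter> S e)"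
    proof (rule card_mono)
      show "finite (P \<inter> S e)" using P by simp
      show "(\<Union>x\<in>X e. ?G x \<inter> P) \<subseteq> P \<inter> S e" using GS by (auto simp: X_def)
    qed
    moreover have "2 * card (X e) * card (X e) \<le> 2 * ?k * card (X e)" using cX by simp
    ultimately show ?thesis by linarith
  qed
  have "(\<Sum>x\<in>Q. card (?G x \<inter> P)) = (\<Sum>e\<in>E. \<Sum>x\<in>X e. card (?G x \<inter> P))"
    unfolding X_def by (rule sum.group[symmetric]) (use finQ finE E_def in auto)
  also have "\<dots> \<le> (\<Sum>e\<in>E. card (P \<inter> S e) + 2 * ?k * card (X e) + (if e \<in> V then ?n * ?n else 0))"
    using step by (intro sum_mono) auto
  also have "\<dots> = (\<Sum>e\<in>E. card (P \<inter> S e)) + 2 * ?k * (\<Sum>e\<in>E. card (X e)) + (\<Sum>e\<in>E. if e \<in> V then ?n * ?n else 0)"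
    by (simp add: sum.distrib sum_distrib_left)
  finally have main: "(\<Sum>x\<in>Q. card (?G x \<inter> P)) \<le> (\<Sum>e\<in>E. card (P \<inter> S e)) + 2 * ?k * (\<Sum>e\<in>E. card (X e))
     + (\<Sum>e\<in>E. if e \<in> V then ?n * ?n else 0)" .
  have "(\<Sum>e\<in>E. card (P \<inter> S e)) = card (SIGMA e:E. P \<inter> S e)"
    using finE P by (subst card_SigmaI) auto
  also have "\<dots> \<le> card (P \<times> P)"
  \<comment> \<open>Spheres around one centre are disjoint, so the centre and a point on it
    determine the sphere.\<close>
  proof (rule card_inj_on_le[of "\<lambda>(e, p). (fst e, p)"])
    show "inj_on (\<lambda>(e, p). (fst e, p)) (SIGMA e:E. P \<inter> S e)"
      using \<mu>(1) by (auto simp: inj_on_def S_def)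
    show "(\<lambda>(e, p). (fst e, p)) ` (SIGMA e:E. P \<inter> S e) \<subseteq> P \<times> P" using E by auto
  qed (use P in simp)
  finally have 1: "(\<Sum>e\<in>E. card (P \<inter> S e)) \<le> ?n * ?n" by (simp add: card_cartesian_product)
  have "(\<Sum>e\<in>E. card (X e)) = (\<Sum>e\<in>E. \<Sum>x\<in>X e. 1)" by simp
  also have "\<dots> = (\<Sum>x\<in>Q. 1)" unfolding X_def by (rule sum.group) (use finQ finE E_def in auto)
  finally have 2: "(\<Sum>e\<in>E. card (X e)) \<le> ?n * ?n" using cQ by simp
  have "card V \<le> D"
  proof -
    define h where "h e = (fst e, \<mu> * snd e)" for e :: "(real^3) \<times> real"
    have "inj_on h V" using \<mu>(1) by (auto simp: inj_on_def h_def prod_eq_iff)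
    then have "card (h ` V) = card V" by (rule card_image)
    moreover have "2 * card (h ` V) \<le> D"
    proof (rule card_spheres_in_zero_set[OF _ _ F])
      show "finite (h ` V)" using finE by (simp add: V_def)
      show "r > 0" if "(a, r) \<in> h ` V" for a r using that E \<mu>(1) by (auto simp: V_def h_def)
      show "F x = 0" if "(a, r) \<in> h ` V" "x \<in> sphere a r" for a r x
        using that by (auto simp: V_def h_def S_def)
    qed
    ultimately show ?thesis by linarith
  qed
  then have "card V * (?n * ?n) \<le> D * (?n * ?n)" by (rule mult_le_mono1)
  moreover have "(\<Sum>e\<in>E. if e \<in> V then ?n * ?n else 0) = card V * (?n * ?n)"
    using finE by (simp add: sum.If_cases V_def Int_def)
  ultimately have 3: "(\<Sum>e\<in>E. if e \<in> V then ?n * ?n else 0) \<le> D * (?n * ?n)" by simp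
  have "(\<Sum>x\<in>Q. card (?G x \<inter> P)) \<le> ?n * ?n + 2 * ?k * (?n * ?n) + D * (?n * ?n)"
    using main 1 3 mult_le_mono2[OF 2, of "2 * ?k"] by linarith
  then show ?thesis by (simp add: algebra_simps)
qed

text \<open>3 * L bisections give 8^L cells at degree at most 18 * 2^L. The factor 64^L = 4^(3 L)
  keeps the bound in the natural numbers, and L stays free so that K does not depend on it.\<close>

lemma incidence_count:
  assumes \<mu>: "\<mu> > 0" "\<bar>\<tau>\<bar> < 1" "\<tau> \<noteq> 0"
  obtains K where "\<And>P L. finite P \<Longrightarrow>
     64 ^ L * card {(a, b, c). a \<in> P \<and> b \<in> P \<and> c \<in> P \<and> a \<noteq> b \<and> c \<in> apex_circle \<mu> \<tau> a b}
       \<le> K * (64 ^ L * 2 ^ L * card P ^ 2) + 2 * card P ^ 3"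
proof -
  obtain K where K: "\<forall>d f a r y U. r > 0 \<longrightarrow> pol d f \<longrightarrow> y \<in> sphere a r \<longrightarrow> f y \<noteq> 0 \<longrightarrow> finite U \<longrightarrow>
     (\<forall>u\<in>U. norm u = 1 \<and> (\<forall>x\<in>sphere_circle a r \<tau> u. f x = 0)) \<longrightarrow>
     (\<forall>u\<in>U. \<forall>v\<in>U. u \<noteq> v \<longrightarrow> finite (sphere_circle a r \<tau> u \<inter> sphere_circle a r \<tau> v)) \<longrightarrow>
     card U \<le> K * (2 * d + 1)"
    using card_circles_in_zero_set[OF \<mu>(2)] by blast
  \<comment> \<open>With z = 2^L and D = 18 z the coefficient of n^2 is 126 z + 6 + K (72 z + 2),
    and z \<ge> 1.\<close>
  define K' where "K' = 132 + 74 * K"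
  have "64 ^ L * card {(a, b, c). a \<in> P \<and> b \<in> P \<and> c \<in> P \<and> a \<noteq> b \<and> c \<in> apex_circle \<mu> \<tau> a b}
       \<le> K' * (64 ^ L * 2 ^ L * card P ^ 2) + 2 * card P ^ 3" if P: "finite P" for P L
  proof -
    let ?j = "3 * L"
    obtain F \<sigma> where part: "pol (pdeg ?j) F" "\<exists>x. F x \<noteq> 0"
     "\<forall>U x y. connected U \<longrightarrow> (\<forall>z\<in>U. F z \<noteq> 0) \<longrightarrow> x \<in> U \<longrightarrow> y \<in> U \<longrightarrow> \<sigma> x = \<sigma> y"
     "\<forall>x. \<sigma> x < (2::nat) ^ ?j" "\<forall>k. 2 ^ ?j * card {p \<in> P. F p \<noteq> 0 \<and> \<sigma> p = k} \<le> card P"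
      using polynomial_partitioning[OF P, of ?j] by blast
    obtain x0 where x0: "F x0 \<noteq> 0" using part(2) by blast
    have const: "\<sigma> x = \<sigma> y" if "connected U" "\<And>z. z \<in> U \<Longrightarrow> F z \<noteq> 0" "x \<in> U" "y \<in> U" for U x y
      using part(3) that by blast
    define D where "D = 18 * (2::nat) ^ L"
    have F: "pol D F" unfolding D_def using pol_mono[OF part(1) pdeg_le] .
    define Q where "Q = {(a, b). a \<in> P \<and> b \<in> P \<and> a \<noteq> b}"
    define Q0 where "Q0 = {x \<in> Q. \<forall>y\<in>apex_circle \<mu> \<tau> (fst x) (snd x). F y = 0}"
    define Q1 where "Q1 = Q - Q0"
    let ?G = "\<lambda>x. apex_circle \<mu> \<tau> (fst x) (snd x)"
    let ?T = "cell_triples P F \<sigma>"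
    have finQ: "finite Q" by (rule finite_subset[of _ "P \<times> P"]) (use P in \<open>auto simp: Q_def\<close>)
    have Q1: "(\<Sum>x\<in>Q1. card (?G x \<inter> P)) \<le> (6 * D + 5) * card P * card P + 2 * card ?T"
      by (rule incidences_circles_not_in_zero_set[OF \<mu>(1,2) P F const]) (auto simp: Q1_def Q0_def Q_def)
    have Q0: "(\<Sum>x\<in>Q0. card (?G x \<inter> P)) \<le> (1 + 2 * (K * (2 * D + 1)) + D) * card P * card P"
      by (rule incidences_circles_in_zero_set[OF \<mu> P F x0]) (use K in \<open>auto simp: Q0_def Q_def\<close>)
    let ?S = "{(a, b, c). a \<in> P \<and> b \<in> P \<and> c \<in> P \<and> a \<noteq> b \<and> c \<in> apex_circle \<mu> \<tau> a b}"
    have "card ?S = card (SIGMA x:Q. ?G x \<inter> P)"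
      by (rule bij_betw_same_card[of "\<lambda>(a, b, c). ((a, b), c)"])
        (auto simp: bij_betw_def inj_on_def Q_def image_iff)
    also have "\<dots> = (\<Sum>x\<in>Q. card (?G x \<inter> P))" using finQ P by (subst card_SigmaI) auto
    also have "\<dots> = (\<Sum>x\<in>Q1. card (?G x \<inter> P)) + (\<Sum>x\<in>Q0. card (?G x \<inter> P))"
      unfolding Q1_def by (rule sum.subset_diff) (use finQ in \<open>auto simp: Q0_def\<close>)
    also have "\<dots> \<le> ((6 * D + 5) + (1 + 2 * (K * (2 * D + 1)) + D)) * card P ^ 2 + 2 * card ?T"
      using Q1 Q0 by (simp add: power2_eq_square algebra_simps)
    also have "(6 * D + 5) + (1 + 2 * (K * (2 * D + 1)) + D) \<le> K' * 2 ^ L"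
    proof -
      define z where "z = (2::nat) ^ L"
      have "z \<ge> 1" by (simp add: z_def)
      then have "(6 + 2 * K) * 1 \<le> (6 + 2 * K) * z" by (rule mult_le_mono2)
      then show ?thesis by (simp add: D_def K'_def algebra_simps flip: z_def)
    qed
    finally have "card ?S \<le> K' * 2 ^ L * card P ^ 2 + 2 * card ?T" by simp
    then have "64 ^ L * card ?S \<le> 64 ^ L * (K' * 2 ^ L * card P ^ 2 + 2 * card ?T)" by (rule mult_le_mono2)
    also have "\<dots> = K' * (64 ^ L * 2 ^ L * card P ^ 2) + 2 * (64 ^ L * card ?T)" by (simp add: algebra_simps)
    also have "64 ^ L * card ?T \<le> card P ^ 3"
    proof -
      have "(4::nat) ^ (3 * L) = 64 ^ L" by (simp add: power_mult)
      then show ?thesis using card_cell_triples[OF P, of \<sigma> ?j F] part(4,5) by simp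
    qed
    finally show ?thesis by simp
  qed
  then show ?thesis using that by blast
qed

section \<open>From similar triangles to incidences\<close>

lemma similar_tri_imp_apex_circle:
  assumes ABC: "\<not> collinear {A, B, C}" and s: "similar_tri a b c A B C"
  shows "a \<noteq> b" "c \<in> apex_circle (dist C A / dist A B)
     ((C - A) \<bullet> (B - A) / (norm (C - A) * norm (B - A))) a b"
proof -
  have ne: "A \<noteq> B" "A \<noteq> C" using ABC by (auto simp: collinear_2 insert_commute)
  obtain k where k: "k > 0" "dist a b = k * dist A B" "dist b c = k * dist B C" "dist c a = k * dist C A"
    using s by (auto simp: similar_tri_def)
  then have "dist a b > 0" using ne by simp
  then show ab: "a \<noteq> b" by auto
  \<comment> \<open>Distances determine inner products, so scaling the sides by k scales the inner
    product at the apex by k^2.\<close>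
  have polar: "2 * (x \<bullet> y) = (norm x)\<^sup>2 + (norm y)\<^sup>2 - (norm (x - y))\<^sup>2" for x y :: "real^3"
    by (simp add: power2_norm_eq_inner inner_diff_left inner_diff_right inner_commute)
  have n: "norm (c - a) = k * norm (C - A)" "norm (b - a) = k * norm (B - A)" "norm (c - b) = k * norm (C - B)"
    using k by (simp_all add: dist_norm norm_minus_commute)
  have "2 * ((c - a) \<bullet> (b - a)) = k\<^sup>2 * (2 * ((C - A) \<bullet> (B - A)))"
    unfolding polar using n by (simp add: power_mult_distrib algebra_simps)
  then have i: "(c - a) \<bullet> (b - a) = k\<^sup>2 * ((C - A) \<bullet> (B - A))" by simp
  have pos: "norm (C - A) > 0" "norm (B - A) > 0" using ne by auto
  show "c \<in> apex_circle (dist C A / dist A B) ((C - A) \<bullet> (B - A) / (norm (C - A) * norm (B - A))) a b"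
    unfolding apex_circle_iff[OF ab] i n using pos
    by (simp add: dist_norm norm_minus_commute power_mult_distrib) (simp add: power2_eq_square)
qed

lemma similar_triangles_swap: "similar_triangles P A B C = similar_triangles P B A C"
proof -
  have "similar_tri a b c A B C \<Longrightarrow> similar_tri b a c B A C" for a b c A B C
    unfolding similar_tri_def by (auto simp: dist_commute)
  then have "similar_triangles P A B C \<subseteq> similar_triangles P B A C" for A B C
    unfolding similar_triangles_def by (auto simp: insert_commute) blast
  then show ?thesis by blast
qed

text \<open>Forgetting the order of the vertices maps the incidences onto a superset of the
  triangles.\<close>

lemma card_similar_triangles_le:
  assumes P: "finite P" and ABC: "\<not> collinear {A, B, C}"
  shows "card (similar_triangles P A B C) \<le> card {(a, b, c). a \<in> P \<and> b \<in> P \<and> c \<in> P \<and> a \<noteq> b \<and>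
    c \<in> apex_circle (dist C A / dist A B) ((C - A) \<bullet> (B - A) / (norm (C - A) * norm (B - A))) a b}"
    (is "_ \<le> card ?S")
proof (rule surj_card_le)
  show "finite ?S" by (rule finite_subset[of _ "P \<times> P \<times> P"]) (use P in auto)
  show "similar_triangles P A B C \<subseteq> (\<lambda>(a, b, c). {a, b, c}) ` ?S"
  proof
    fix T assume "T \<in> similar_triangles P A B C"
    then obtain a b c where T: "T = {a, b, c}" "T \<subseteq> P" "similar_tri a b c A B C"
      by (auto simp: similar_triangles_def)
    then have "(a, b, c) \<in> ?S" using similar_tri_imp_apex_circle[OF ABC T(3)] by auto
    then show "T \<in> (\<lambda>(a, b, c). {a, b, c}) ` ?S" using T(1) by force
  qed
qed

lemma similar_triangles_bound:
  assumes ABC: "\<not> collinear {A, B, C}" and nr: "(C - A) \<bullet> (B - A) \<noteq> 0"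
  shows "\<exists>K>0. \<forall>P. finite P \<longrightarrow> real (card (similar_triangles P A B C)) \<le> K * real (card P) powr (15/7)"
proof -
  have ne: "A \<noteq> B" "A \<noteq> C" using ABC by (auto simp: collinear_2 insert_commute)
  define \<mu> \<tau> where "\<mu> = dist C A / dist A B" and "\<tau> = (C - A) \<bullet> (B - A) / (norm (C - A) * norm (B - A))"
  have \<mu>: "\<mu> > 0" using ne by (simp add: \<mu>_def)
  have \<tau>0: "\<tau> \<noteq> 0" using nr ne by (simp add: \<tau>_def)
  \<comment> \<open>Equality in Cauchy--Schwarz would make the triangle degenerate.\<close>
  have \<tau>1: "\<bar>\<tau>\<bar> < 1"
  proof -
    have pos: "norm (C - A) * norm (B - A) > 0" using ne by simp
    have "\<bar>(C - A) \<bullet> (B - A)\<bar> \<noteq> norm (C - A) * norm (B - A)"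
    proof
      assume "\<bar>(C - A) \<bullet> (B - A)\<bar> = norm (C - A) * norm (B - A)"
      then have "collinear {0, C - A, B - A}" by (simp add: norm_cauchy_schwarz_equal)
      then have "collinear {C, A, B}" by (simp add: collinear_3)
      then show False using ABC by (simp add: insert_commute)
    qed
    then have "\<bar>(C - A) \<bullet> (B - A)\<bar> < norm (C - A) * norm (B - A)"
      using Cauchy_Schwarz_ineq2[of "C - A" "B - A"] by linarith
    then show ?thesis using pos by (simp add: \<tau>_def abs_div_pos[symmetric])
  qed
  obtain K where K: "\<And>P L. finite P \<Longrightarrow>
     64 ^ L * card {(a, b, c). a \<in> P \<and> b \<in> P \<and> c \<in> P \<and> a \<noteq> b \<and> c \<in> apex_circle \<mu> \<tau> a b}
       \<le> K * (64 ^ L * 2 ^ L * card P ^ 2) + 2 * card P ^ 3"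
    using incidence_count[OF \<mu> \<tau>1 \<tau>0] by blast
  have "real (card (similar_triangles P A B C)) \<le> (real K + 128) * real (card P) powr (15/7)" if P: "finite P" for P
  proof (cases "card P = 0")
    case True
    then have "P = {}" using P by simp
    then have "similar_triangles P A B C = {}" by (auto simp: similar_triangles_def)
    then show ?thesis by simp
  next
    case False
    define x where "x = real (card P) powr (1/7)"
    have x0: "x > 0" using False by (simp add: x_def)
    have xp: "x ^ m = real (card P) powr (real m / 7)" for m
    proof -
      have "x ^ m = x powr real m" using powr_realpow[OF x0, of m] by simp
      then show ?thesis by (simp add: x_def powr_powr)
    qed
    have x7: "x ^ 7 = real (card P)" using xp[of 7] False by simp
    have x15: "x ^ 15 = real (card P) powr (15/7)" using xp[of 15] by simp
    \<comment> \<open>As 128 = 2^7, this makes y = 2^L agree with x = n^(1/7) up to a factor of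
      2.\<close>
    obtain L where L: "128 ^ L \<le> card P" "card P < 128 ^ (L + 1)"
      using ex_power_ivl1[of 128 "card P"] False by auto
    define y where "y = (2::real) ^ L"
    have y0: "y > 0" by (simp add: y_def)
    have yp: "y ^ m = (2 ^ m) ^ L" for m unfolding y_def by (simp only: power_mult[symmetric] mult.commute)
    have y7: "y ^ 7 = real (128 ^ L)" by (simp add: yp)
    have "y ^ 7 \<le> x ^ 7" unfolding y7 x7 using L(1) by linarith
    then have yx: "y \<le> x" using x0 y0 by (simp add: power_mono_iff)
    have "real (card P) \<le> real (128 ^ (L + 1))" using L(2) by (simp only: of_nat_le_iff less_imp_le)
    then have "x ^ 7 \<le> 128 * y ^ 7" unfolding y7 x7 by simp
    then have "x ^ 7 \<le> (2 * y) ^ 7" by (simp add: power_mult_distrib)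
    moreover have "x ^ 7 \<le> (2 * y) ^ 7 \<longleftrightarrow> x \<le> 2 * y" using x0 y0 by (intro power_mono_iff) auto
    ultimately have xy: "x \<le> 2 * y" by blast
    define N where "N = card (similar_triangles P A B C)"
    have "64 ^ L * N \<le> 64 ^ L * card {(a, b, c). a \<in> P \<and> b \<in> P \<and> c \<in> P \<and> a \<noteq> b \<and> c \<in> apex_circle \<mu> \<tau> a b}"
      using card_similar_triangles_le[OF P ABC] by (simp add: N_def \<mu>_def \<tau>_def)
    also have "\<dots> \<le> K * (64 ^ L * 2 ^ L * card P ^ 2) + 2 * card P ^ 3" by (rule K[OF P])
    finally have "real (64 ^ L * N) \<le> real (K * (64 ^ L * 2 ^ L * card P ^ 2) + 2 * card P ^ 3)"
      by (simp only: of_nat_le_iff)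
    moreover have "real (64 ^ L) = y ^ 6" by (simp add: yp)
    ultimately have "y ^ 6 * real N \<le> real K * (y ^ 6 * y * (x ^ 7) ^ 2) + 2 * (x ^ 7) ^ 3"
      by (simp add: y_def x7)
    also have "\<dots> \<le> real K * (y ^ 6 * x * (x ^ 7) ^ 2) + 2 * (x ^ 15 * (64 * y ^ 6))"
    proof (intro add_mono mult_left_mono mult_right_mono)
      \<comment> \<open>Rounding n^(1/7) to a power of 2 costs 2^6 in n^3 / D^6; doubled, this is
        the 128 of the constant.\<close>
      have "x ^ 6 \<le> (2 * y) ^ 6" using xy x0 by (intro power_mono) auto
      then have "x ^ 15 * x ^ 6 \<le> x ^ 15 * (64 * y ^ 6)" using x0 by (intro mult_left_mono) (auto simp: power_mult_distrib)
      then show "(x ^ 7) ^ 3 \<le> x ^ 15 * (64 * y ^ 6)" by (simp flip: power_mult power_add)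
    qed (use yx x0 y0 in auto)
    also have "\<dots> = y ^ 6 * ((real K + 128) * x ^ 15)" by (simp add: algebra_simps flip: power_mult power_add power_Suc)
    finally have "real N \<le> (real K + 128) * x ^ 15" using y0 by simp
    then show ?thesis by (simp add: N_def x15)
  qed
  then show ?thesis by (intro exI[of _ "real K + 128"]) auto
qed

theorem theorem3p1:
  fixes A B C :: "real^3"
  assumes "\<not> collinear {A, B, C}"
  shows "\<exists>K>0. \<forall>P :: (real^3) set. finite P \<longrightarrow>
           real (card (similar_triangles P A B C)) \<le> K * real (card P) powr (15/7)"
proof (cases "(C - A) \<bullet> (B - A) = 0")
  case False
  then show ?thesis using similar_triangles_bound assms by blast
next
  case True
  have "A \<noteq> B" using assms by (auto simp: collinear_2)
  then have "(B - A) \<bullet> (B - A) \<noteq> 0" by simp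
  \<comment> \<open>With a right angle at A this inner product is |AB|^2, so the angle at B is not
    right and B can take the role of A.\<close>
  moreover have "(C - B) \<bullet> (A - B) = (B - A) \<bullet> (B - A) - (C - A) \<bullet> (B - A)"
    by (simp add: inner_diff_left inner_diff_right)
  ultimately have "(C - B) \<bullet> (A - B) \<noteq> 0" using True by simp
  moreover have "\<not> collinear {B, A, C}" using assms by (simp add: insert_commute)
  ultimately show ?thesis using similar_triangles_bound[of B A C] similar_triangles_swap by simp
qed

end
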